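(* (Critical-point equations of the effective action.) With the action $S[g,h]$ defined in the context for fixed boundary data $g,g'\in SL(2,\mathbb C)^{E(\gamma)}$, a configuration $(g_1,\dots,g_{N+1},h)$ in the domain of $S$ is a critical point of $S$ with respect to all the variables $g_i(e)\in SL(2,\mathbb C)$ ($i=1,\dots,N+1$, $e\in E(\gamma)$) and $h_v\in SU(2)$ ($v\in V(\gamma)$) if and only if all of the following hold, where $g_0=g'^h$, $g_{N+2}=g$ and $$Z^a_{k,l}(e):=\frac{z_{k,l}(e)\,\mathrm{tr}[\tau^ag_k(e)^\dagger g_l(e)]}{\sqrt{x_{k,l}(e)-1}\sqrt{x_{k,l}(e)+1}},\qquad W^a_k(e):=\frac{p_k(e)\,\mathrm{tr}[\tau^ag_k(e)^\dagger g_k(e)]}{\sinh(p_k(e))}.$$ (1) For $i=1,\dots,N$, every $e\in E(\gamma)$ and $a=1,2,3$: $\displaystyle Z^a_{i+1,i}(e)-W^a_i(e)=\frac{i\kappa\Delta\tau}{a^2}\frac{\partial}{\partial\varepsilon^a_i(e)}\left[\frac{\langle\psi^t_{g_{i+1}}|\hat{\mathbf H}|\psi^t_{g_i^\varepsilon}\rangle}{\langle\psi^t_{g_{i+1}}|\psi^t_{g_i^\varepsilon}\rangle}\right]_{\varepsilon=0}$. (2) For $i=2,\dots,N+1$, every $e$ and $a$: $\displaystyle Z^a_{i,i-1}(e)-W^a_i(e)=-\frac{i\kappa\Delta\tau}{a^2}\frac{\partial}{\partial\bar\varepsilon^a_i(e)}\left[\frac{\langle\psi^t_{g_i^\varepsilon}|\hat{\mathbf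 H}|\psi^t_{g_{i-1}}\rangle}{\langle\psi^t_{g_i^\varepsilon}|\psi^t_{g_{i-1}}\rangle}\right]_{\varepsilon=0}$. (3) For every $e$ and $a$: $Z^a_{N+2,N+1}(e)-W^a_{N+1}(e)=0$ and $Z^a_{1,0}(e)-W^a_1(e)=0$. (4) For every vertex $v$ and every $a$: $$-\sum_{e:\,s(e)=v}\frac{z_{1,0}(e)\,\mathrm{tr}[g_1(e)^\dagger\tau^ag'^h(e)]}{\sqrt{x_{1,0}(e)-1}\sqrt{x_{1,0}(e)+1}}+\sum_{e:\,t(e)=v}\frac{z_{1,0}(e)\,\mathrm{tr}[\tau^ag_1(e)^\dagger g'^h(e)]}{\sqrt{x_{1,0}(e)-1}\sqrt{x_{1,0}(e)+1}}=0.$$ Moreover, when $g_1=g'^h$, condition (4) is equivalent to the closure condition $$-\sum_{e:\,s(e)=v}p_1^a(e)+\sum_{e:\,t(e)=v}\Lambda^a{}_b(\vec\theta_1(e))\,p_1^b(e)=0\qquad\text{for all }v, a.$$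
   Context: $\tau^a=-i\sigma^a$ ($\sigma^a$ Pauli matrices). In prefactors such as $i\kappa\Delta\tau/a^2$ the symbol $i$ is the imaginary unit and $a$ is a positive constant (length unit); as sub/superscripts $i$ is a time-step label and $a$ an su(2) index in $\{1,2,3\}$ (repeated su(2) indices summed). $\kappa,\Delta\tau,t>0$ are constants, $N\ge1$. $\gamma$ is a finite oriented cubic lattice with edges $E(\gamma)$, vertices $V(\gamma)$; $s(e),t(e)$ are the source and target of $e$. Every $g(e)\in SL(2,\mathbb C)$ is written $g(e)=e^{-ip^a(e)\tau^a/2}e^{\theta^a(e)\tau^a/2}$ with $p^a(e),\theta^a(e)$ real, and $p(e)=\sqrt{p^a(e)p^a(e)}=\mathrm{arccosh}(\frac12\mathrm{tr}[g(e)^\dagger g(e)])$. $\Lambda(\vec\theta)\in SO(3)$ is defined by $e^{\theta^c\tau^c/2}\tau^ae^{-\theta^c\tau^c/2}=\Lambda^a{}_b(\vec\theta)\tau^b$. For $h=(h_v)\in SU(2)^{V(\gamma)}$, $g'^h(e)=h_{s(e)}^{-1}g'(e)h_{t(e)}$. Coherent states: $\psi^t_g=\bigotimes_e\psi^t_{g(e)}\in\mathcal H^0_\gamma=\bigotimes_eL^2(SU(2))$, $\psi^t_{g(e)}(u)=\sum_{j\in\{0,1/2,1,\dots\}}(2j+1)e^{-tj(j+1)/2}\chi_j(g(e)u^{-1})$, with $\chi_j$ the spin-$j$ character extended to $SL(2,\mathbb C)$. $\hat{\mathbf H}$ is a self-adjoint operator on $\mathcal H^0_\gamma$ whose domain contains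 all $\psi^t_g$. Action: with $g_0=g'^h$, $g_{N+2}=g$, $$S[g,h]=\sum_{i=0}^{N+1}\sum_{e\in E(\gamma)}\Big[z_{i+1,i}(e)^2-\tfrac12p_{i+1}(e)^2-\tfrac12p_i(e)^2\Big]-\frac{i\kappa}{a^2}\sum_{i=1}^N\Delta\tau\,\frac{\langle\psi^t_{g_{i+1}}|\hat{\mathbf H}|\psi^t_{g_i}\rangle}{\langle\psi^t_{g_{i+1}}|\psi^t_{g_i}\rangle},$$ $x_{k,l}(e)=\frac12\mathrm{tr}[g_k(e)^\dagger g_l(e)]$, $z_{k,l}(e)=\mathrm{arccosh}(x_{k,l}(e))$, $\mathrm{arccosh}(x)=\ln(x+\sqrt{x+1}\sqrt{x-1})$. The domain of $S$ consists of configurations with $x_{i+1,i}(e)\notin(-\infty,-1]$ and $\langle\psi^t_{g_{i+1}}|\psi^t_{g_i}\rangle\neq0$. The quotients $z/(\sqrt{x-1}\sqrt{x+1})$ and $p/\sinh p$ are extended continuously by the value $1$ at $x=1$ and $p=0$. Variations: $g_i^\varepsilon(e)=g_i(e)e^{\varepsilon_i^a(e)\tau^a}$ with $\varepsilon_i^a(e)\in\mathbb C$; $\partial/\partial\varepsilon,\partial/\partial\bar\varepsilon$ are Wirtinger derivatives; $h_v^\eta=h_ve^{\eta_v^a\tau^a}$ with $\eta_v^a\in\mathbb R$. Critical point means that all first-order variations of $S$ vanish. *)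

theory Defs
  imports
    "HOL-Probability.Probability"
    "HOL-Computational_Algebra.Polynomial"
    "Graph_Theory.Digraph"
begin

section \<open>Two-by-two matrices, SL(2,C) and SU(2)\<close>

type_synonym mat2 = "complex^2^2"

definition dagger :: "mat2 \<Rightarrow> mat2" where
  "dagger A = (\<chi> i j. cnj (A $ j $ i))"

definition SL2C :: "mat2 set" where
  "SL2C = {g. det g = 1}"

definition SU2 :: "mat2 set" where
  "SU2 = {u. det u = 1 \<and> dagger u ** u = mat 1 \<and> u ** dagger u = mat 1}"

text \<open>The library multiplication of vectors is componentwise, so the library function
  \<open>exp\<close> is not the matrix exponential.\<close>

definition mexp :: "mat2 \<Rightarrow> mat2" where
  "mexp A = (\<Sum>n. (1 / fact n) *\<^sub>R (((**) A ^^ n) (mat 1)))"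

text \<open>The su(2) indices range over the type \<open>3\<close>, whose elements are \<open>1\<close>, \<open>2\<close> and \<open>3\<close>
  (with \<open>3 = 0\<close>).\<close>

definition pauli :: "3 \<Rightarrow> mat2" where
  "pauli a =
    (if a = 1 then vector [vector [0, 1], vector [1, 0]]
     else if a = 2 then vector [vector [0, - \<i>], vector [\<i>, 0]]
     else vector [vector [1, 0], vector [0, - 1]])"

text \<open>\<open>mat c ** A\<close> is the multiple of the matrix \<open>A\<close> by the scalar \<open>c\<close>.\<close>

definition tau :: "3 \<Rightarrow> mat2" where
  "tau a = mat (- \<i>) ** pauli a"

definition tau_comb :: "complex^3 \<Rightarrow> mat2" where
  "tau_comb \<xi> = (\<Sum>a\<in>UNIV. mat (\<xi> $ a) ** tau a)"

definition cvec :: "real^3 \<Rightarrow> complex^3" where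
  "cvec \<eta> = (\<chi> a. complex_of_real (\<eta> $ a))"

definition polar_coords :: "mat2 \<Rightarrow> real^3 \<Rightarrow> real^3 \<Rightarrow> bool" where
  "polar_coords g p \<theta> \<longleftrightarrow>
     g = mexp (tau_comb (\<chi> a. - \<i> * of_real (p $ a) / 2)) ** mexp (tau_comb (cvec (\<theta> /\<^sub>R 2)))"

definition Lambda :: "real^3 \<Rightarrow> real^3^3" where
  "Lambda \<theta> = (THE L. \<forall>a.
     mexp (tau_comb (cvec (\<theta> /\<^sub>R 2))) ** tau a ** mexp (tau_comb (cvec (- \<theta> /\<^sub>R 2)))
       = (\<Sum>b\<in>UNIV. mat (of_real (L $ a $ b)) ** tau b))"


section \<open>Cubic lattices\<close>

text \<open>Vertices of an \<open>n\<^sub>1 \<times> n\<^sub>2 \<times> n\<^sub>3\<close> box, with one link from each vertex to its successor in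
  each of the three directions. Each direction is either periodic (the last vertex is linked
  to the first one) or has open ends. The orientation of each link is arbitrary.\<close>

definition box_vertices :: "nat^3 \<Rightarrow> (nat^3) set" where
  "box_vertices n = {x. \<forall>k. x $ k < n $ k}"

definition box_succ :: "nat^3 \<Rightarrow> nat^3 \<Rightarrow> 3 \<Rightarrow> nat^3" where
  "box_succ n x k = (\<chi> j. if j = k then (x $ j + 1) mod (n $ j) else x $ j)"

definition box_links :: "nat^3 \<Rightarrow> 3 set \<Rightarrow> ((nat^3) \<times> 3) set" where
  "box_links n periodic =
     {(x, k). x \<in> box_vertices n \<and> (k \<in> periodic \<or> x $ k + 1 < n $ k)}"

definition cubic_lattice :: "('v, 'e) pre_digraph \<Rightarrow> bool" where
  "cubic_lattice \<gamma> \<longleftrightarrow> fin_digraph \<gamma> \<and>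
     (\<exists>n periodic \<phi> link.
        (\<forall>k. 1 \<le> n $ k) \<and>
        bij_betw \<phi> (verts \<gamma>) (box_vertices n) \<and>
        bij_betw link (arcs \<gamma>) (box_links n periodic) \<and>
        (\<forall>e\<in>arcs \<gamma>. case link e of (x, k) \<Rightarrow>
           (\<phi> (tail \<gamma> e), \<phi> (head \<gamma> e)) \<in> {(x, box_succ n x k), (box_succ n x k, x)}))"


section \<open>The Hilbert space and self-adjoint operators\<close>

definition haar_SU2 :: "mat2 measure \<Rightarrow> bool" where
  "haar_SU2 \<mu> \<longleftrightarrow> prob_space \<mu> \<and> space \<mu> = SU2 \<and> sets \<mu> = sets (restrict_space borel SU2) \<and>
     (\<forall>u\<in>SU2. \<forall>A\<in>sets \<mu>. emeasure \<mu> ((**) u ` A) = emeasure \<mu> A)"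

text \<open>The tensor product of the spaces \<open>L\<^sup>2(SU(2))\<close> over the edges is \<open>L\<^sup>2\<close> of the product
  measure. Its elements are represented by square-integrable functions, and equality of
  vectors is equality almost everywhere.\<close>

definition SU2_edges :: "('v, 'e) pre_digraph \<Rightarrow> mat2 measure \<Rightarrow> ('e \<Rightarrow> mat2) measure" where
  "SU2_edges \<gamma> \<mu> = PiM (arcs \<gamma>) (\<lambda>_. \<mu>)"

definition L2 :: "'a measure \<Rightarrow> ('a \<Rightarrow> complex) set" where
  "L2 M = {f \<in> borel_measurable M. integrable M (\<lambda>x. (cmod (f x))\<^sup>2)}"

definition L2_inner :: "'a measure \<Rightarrow> ('a \<Rightarrow> complex) \<Rightarrow> ('a \<Rightarrow> complex) \<Rightarrow> complex" where
  "L2_inner M f g = (LINT x|M. cnj (f x) * g x)"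

definition L2_operator ::
  "'a measure \<Rightarrow> ('a \<Rightarrow> complex) set \<Rightarrow> (('a \<Rightarrow> complex) \<Rightarrow> ('a \<Rightarrow> complex)) \<Rightarrow> bool" where
  "L2_operator M D H \<longleftrightarrow> D \<subseteq> L2 M \<and> H ` D \<subseteq> L2 M \<and>
     (\<forall>f\<in>D. \<forall>g\<in>L2 M. (AE x in M. f x = g x) \<longrightarrow> g \<in> D \<and> (AE x in M. H f x = H g x)) \<and>
     (\<forall>f\<in>D. \<forall>g\<in>D. \<forall>c. (\<lambda>x. c * f x + g x) \<in> D \<and>
        (AE x in M. H (\<lambda>x. c * f x + g x) x = c * H f x + H g x))"

definition L2_dense :: "'a measure \<Rightarrow> ('a \<Rightarrow> complex) set \<Rightarrow> bool" where
  "L2_dense M D \<longleftrightarrow> (\<forall>f\<in>L2 M. \<forall>\<epsilon>>0. \<exists>d\<in>D. (LINT x|M. (cmod (f x - d x))\<^sup>2) < \<epsilon>)"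

text \<open>\<open>adjoint_graph M D H\<close> is the graph of the adjoint of the operator \<open>H\<close> with domain \<open>D\<close>,
  and self-adjointness is equality of this graph with that of \<open>H\<close>, so the domains of
  \<open>H\<close> and of its adjoint coincide.\<close>

definition adjoint_graph ::
  "'a measure \<Rightarrow> ('a \<Rightarrow> complex) set \<Rightarrow> (('a \<Rightarrow> complex) \<Rightarrow> ('a \<Rightarrow> complex)) \<Rightarrow>
     (('a \<Rightarrow> complex) \<times> ('a \<Rightarrow> complex)) set" where
  "adjoint_graph M D H =
     {(f, k) \<in> L2 M \<times> L2 M. \<forall>d\<in>D. L2_inner M f (H d) = L2_inner M k d}"

definition self_adjoint_operator ::
  "'a measure \<Rightarrow> ('a \<Rightarrow> complex) set \<Rightarrow> (('a \<Rightarrow> complex) \<Rightarrow> ('a \<Rightarrow> complex)) \<Rightarrow> bool" where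
  "self_adjoint_operator M D H \<longleftrightarrow> L2_operator M D H \<and> L2_dense M D \<and>
     adjoint_graph M D H = {(f, k) \<in> D \<times> L2 M. AE x in M. k x = H f x}"


section \<open>Coherent states\<close>

text \<open>\<open>spin_char n\<close> is the character of spin \<open>j = n / 2\<close>: the trace of the action of \<open>g\<close> by
  linear substitution on homogeneous polynomials of degree \<open>n\<close> in two variables. The image of
  the basis vector \<open>X\<^bsup>n - k\<^esup> Y\<^bsup>k\<^esup>\<close> is
  \<open>(g\<^sub>1\<^sub>1 X + g\<^sub>2\<^sub>1 Y)\<^bsup>n - k\<^esup> (g\<^sub>1\<^sub>2 X + g\<^sub>2\<^sub>2 Y)\<^bsup>k\<^esup>\<close>, and
  its coefficient along the same basis vector is read off after setting \<open>X = 1\<close>.\<close>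

definition spin_char :: "nat \<Rightarrow> mat2 \<Rightarrow> complex" where
  "spin_char n g =
     (\<Sum>k\<le>n. poly.coeff ([: g $ 1 $ 1, g $ 2 $ 1 :] ^ (n - k) * [: g $ 1 $ 2, g $ 2 $ 2 :] ^ k) k)"

text \<open>The sum over spins \<open>j\<close> runs over \<open>n = 2 j\<close>.\<close>

definition edge_state :: "real \<Rightarrow> mat2 \<Rightarrow> mat2 \<Rightarrow> complex" where
  "edge_state t g u =
     (\<Sum>n. let j = real n / 2 in
        of_real ((2 * j + 1) * exp (- t * j * (j + 1) / 2)) * spin_char n (g ** matrix_inv u))"

definition coherent_state ::
  "('v, 'e) pre_digraph \<Rightarrow> real \<Rightarrow> ('e \<Rightarrow> mat2) \<Rightarrow> ('e \<Rightarrow> mat2) \<Rightarrow> complex" where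
  "coherent_state \<gamma> t g u = (\<Prod>e\<in>arcs \<gamma>. edge_state t (g e) (u e))"

definition overlap ::
  "('v, 'e) pre_digraph \<Rightarrow> mat2 measure \<Rightarrow> real \<Rightarrow> ('e \<Rightarrow> mat2) \<Rightarrow> ('e \<Rightarrow> mat2) \<Rightarrow> complex" where
  "overlap \<gamma> \<mu> t g1 g2 =
     L2_inner (SU2_edges \<gamma> \<mu>) (coherent_state \<gamma> t g1) (coherent_state \<gamma> t g2)"

type_synonym 'e op = "(('e \<Rightarrow> mat2) \<Rightarrow> complex) \<Rightarrow> (('e \<Rightarrow> mat2) \<Rightarrow> complex)"

definition H_ratio ::
  "('v, 'e) pre_digraph \<Rightarrow> mat2 measure \<Rightarrow> 'e op \<Rightarrow> real \<Rightarrow> ('e \<Rightarrow> mat2) \<Rightarrow> ('e \<Rightarrow> mat2) \<Rightarrow> complex"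
  where
  "H_ratio \<gamma> \<mu> H t g1 g2 =
     L2_inner (SU2_edges \<gamma> \<mu>) (coherent_state \<gamma> t g1) (H (coherent_state \<gamma> t g2))
       / overlap \<gamma> \<mu> t g1 g2"


section \<open>The action\<close>

text \<open>The polymorphic library function \<open>arcosh\<close> uses the principal root of \<open>x\<^sup>2 - 1\<close>, which
  on complex arguments is a different branch.\<close>

definition carcosh :: "complex \<Rightarrow> complex" where
  "carcosh x = Ln (x + csqrt (x + 1) * csqrt (x - 1))"

definition x_of :: "mat2 \<Rightarrow> mat2 \<Rightarrow> complex" where
  "x_of g1 g2 = trace (dagger g1 ** g2) / 2"

definition z_of :: "mat2 \<Rightarrow> mat2 \<Rightarrow> complex" where
  "z_of g1 g2 = carcosh (x_of g1 g2)"

text \<open>The trace of \<open>dagger g ** g\<close> is real, so taking the real part loses nothing.\<close>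

definition p_of :: "mat2 \<Rightarrow> real" where
  "p_of g = arcosh (Re (x_of g g))"

definition gauge_transform ::
  "('v, 'e) pre_digraph \<Rightarrow> ('v \<Rightarrow> mat2) \<Rightarrow> ('e \<Rightarrow> mat2) \<Rightarrow> ('e \<Rightarrow> mat2)" where
  "gauge_transform \<gamma> h g e = matrix_inv (h (tail \<gamma> e)) ** g e ** h (head \<gamma> e)"

text \<open>The full sequence \<open>g\<^sub>0, \<dots>, g\<^bsub>N+2\<^esub>\<close>, including the boundary data \<open>gi\<close>
  (gauge transformed by \<open>h\<close>) at the initial and \<open>gf\<close> at the final end.\<close>

definition slice ::
  "('v, 'e) pre_digraph \<Rightarrow> nat \<Rightarrow> ('e \<Rightarrow> mat2) \<Rightarrow> ('e \<Rightarrow> mat2) \<Rightarrow>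
     (nat \<Rightarrow> 'e \<Rightarrow> mat2) \<Rightarrow> ('v \<Rightarrow> mat2) \<Rightarrow> nat \<Rightarrow> 'e \<Rightarrow> mat2" where
  "slice \<gamma> N gf gi g h i =
     (if i = 0 then gauge_transform \<gamma> h gi else if i = N + 2 then gf else g i)"

text \<open>The length unit is called \<open>len\<close>, to distinguish it from su(2) indices.\<close>

definition action ::
  "('v, 'e) pre_digraph \<Rightarrow> mat2 measure \<Rightarrow> 'e op \<Rightarrow> real \<Rightarrow> real \<Rightarrow> real \<Rightarrow> real \<Rightarrow> nat \<Rightarrow>
     ('e \<Rightarrow> mat2) \<Rightarrow> ('e \<Rightarrow> mat2) \<Rightarrow> (nat \<Rightarrow> 'e \<Rightarrow> mat2) \<Rightarrow> ('v \<Rightarrow> mat2) \<Rightarrow> complex" where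
  "action \<gamma> \<mu> H \<kappa> \<Delta>\<tau> len t N gf gi g h =
     (let G = slice \<gamma> N gf gi g h in
      (\<Sum>i=0..N+1. \<Sum>e\<in>arcs \<gamma>.
         (z_of (G (i+1) e) (G i e))\<^sup>2
           - of_real ((p_of (G (i+1) e))\<^sup>2) / 2 - of_real ((p_of (G i e))\<^sup>2) / 2)
      - \<i> * of_real \<kappa> / of_real (len\<^sup>2) *
          (\<Sum>i=1..N. of_real \<Delta>\<tau> * H_ratio \<gamma> \<mu> H t (G (i+1)) (G i)))"

definition configurations ::
  "('v, 'e) pre_digraph \<Rightarrow> nat \<Rightarrow> ((nat \<Rightarrow> 'e \<Rightarrow> mat2) \<times> ('v \<Rightarrow> mat2)) set" where
  "configurations \<gamma> N =
     {(g, h). (\<forall>i\<in>{1..N+1}. \<forall>e\<in>arcs \<gamma>. g i e \<in> SL2C) \<and> (\<forall>v\<in>verts \<gamma>. h v \<in> SU2)}"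

text \<open>Each condition is imposed for the indices at which the quantity occurs in the action.\<close>

definition action_domain ::
  "('v, 'e) pre_digraph \<Rightarrow> mat2 measure \<Rightarrow> real \<Rightarrow> nat \<Rightarrow> ('e \<Rightarrow> mat2) \<Rightarrow> ('e \<Rightarrow> mat2) \<Rightarrow>
     ((nat \<Rightarrow> 'e \<Rightarrow> mat2) \<times> ('v \<Rightarrow> mat2)) set" where
  "action_domain \<gamma> \<mu> t N gf gi =
     {(g, h) \<in> configurations \<gamma> N.
        let G = slice \<gamma> N gf gi g h in
        (\<forall>i\<in>{0..N+1}. \<forall>e\<in>arcs \<gamma>. x_of (G (i+1) e) (G i e) \<notin> complex_of_real ` {..-1}) \<and>
        (\<forall>i\<in>{1..N}. overlap \<gamma> \<mu> t (G (i+1)) (G i) \<noteq> 0)}"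


section \<open>Variations and critical points\<close>

text \<open>Right variation of a single group variable: \<open>f x\<close> is replaced by
  \<open>f x e\<^bsup>\<xi>\<cdot>\<tau>\<^esup>\<close>.\<close>

definition vary :: "('x \<Rightarrow> mat2) \<Rightarrow> 'x \<Rightarrow> complex^3 \<Rightarrow> ('x \<Rightarrow> mat2)" where
  "vary f x \<xi> = f(x := f x ** mexp (tau_comb \<xi>))"

definition wirtinger :: "(complex \<Rightarrow> complex) \<Rightarrow> complex \<Rightarrow> complex" where
  "wirtinger f w =
     (frechet_derivative f (at w) 1 - \<i> * frechet_derivative f (at w) \<i>) / 2"

definition wirtinger_bar :: "(complex \<Rightarrow> complex) \<Rightarrow> complex \<Rightarrow> complex" where
  "wirtinger_bar f w =
     (frechet_derivative f (at w) 1 + \<i> * frechet_derivative f (at w) \<i>) / 2"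

text \<open>The real differential of \<open>S\<close> with respect to each variable vanishes. For the variables
  \<open>g\<^sub>i(e)\<close> this is the vanishing of the derivatives with respect to all \<open>\<epsilon>\<^sub>i\<^sup>a(e)\<close> and their
  conjugates.\<close>

definition critical_point ::
  "('v, 'e) pre_digraph \<Rightarrow> nat \<Rightarrow> ((nat \<Rightarrow> 'e \<Rightarrow> mat2) \<Rightarrow> ('v \<Rightarrow> mat2) \<Rightarrow> complex) \<Rightarrow>
     (nat \<Rightarrow> 'e \<Rightarrow> mat2) \<Rightarrow> ('v \<Rightarrow> mat2) \<Rightarrow> bool" where
  "critical_point \<gamma> N S g h \<longleftrightarrow>
     (\<forall>i\<in>{1..N+1}. \<forall>e\<in>arcs \<gamma>.
        ((\<lambda>\<epsilon>::complex^3. S (g(i := vary (g i) e \<epsilon>)) h) has_derivative (\<lambda>_. 0)) (at 0)) \<and>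
     (\<forall>v\<in>verts \<gamma>.
        ((\<lambda>\<eta>::real^3. S g (vary h v (cvec \<eta>))) has_derivative (\<lambda>_. 0)) (at 0))"


section \<open>The quantities in the critical equations\<close>

text \<open>\<open>z / (sqrt (x - 1) sqrt (x + 1))\<close> and \<open>p / sinh p\<close>, extended continuously.\<close>

definition z_quot :: "complex \<Rightarrow> complex" where
  "z_quot x = (if x = 1 then 1 else carcosh x / (csqrt (x - 1) * csqrt (x + 1)))"

definition p_quot :: "real \<Rightarrow> real" where
  "p_quot p = (if p = 0 then 1 else p / sinh p)"

definition Z_of :: "3 \<Rightarrow> mat2 \<Rightarrow> mat2 \<Rightarrow> complex" where
  "Z_of a g1 g2 = z_quot (x_of g1 g2) * trace (tau a ** dagger g1 ** g2)"

definition W_of :: "3 \<Rightarrow> mat2 \<Rightarrow> complex" where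
  "W_of a g = of_real (p_quot (p_of g)) * trace (tau a ** dagger g ** g)"

definition vertex_condition ::
  "('v, 'e) pre_digraph \<Rightarrow> ('e \<Rightarrow> mat2) \<Rightarrow> ('e \<Rightarrow> mat2) \<Rightarrow> bool" where
  "vertex_condition \<gamma> g1 g0 \<longleftrightarrow> (\<forall>v\<in>verts \<gamma>. \<forall>a.
     - (\<Sum>e\<in>out_arcs \<gamma> v.
          z_quot (x_of (g1 e) (g0 e)) * trace (dagger (g1 e) ** tau a ** g0 e))
     + (\<Sum>e\<in>in_arcs \<gamma> v.
          z_quot (x_of (g1 e) (g0 e)) * trace (tau a ** dagger (g1 e) ** g0 e)) = 0)"

definition closure_condition ::
  "('v, 'e) pre_digraph \<Rightarrow> ('e \<Rightarrow> real^3) \<Rightarrow> ('e \<Rightarrow> real^3) \<Rightarrow> bool" where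
  "closure_condition \<gamma> p \<theta> \<longleftrightarrow> (\<forall>v\<in>verts \<gamma>. \<forall>a.
     - (\<Sum>e\<in>out_arcs \<gamma> v. p e $ a)
     + (\<Sum>e\<in>in_arcs \<gamma> v. \<Sum>b\<in>UNIV. Lambda (\<theta> e) $ a $ b * p e $ b) = 0)"

end

(*
On SL(2,C) the characters are Chebyshev polynomials of the trace, so an edge state is an entire
function of tr(g u^-1). As H is self-adjoint, <psi_k|H psi_g> = <H psi_k|psi_g> is holomorphic
in g, and it is antiholomorphic in k. The square of the complex arcosh is holomorphic off (-oo,-1], even at its branch point 1, with derivative
2 z / (sqrt (x - 1) sqrt (x + 1)), and p(g)^2 = z(g,g)^2 on SL(2,C). The differential of S in
g_i(e) is therefore a linear form in epsilon plus a linear form in its conjugate. They vanish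
separately, the first giving the equations with Z_{i+1,i} and the second those with Z_{i,i-1}.
The variables h enter through g_0 only, and p_0 does not depend on h, which leaves the derivative
of z_{1,0}^2. For g_1 = g_0 the traces are components of g g^dagger = exp(-p.sigma), conjugated by
the SU(2) factor in the terms with t(e) = v.
*)
theory Submission
  imports Defs "HOL-Complex_Analysis.Cauchy_Integral_Formula" "HOL-Real_Asymp.Real_Asymp"
begin

section \<open>Two-by-two matrices\<close>

text \<open>\<open>H\<close> may be unbounded, so nothing says that its value at a coherent state
  depends differentiably on the label. Every variation is therefore moved to a coherent state paired
  with a fixed \<open>L2\<close> function; the domination needed under the integral comes from the
  boundedness of SU(2). As an edge state is an entire function of an expression linear in the
  matrix, the differentiation takes place in the vector space of all 2 x 2 matrices, and SL(2,C)
  returns through the curve given by the exponential. \<open>critical_point\<close> asks for a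
  Frechet derivative, while three ingredients are not smooth: the root in the closed form of the
  exponential, the roots in \<open>carcosh\<close>, and the real arcosh at p = 0. In each case only
  an even function of the root occurs, and that one is differentiable. W appears in both families of
  equations because the halves of the squared momentum in the two steps around slice i add up to
  z(g_i, g_i)^2, whose differential has a linear and an antilinear part.\<close>

lemma mat2_eq_iff:
  fixes A B :: "'a^2^2"
  shows "A = B \<longleftrightarrow> A$1$1 = B$1$1 \<and> A$1$2 = B$1$2 \<and> A$2$1 = B$2$1 \<and> A$2$2 = B$2$2"
  by (auto simp: vec_eq_iff forall_2)

lemma mmult_entry:
  fixes A B :: "'a::semiring_1^2^2"
  shows "(A ** B)$i$j = A$i$1 * B$1$j + A$i$2 * B$2$j"
  by (simp add: matrix_matrix_mult_def sum_2)

lemma mat_entry: "(mat c :: 'a::zero^'n^'n)$i$j = (if i = j then c else 0)"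
  by (simp add: mat_def)

lemma smult_entry:
  fixes A :: "mat2"
  shows "(mat c ** A)$i$j = c * A$i$j"
  using exhaust_2[of i] by (auto simp: mmult_entry mat_entry)

lemma dagger_entry: "dagger A $ i $ j = cnj (A $ j $ i)"
  by (simp add: dagger_def)

lemma trace_mat2: "trace (A :: 'a::semiring_1^2^2) = A$1$1 + A$2$2"
  by (simp add: trace_def sum_2)

lemma tau_entry:
  "tau 1 $ 1 $ 1 = 0" "tau 1 $ 1 $ 2 = - \<i>" "tau 1 $ 2 $ 1 = - \<i>" "tau 1 $ 2 $ 2 = 0"
  "tau 2 $ 1 $ 1 = 0" "tau 2 $ 1 $ 2 = - 1" "tau 2 $ 2 $ 1 = 1" "tau 2 $ 2 $ 2 = 0"
  "tau 3 $ 1 $ 1 = - \<i>" "tau 3 $ 1 $ 2 = 0" "tau 3 $ 2 $ 1 = 0" "tau 3 $ 2 $ 2 = \<i>"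
  unfolding tau_def smult_entry pauli_def by (simp_all add: vector_2)

lemma tau_comb_entry:
  "tau_comb \<xi> $ 1 $ 1 = - \<i> * \<xi>$3" "tau_comb \<xi> $ 1 $ 2 = - \<i> * \<xi>$1 - \<xi>$2"
  "tau_comb \<xi> $ 2 $ 1 = - \<i> * \<xi>$1 + \<xi>$2" "tau_comb \<xi> $ 2 $ 2 = \<i> * \<xi>$3"
  unfolding tau_comb_def by (simp_all add: sum_3 smult_entry tau_entry)

text \<open>Rewriting with these reduces matrix and trace identities to polynomial identities
  between entries.\<close>

lemmas mat2_simps = mat2_eq_iff mmult_entry mat_entry dagger_entry trace_mat2
  tau_entry tau_comb_entry det_2

lemma dagger_mult: "dagger (A ** B) = dagger B ** dagger A"
  by (simp add: mat2_simps mult.commute add.commute)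

lemma dagger_dagger [simp]: "dagger (dagger A) = A"
  by (simp add: mat2_simps)

lemma dagger_mat: "dagger (mat c) = mat (cnj c)"
  by (simp add: mat2_simps)

lemma dagger_add: "dagger (A + B) = dagger A + dagger B"
  by (simp add: mat2_simps)

lemma det_dagger: "det (dagger A) = cnj (det A)"
  by (simp add: mat2_simps)

lemma mat_mult_commute: "mat c ** A = A ** mat c" for A :: mat2
  by (simp add: mat2_simps mult.commute)

text \<open>The \<open>tau a\<close> anticommute and square to minus one, so every element of
  sl(2,C) has a scalar square. This gives the exponential a closed form.\<close>

lemma tau_comb_square: "tau_comb \<xi> ** tau_comb \<xi> = mat (- (\<Sum>a\<in>UNIV. (\<xi>$a)\<^sup>2))"
  by (simp add: mat2_simps sum_3 algebra_simps power2_eq_square)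

lemma bounded_linear_smult: "bounded_linear (\<lambda>c. mat c ** (A :: mat2))"
proof -
  have "linear (\<lambda>c. mat c ** (A :: mat2))"
    by (rule linearI) (simp_all add: mat2_simps algebra_simps)
  then show ?thesis by (simp add: linear_conv_bounded_linear)
qed

lemma bounded_bilinear_mmult: "bounded_bilinear ((**) :: mat2 \<Rightarrow> mat2 \<Rightarrow> mat2)"
proof -
  have "bilinear ((**) :: mat2 \<Rightarrow> mat2 \<Rightarrow> mat2)"
    unfolding bilinear_def by (auto intro!: linearI simp: mat2_simps algebra_simps)
  then show ?thesis by (simp add: bilinear_conv_bounded_bilinear)
qed

lemma bounded_linear_dagger: "bounded_linear dagger"
proof -
  have "linear dagger"
    by (rule linearI) (simp_all add: mat2_simps)
  then show ?thesis by (simp add: linear_conv_bounded_linear)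
qed

lemma bounded_linear_trace: "bounded_linear (trace :: mat2 \<Rightarrow> complex)"
proof -
  have "linear (trace :: mat2 \<Rightarrow> complex)"
    by (rule linearI) (simp_all add: mat2_simps algebra_simps)
  then show ?thesis by (simp add: linear_conv_bounded_linear)
qed

section \<open>The matrix exponential on \<open>sl(2,C)\<close>\<close>

text \<open>Like cosh, this is an even function, so the sign of the root \<open>w\<close> in the
  closed form of the exponential is immaterial. The value at 0 is the limit.\<close>

definition sinhc :: "complex \<Rightarrow> complex" where
  "sinhc w = (if w = 0 then 1 else sinh w / w)"

text \<open>Even powers of \<open>A\<close> are scalars and odd powers are scalar multiples of
  \<open>A\<close>, so the series splits into that of cosh w and that of sinh w divided by
  w.\<close>

lemma mexp_eq:
  assumes "A ** A = mat (w\<^sup>2)"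
  shows "mexp A = mat (cosh w) + mat (sinhc w) ** A"
proof -
  \<comment> \<open>The exponent \<open>n - 1\<close> in place of a division by \<open>w\<close>
    keeps the formula valid at \<open>w = 0\<close>.\<close>
  have pow: "((**) A ^^ n) (mat 1) =
      mat (if even n then w ^ n else 0) + mat (if odd n then w ^ (n - 1) else 0) ** A" for n
  proof (induction n)
    case 0
    show ?case by (simp add: mat2_simps)
  next
    case (Suc n)
    have "A ** (mat c + mat d ** A) = mat c ** A + mat d ** (A ** A)" for c d
      by (simp add: mat2_simps algebra_simps)
    then have "((**) A ^^ Suc n) (mat 1) =
        mat (if even n then w ^ n else 0) ** A
          + mat (if odd n then w ^ (n - 1) else 0) ** mat (w\<^sup>2)"
      using Suc assms by simp
    also have "\<dots> = mat (if even (Suc n) then w ^ Suc n else 0)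
        + mat (if odd (Suc n) then w ^ (Suc n - 1) else 0) ** A"
    proof (cases "even n")
      case False
      then obtain m where "n = Suc m" by (cases n) auto
      with False show ?thesis by (simp add: mat2_simps power2_eq_square)
    qed (simp add: mat2_simps)
    finally show ?case .
  qed
  have c: "(\<lambda>n. if even n then w ^ n /\<^sub>R fact n else 0) sums cosh w"
    by (rule cosh_converges)
  have s: "(\<lambda>n. if odd n then w ^ (n - 1) /\<^sub>R fact n else 0) sums sinhc w"
  proof (cases "w = 0")
    case True
    have "(\<lambda>n. if n = 1 then 1 else 0 :: complex) sums 1"
      using sums_single[of 1 "\<lambda>_. 1 :: complex"] by simp
    moreover have "(\<lambda>n. if odd n then w ^ (n - 1) /\<^sub>R fact n else 0)
        = (\<lambda>n. if n = 1 then 1 else 0)"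
      using True by (auto simp: fun_eq_iff power_0_left le_Suc_eq)
    ultimately show ?thesis using True by (simp add: sinhc_def)
  next
    case False
    have "(\<lambda>n. (if even n then 0 else w ^ n /\<^sub>R fact n) / w) sums (sinh w / w)"
      by (intro sums_divide sinh_converges)
    moreover have "(\<lambda>n. (if even n then 0 else w ^ n /\<^sub>R fact n) / w)
        = (\<lambda>n. if odd n then w ^ (n - 1) /\<^sub>R fact n else 0)"
    proof
      fix n
      show "(if even n then 0 else w ^ n /\<^sub>R fact n) / w
        = (if odd n then w ^ (n - 1) /\<^sub>R fact n else 0)"
        using False by (cases n) (auto simp: field_simps scaleR_conv_of_real)
    qed
    ultimately show ?thesis using False by (simp add: sinhc_def)
  qed
  have "(\<lambda>n. mat (if even n then w ^ n /\<^sub>R fact n else 0) ** mat 1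
       + mat (if odd n then w ^ (n - 1) /\<^sub>R fact n else 0) ** A)
      sums (mat (cosh w) ** mat 1 + mat (sinhc w) ** A)"
    by (intro sums_add bounded_linear.sums[OF bounded_linear_smult] c s)
  moreover have "mat (if even n then w ^ n /\<^sub>R fact n else 0) ** mat 1
       + mat (if odd n then w ^ (n - 1) /\<^sub>R fact n else 0) ** A
      = (1 / fact n) *\<^sub>R (((**) A ^^ n) (mat 1))" for n
    unfolding pow by (simp add: mat2_simps) (simp add: scaleR_conv_of_real field_simps)
  ultimately show ?thesis
    unfolding mexp_def by (simp add: sums_iff)
qed

lemma tau_comb_square_csqrt:
  "tau_comb \<xi> ** tau_comb \<xi> = mat ((csqrt (- (\<Sum>a\<in>UNIV. (\<xi>$a)\<^sup>2)))\<^sup>2)"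
  unfolding tau_comb_square by simp

lemma sinhc_mult: "sinhc w * w = sinh w"
  by (simp add: sinhc_def)

text \<open>The half-angle formula without a division. It exhibits cosh w - 1 as a second-order
  quantity, both at the origin of the exponential and at the branch point of
  \<open>carcosh\<close>.\<close>

lemma cosh_eq_sinhc: "cosh w = 1 + (sinhc (w / 2))\<^sup>2 / 2 * w\<^sup>2"
proof -
  have "cosh w = 1 + 2 * (sinh (w / 2))\<^sup>2"
    using cosh_double[of "w / 2"] cosh_square_eq[of "w / 2"] by simp
  also have "\<dots> = 1 + (sinhc (w / 2))\<^sup>2 / 2 * w\<^sup>2"
    by (simp flip: sinhc_mult add: power_mult_distrib power_divide)
  finally show ?thesis .
qed

text \<open>For a traceless \<open>A\<close> with square w^2, the determinant of c + s A is c^2 -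
  s^2 w^2, here cosh^2 - sinh^2.\<close>

lemma det_mexp_tau_comb: "det (mexp (tau_comb \<xi>)) = 1"
proof -
  define w where "w = csqrt (- (\<Sum>a\<in>UNIV. (\<xi>$a)\<^sup>2))"
  have sq: "tau_comb \<xi> ** tau_comb \<xi> = mat (w\<^sup>2)"
    unfolding w_def by (rule tau_comb_square_csqrt)
  have w2: "w\<^sup>2 = - (\<Sum>a\<in>UNIV. (\<xi>$a)\<^sup>2)" by (simp add: w_def)
  have "det (mexp (tau_comb \<xi>)) = (cosh w)\<^sup>2 - (sinhc w)\<^sup>2 * w\<^sup>2"
    unfolding mexp_eq[OF sq] w2
    by (simp add: mat2_simps sum_3 algebra_simps power2_eq_square)
  also have "\<dots> = (cosh w)\<^sup>2 - (sinh w)\<^sup>2"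
    by (simp flip: sinhc_mult add: power_mult_distrib)
  finally show ?thesis by (simp add: cosh_square_eq)
qed

lemma mexp_mult_minus: "mexp (tau_comb \<xi>) ** mexp (tau_comb (- \<xi>)) = mat 1"
proof -
  define w where "w = csqrt (- (\<Sum>a\<in>UNIV. (\<xi>$a)\<^sup>2))"
  have sq: "tau_comb \<xi> ** tau_comb \<xi> = mat (w\<^sup>2)"
    unfolding w_def by (rule tau_comb_square_csqrt)
  have sq': "tau_comb (-\<xi>) ** tau_comb (-\<xi>) = mat (w\<^sup>2)"
    unfolding w_def tau_comb_square by simp
  have w2: "w\<^sup>2 = - (\<Sum>a\<in>UNIV. (\<xi>$a)\<^sup>2)" by (simp add: w_def)
  have "mexp (tau_comb \<xi>) ** mexp (tau_comb (- \<xi>)) = mat ((cosh w)\<^sup>2 - (sinhc w)\<^sup>2 * w\<^sup>2)"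
    unfolding mexp_eq[OF sq] mexp_eq[OF sq'] w2
    by (simp add: mat2_simps sum_3 algebra_simps power2_eq_square)
  also have "(cosh w)\<^sup>2 - (sinhc w)\<^sup>2 * w\<^sup>2 = (cosh w)\<^sup>2 - (sinh w)\<^sup>2"
    by (simp flip: sinhc_mult add: power_mult_distrib)
  finally show ?thesis by (simp add: cosh_square_eq)
qed

lemma cnj_cosh: "cnj (cosh w) = cosh (cnj w)"
  by (simp add: cosh_def exp_cnj scaleR_conv_of_real)

lemma cnj_sinhc: "cnj (sinhc w) = sinhc (cnj w)"
  by (simp add: sinhc_def sinh_def exp_cnj scaleR_conv_of_real)

lemma dagger_mexp_tau_comb: "dagger (mexp (tau_comb \<xi>)) = mexp (dagger (tau_comb \<xi>))"
proof -
  define w where "w = csqrt (- (\<Sum>a\<in>UNIV. (\<xi>$a)\<^sup>2))"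
  have sq: "tau_comb \<xi> ** tau_comb \<xi> = mat (w\<^sup>2)"
    unfolding w_def by (rule tau_comb_square_csqrt)
  have sq': "dagger (tau_comb \<xi>) ** dagger (tau_comb \<xi>) = mat ((cnj w)\<^sup>2)"
    using arg_cong[OF sq, of dagger] by (simp add: dagger_mult dagger_mat)
  show ?thesis
    unfolding mexp_eq[OF sq] mexp_eq[OF sq'] dagger_add dagger_mult dagger_mat
    by (simp add: cnj_cosh cnj_sinhc mat_mult_commute)
qed

lemma mexp_0: "mexp (tau_comb 0) = mat 1"
proof -
  have "tau_comb 0 ** tau_comb 0 = mat (0\<^sup>2)" by (simp add: mat2_simps)
  then show ?thesis unfolding mexp_eq[OF \<open>tau_comb 0 ** tau_comb 0 = mat (0\<^sup>2)\<close>] by (simp add: mat2_simps)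
qed

section \<open>Unitary matrices and the groups SU(2) and SL(2,C)\<close>

lemma SU2D: "u \<in> SU2 \<Longrightarrow> det u = 1" "u \<in> SU2 \<Longrightarrow> dagger u ** u = mat 1"
    "u \<in> SU2 \<Longrightarrow> u ** dagger u = mat 1"
  by (auto simp: SU2_def)

lemma cvec_minus: "cvec (- \<eta>) = - cvec \<eta>"
  by (simp add: cvec_def vec_eq_iff)

lemma dagger_mexp_cvec: "dagger (mexp (tau_comb (cvec \<eta>))) = mexp (tau_comb (cvec (- \<eta>)))"
proof -
  have "dagger (tau_comb (cvec \<eta>)) = tau_comb (cvec (- \<eta>))"
    by (simp add: mat2_simps cvec_def)
  then show ?thesis by (simp add: dagger_mexp_tau_comb)
qed

text \<open>For real components the dagger reverses the sign of the exponent and so produces the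
  inverse.\<close>

lemma mexp_real_SU2: "mexp (tau_comb (cvec \<eta>)) \<in> SU2"
  using mexp_mult_minus[of "cvec \<eta>"] mexp_mult_minus[of "- cvec \<eta>"]
  by (simp add: SU2_def det_mexp_tau_comb dagger_mexp_cvec cvec_minus)

lemma SU2_mult: "u \<in> SU2 \<Longrightarrow> v \<in> SU2 \<Longrightarrow> u ** v \<in> SU2"
proof -
  assume u: "u \<in> SU2" and v: "v \<in> SU2"
  have "dagger v ** dagger u ** (u ** v) = dagger v ** (dagger u ** u) ** v"
    by (simp add: matrix_mul_assoc)
  moreover have "u ** v ** (dagger v ** dagger u) = u ** (v ** dagger v) ** dagger u"
    by (simp add: matrix_mul_assoc)
  ultimately show ?thesis using SU2D[OF u] SU2D[OF v]
    by (simp add: SU2_def det_mul dagger_mult)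
qed

lemma SU2_dagger: "u \<in> SU2 \<Longrightarrow> dagger u \<in> SU2"
  by (simp add: SU2_def det_dagger)

text \<open>\<open>matrix_inv\<close> chooses a two-sided inverse. The dagger shows that one exists,
  and associativity makes it unique.\<close>

lemma matrix_inv_SU2:
  assumes "u \<in> SU2"
  shows "matrix_inv u = dagger u"
proof -
  have "u ** dagger u = mat 1 \<and> dagger u ** u = mat 1"
    using assms by (simp add: SU2_def)
  then have *: "u ** matrix_inv u = mat 1 \<and> matrix_inv u ** u = mat 1"
    unfolding matrix_inv_def by (rule someI)
  have "matrix_inv u = (dagger u ** u) ** matrix_inv u"
    using assms by (simp add: SU2_def)
  also have "\<dots> = dagger u ** (u ** matrix_inv u)" by (simp add: matrix_mul_assoc)
  finally show ?thesis using * by simp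
qed

lemma SL2C_mult: "g \<in> SL2C \<Longrightarrow> g' \<in> SL2C \<Longrightarrow> g ** g' \<in> SL2C"
  by (simp add: SL2C_def det_mul)

lemma SU2_SL2C: "u \<in> SU2 \<Longrightarrow> u \<in> SL2C"
  by (simp add: SU2_def SL2C_def)

lemma mexp_SL2C: "mexp (tau_comb \<xi>) \<in> SL2C"
  by (simp add: SL2C_def det_mexp_tau_comb)

section \<open>The differential of the exponential at the origin\<close>

lemma sinhc_tendsto: "sinhc \<midarrow>0\<rightarrow> 1"
proof -
  have "(sinh has_field_derivative cosh 0) (at (0::complex))"
    by (rule derivative_eq_intros refl | simp)+
  then have "(\<lambda>h. sinh h / h) \<midarrow>0\<rightarrow> (1::complex)"
    by (simp add: DERIV_def)
  then show ?thesis
    by (rule Lim_transform_eventually) (auto simp: sinhc_def eventually_at_filter)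
qed

text \<open>A linear form is already of first order, so a limit of its cofactor determines the
  derivative of the product. This admits cofactors built from a complex square root.\<close>

lemma has_derivative_mult_linear_0:
  fixes f L :: "'a::real_normed_vector \<Rightarrow> complex"
  assumes f: "(f \<longlongrightarrow> l) (at 0)" and L: "bounded_linear L"
  shows "((\<lambda>x. f x * L x) has_derivative (\<lambda>x. l * L x)) (at 0)"
proof -
  obtain K where K: "\<And>x. norm (L x) \<le> norm x * K"
    using bounded_linear.bounded[OF L] by blast
  interpret L: bounded_linear L by fact
  have "(\<lambda>h. norm ((f h - l) * L h) / norm h) \<midarrow>0\<rightarrow> 0"
  proof (rule Lim_null_comparison)
    have "norm (f h - l) * norm (L h) / norm h \<le> norm (f h - l) * K" if "h \<noteq> 0" for h
    proof -
      have "norm (L h) / norm h \<le> K" using K[of h] that by (simp add: field_simps)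
      then show ?thesis
        by (metis mult_left_mono norm_ge_zero times_divide_eq_right)
    qed
    then show "\<forall>\<^sub>F h in at 0. norm (norm ((f h - l) * L h) / norm h) \<le> norm (f h - l) * K"
      by (auto simp: eventually_at_filter norm_mult)
    have "((\<lambda>h. norm (f h - l)) \<longlongrightarrow> 0) (at 0)"
      using f by (simp add: LIM_zero tendsto_norm_zero)
    then show "((\<lambda>h. norm (f h - l) * K) \<longlongrightarrow> 0) (at 0)"
      by (simp add: tendsto_mult_left_zero)
  qed
  then show ?thesis
    unfolding has_derivative_at
    by (simp add: L.zero algebra_simps bounded_linear_const_mult L)
qed

text \<open>The root \<open>w \<xi>\<close> is not differentiable at 0, which rules out the chain
  rule. Its convergence to 0 is enough, because \<open>cosh (w \<xi>) - 1\<close> and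
  \<open>sinhc (w \<xi>)\<close> enter multiplied by components of \<open>\<xi>\<close> or can be
  factored that way.\<close>

lemma mexp_has_derivative: "((\<lambda>\<xi>. mexp (tau_comb \<xi>)) has_derivative tau_comb) (at 0)"
proof -
  define w :: "complex^3 \<Rightarrow> complex" where "w \<xi> = csqrt (- (\<Sum>a\<in>UNIV. (\<xi>$a)\<^sup>2))" for \<xi>
  have "(w \<longlongrightarrow> 0) (at 0)"
  \<comment> \<open>\<open>csqrt\<close> jumps across its cut, but its modulus is the real root of
    the modulus of the argument.\<close>
  proof (rule tendsto_norm_zero_cancel)
    have "((\<lambda>\<xi>::complex^3. sqrt (norm (- (\<Sum>a\<in>UNIV. (\<xi>$a)\<^sup>2))))
        \<longlongrightarrow> sqrt (norm (- (\<Sum>a\<in>UNIV. ((0::complex^3)$a)\<^sup>2)))) (at 0)"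
      by (intro tendsto_intros)
    then show "((\<lambda>\<xi>. norm (w \<xi>)) \<longlongrightarrow> 0) (at 0)"
      by (simp add: w_def)
  qed
  have cont: "isCont sinhc 0"
    using sinhc_tendsto by (simp add: isCont_def sinhc_def)
  have sw: "((\<lambda>\<xi>. sinhc (w \<xi>)) \<longlongrightarrow> 1) (at 0)"
    using isCont_tendsto_compose[OF cont \<open>(w \<longlongrightarrow> 0) (at 0)\<close>] by (simp add: sinhc_def)
  have "((\<lambda>\<xi>. w \<xi> / 2) \<longlongrightarrow> 0) (at 0)"
    using \<open>(w \<longlongrightarrow> 0) (at 0)\<close> by (auto intro: tendsto_eq_intros)
  then have sw2: "((\<lambda>\<xi>. sinhc (w \<xi> / 2)) \<longlongrightarrow> 1) (at 0)"
    using isCont_tendsto_compose[OF cont] by (fastforce simp: sinhc_def)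
  \<comment> \<open>The quadratic form under the root is split into linear forms
    \<open>\<xi>$a\<close> whose cofactors tend to 0, so that the derivative is 0.\<close>
  have cosh_eq: "cosh (w \<xi>) = 1 + (\<Sum>a\<in>UNIV. (- (\<xi>$a) * (sinhc (w \<xi> / 2))\<^sup>2 / 2) * \<xi>$a)" for \<xi>
  proof -
    have w2: "(w \<xi>)\<^sup>2 = - (\<Sum>a\<in>UNIV. (\<xi>$a)\<^sup>2)" by (simp add: w_def)
    show ?thesis
      unfolding cosh_eq_sinhc w2 by (simp add: sum_3 algebra_simps power2_eq_square)
  qed
  have comp: "bounded_linear (\<lambda>\<xi>::complex^3. \<xi>$a)" for a
    by (rule bounded_linear_vec_nth)
  have "((\<lambda>\<xi>. (- (\<xi>$a) * (sinhc (w \<xi> / 2))\<^sup>2 / 2) * \<xi>$a) has_derivative (\<lambda>\<xi>. 0 * \<xi>$a)) (at 0)" for a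
  proof (rule has_derivative_mult_linear_0[OF _ comp])
    have "((\<lambda>\<xi>. - (\<xi>$a) * (sinhc (w \<xi> / 2))\<^sup>2 / 2) \<longlongrightarrow> - ((0::complex^3)$a) * 1\<^sup>2 / 2) (at 0)"
      by (intro tendsto_intros sw2) simp
    then show "((\<lambda>\<xi>. - (\<xi>$a) * (sinhc (w \<xi> / 2))\<^sup>2 / 2) \<longlongrightarrow> 0) (at 0)" by simp
  qed
  then have c: "((\<lambda>\<xi>. cosh (w \<xi>)) has_derivative (\<lambda>_. 0)) (at 0)"
    unfolding cosh_eq
    by (intro has_derivative_eq_rhs[OF has_derivative_add[OF has_derivative_const has_derivative_sum]])
      (auto simp: fun_eq_iff)
  have s: "((\<lambda>\<xi>. sinhc (w \<xi>) * \<xi>$a) has_derivative (\<lambda>\<xi>. \<xi>$a)) (at 0)" for a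
    using has_derivative_mult_linear_0[OF sw comp[of a]] by simp
  have eq: "mexp (tau_comb \<xi>) =
      mat (cosh (w \<xi>)) ** mat 1 + (\<Sum>a\<in>UNIV. mat (sinhc (w \<xi>) * \<xi>$a) ** tau a)" for \<xi>
  proof -
    have "mexp (tau_comb \<xi>) = mat (cosh (w \<xi>)) + mat (sinhc (w \<xi>)) ** tau_comb \<xi>"
      unfolding w_def by (rule mexp_eq[OF tau_comb_square_csqrt])
    then show ?thesis by (simp add: mat2_simps sum_3 algebra_simps)
  qed
  have "((\<lambda>\<xi>. mexp (tau_comb \<xi>)) has_derivative
      (\<lambda>\<xi>. mat 0 ** mat 1 + (\<Sum>a\<in>UNIV. mat (\<xi>$a) ** tau a))) (at 0)"
    unfolding eq
    by (intro has_derivative_add has_derivative_sum c s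
        bounded_linear.has_derivative[OF bounded_linear_smult])
  moreover have "mat 0 ** mat 1 + (\<Sum>a\<in>UNIV. mat (\<xi>$a) ** tau a) = tau_comb \<xi>" for \<xi> :: "complex^3"
    by (simp add: tau_comb_def mat2_simps)
  ultimately show ?thesis by simp
qed

section \<open>The square of the complex arcosh\<close>

lemma add_1_nonpos_iff: "x + 1 \<in> \<real>\<^sub>\<le>\<^sub>0 \<longleftrightarrow> x \<in> complex_of_real ` {..-1}" for x :: complex
proof
  assume "x + 1 \<in> \<real>\<^sub>\<le>\<^sub>0"
  then obtain r :: real where "x + 1 = of_real r" "r \<le> 0"
    by (auto elim!: nonpos_Reals_cases)
  then have "x = of_real (r - 1)" "r - 1 \<in> {..-1}" by (auto simp: algebra_simps)
  then show "x \<in> complex_of_real ` {..-1}" by blast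
next
  assume "x \<in> complex_of_real ` {..-1}"
  then show "x + 1 \<in> \<real>\<^sub>\<le>\<^sub>0" by (auto simp: complex_nonpos_Reals_iff)
qed

text \<open>x + s and x - s are mutually inverse. If x + s were a real r \<le> 0, then r < 0 and x =
  (r + 1/r)/2 \<le> -1, a point of the excluded cut.\<close>

lemma Ln_arcosh_arg_nonpos:
  assumes "s\<^sup>2 = x\<^sup>2 - 1" "x \<notin> complex_of_real ` {..-1}"
  shows "x + s \<notin> \<real>\<^sub>\<le>\<^sub>0"
proof
  assume "x + s \<in> \<real>\<^sub>\<le>\<^sub>0"
  then obtain r :: real where r: "x + s = of_real r" "r \<le> 0"
    by (auto elim!: nonpos_Reals_cases)
  have prod: "(x + s) * (x - s) = 1"
    using assms(1) by (simp add: algebra_simps power2_eq_square)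
  then have "r \<noteq> 0" using r by auto
  with r have "r < 0" by simp
  have "2 * x = (x + s) + (x - s)" by simp
  also have "x - s = of_real (1 / r)"
  proof -
    have "of_real r * (x - s) = 1" using prod r by simp
    then show ?thesis using \<open>r \<noteq> 0\<close> by (simp add: eq_divide_eq mult.commute)
  qed
  finally have x: "x = of_real ((r + 1 / r) / 2)" using r by (simp add: mult.commute[of x])
  \<comment> \<open>The quotient equals r + 2 + 1/r.\<close>
  have "(r + 1)\<^sup>2 / r \<le> 0" using \<open>r < 0\<close> by (simp add: divide_nonneg_neg)
  then have "(r + 1 / r) / 2 \<le> -1"
    using \<open>r < 0\<close> by (simp add: power2_eq_square field_simps)
  with x assms(2) show False by blast
qed

lemma csqrt_product_square: "(csqrt (x + 1) * csqrt (x - 1))\<^sup>2 = x\<^sup>2 - 1"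
  by (simp add: power_mult_distrib) (simp add: power2_eq_square algebra_simps)

text \<open>With w the product of the two roots, x + w and x - w are inverse to each other. Hence x
  + w never vanishes, and the formulas hold for every x, cut included.\<close>

lemma cosh_carcosh [simp]: "cosh (carcosh x) = x"
  and sinh_carcosh: "sinh (carcosh x) = csqrt (x - 1) * csqrt (x + 1)"
proof -
  define w where "w = csqrt (x + 1) * csqrt (x - 1)"
  have prod: "(x + w) * (x - w) = 1"
    using csqrt_product_square[of x] by (simp add: w_def algebra_simps power2_eq_square)
  then have nz: "x + w \<noteq> 0" by auto
  have e: "exp (carcosh x) = x + w" using nz by (simp add: carcosh_def w_def)
  have e': "exp (- carcosh x) = x - w"
    using prod nz e by (simp add: exp_minus field_simps)
  show "cosh (carcosh x) = x" unfolding cosh_def e e' by simp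
  show "sinh (carcosh x) = csqrt (x - 1) * csqrt (x + 1)"
    unfolding sinh_def e e' by (simp add: w_def)
qed

text \<open>Replacing the root \<open>w\<close> by \<open>- w\<close> turns \<open>x + w\<close> into its inverse, so the logarithm changes sign
  and neither its square nor its quotient by the root sees the choice. Across the cut \<open>(-1, 1)\<close>
  of \<open>csqrt (x - 1)\<close> another, locally holomorphic root can therefore be used.\<close>

lemma carcosh_other_root:
  assumes "s\<^sup>2 = x\<^sup>2 - 1" "x \<notin> complex_of_real ` {..-1}"
  shows "(Ln (x + s))\<^sup>2 = (carcosh x)\<^sup>2"
    and "Ln (x + s) / s = carcosh x / (csqrt (x - 1) * csqrt (x + 1))"
proof -
  define w where "w = csqrt (x + 1) * csqrt (x - 1)"
  have w: "w\<^sup>2 = x\<^sup>2 - 1" unfolding w_def by (rule csqrt_product_square)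
  have "s\<^sup>2 = w\<^sup>2" using assms(1) w by simp
  then have "s = w \<or> s = - w" by (simp add: power2_eq_iff)
  moreover have "Ln (x - w) = - Ln (x + w)"
  proof -
    have "(x + w) * (x - w) = 1"
      using w by (simp add: algebra_simps power2_eq_square)
    then have "x - w = inverse (x + w)"
      using inverse_unique by metis
    then show ?thesis
      using Ln_inverse[OF Ln_arcosh_arg_nonpos[OF w assms(2)]] by simp
  qed
  ultimately show "(Ln (x + s))\<^sup>2 = (carcosh x)\<^sup>2"
    and "Ln (x + s) / s = carcosh x / (csqrt (x - 1) * csqrt (x + 1))"
    by (auto simp: carcosh_def w_def mult.commute)
qed

text \<open>Differentiating s^2 = y^2 - 1 gives s' = x / s, hence Ln (y + s) has derivative 1 / s.
  Its square agrees with (carcosh y)^2 on the slit plane, which is open, so the derivative carries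
  over.\<close>

lemma carcosh_square_deriv_root:
  assumes x: "x \<notin> complex_of_real ` {..-1}" and "s x \<noteq> 0"
    and ds: "(s has_field_derivative d) (at x)" and s: "\<And>y. (s y)\<^sup>2 = y\<^sup>2 - 1"
  shows "((\<lambda>x. (carcosh x)\<^sup>2) has_field_derivative
    2 * (carcosh x / (csqrt (x - 1) * csqrt (x + 1)))) (at x)"
proof -
  have "((\<lambda>y. (s y)\<^sup>2) has_field_derivative 2 * s x * d) (at x)"
    by (rule derivative_eq_intros ds refl | simp)+
  moreover have "((\<lambda>y. (s y)\<^sup>2) has_field_derivative 2 * x) (at x)"
    unfolding s by (rule derivative_eq_intros refl | simp)+
  ultimately have "2 * s x * d = 2 * x" by (rule DERIV_unique)
  then have d: "d = x / s x" using \<open>s x \<noteq> 0\<close> by (simp add: field_simps)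
  have nonpos: "x + s x \<notin> \<real>\<^sub>\<le>\<^sub>0" using Ln_arcosh_arg_nonpos[OF s x] .
  then have nz: "x + s x \<noteq> 0" by auto
  have "((\<lambda>y. (Ln (y + s y))\<^sup>2) has_field_derivative
      2 * Ln (x + s x) * ((1 + d) / (x + s x))) (at x)"
    by (rule derivative_eq_intros ds nonpos refl | simp add: divide_inverse)+
  also have "2 * Ln (x + s x) * ((1 + d) / (x + s x)) = 2 * (Ln (x + s x) / s x)"
  proof -
    have "(1 + d) / (x + s x) = 1 / s x"
      unfolding d using \<open>s x \<noteq> 0\<close> nz by (simp add: divide_simps add.commute)
    then show ?thesis by simp
  qed
  also have "\<dots> = 2 * (carcosh x / (csqrt (x - 1) * csqrt (x + 1)))"
    using carcosh_other_root(2)[OF s x] by simp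
  finally have deriv: "((\<lambda>y. (Ln (y + s y))\<^sup>2) has_field_derivative
      2 * (carcosh x / (csqrt (x - 1) * csqrt (x + 1)))) (at x)" .
  define S where "S = - ((\<lambda>x. x + 1) -` (\<real>\<^sub>\<le>\<^sub>0 :: complex set))"
  have S_eq: "S = - complex_of_real ` {..-1}"
    by (auto simp: S_def add_1_nonpos_iff)
  have "open S"
    unfolding S_def by (intro open_Compl continuous_closed_vimage closed_nonpos_Reals_complex)
      (auto intro!: continuous_intros)
  show ?thesis
    by (rule has_field_derivative_transform_within_open[OF deriv \<open>open S\<close>])
      (use x in \<open>auto simp: S_eq carcosh_other_root(1)[OF s]\<close>)
qed

lemma carcosh_tendsto_1: "carcosh \<midarrow>1\<rightarrow> 0"
proof -
  \<comment> \<open>At the limit x - 1 reaches 0, an end of the cut of \<open>csqrt\<close>, so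
    convergence is obtained through the modulus.\<close>
  have "((\<lambda>x. norm (csqrt (x - 1))) \<longlongrightarrow> sqrt (norm (1 - 1 :: complex))) (at 1)"
    unfolding norm_csqrt by (intro tendsto_intros)
  then have "((\<lambda>x. csqrt (x - 1)) \<longlongrightarrow> 0) (at 1)"
    by (intro tendsto_norm_zero_cancel[where f = "\<lambda>x. csqrt (x - 1)"]) simp
  moreover have "((\<lambda>x. csqrt (x + 1)) \<longlongrightarrow> csqrt (1 + 1)) (at 1)"
    by (intro isCont_tendsto_compose[OF continuous_at_csqrt] tendsto_intros)
      (simp add: complex_nonpos_Reals_iff)
  ultimately have "((\<lambda>x. x + csqrt (x + 1) * csqrt (x - 1)) \<longlongrightarrow> 1 + csqrt (1 + 1) * 0) (at 1)"
    by (intro tendsto_intros)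
  then have "((\<lambda>x. Ln (x + csqrt (x + 1) * csqrt (x - 1))) \<longlongrightarrow> Ln 1) (at 1)"
    by (intro isCont_tendsto_compose[OF continuous_at_Ln]) (simp_all add: complex_nonpos_Reals_iff)
  then show ?thesis by (simp add: carcosh_def[abs_def])
qed

text \<open>At the branch point, \<open>x - 1 = cosh z - 1\<close> is \<open>z\<^sup>2 / 2\<close> times a factor tending to \<open>1\<close>.\<close>

lemma carcosh_square_deriv_1: "((\<lambda>x. (carcosh x)\<^sup>2) has_field_derivative 2) (at 1)"
proof -
  have c1: "carcosh 1 = 0" by (simp add: carcosh_def)
  have "((\<lambda>x. carcosh x / 2) \<longlongrightarrow> 0) (at 1)"
    using carcosh_tendsto_1 by (auto intro: tendsto_eq_intros)
  moreover have "isCont sinhc 0"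
    using sinhc_tendsto by (simp add: isCont_def sinhc_def)
  ultimately have "((\<lambda>x. sinhc (carcosh x / 2)) \<longlongrightarrow> 1) (at 1)"
    using isCont_tendsto_compose by (fastforce simp: sinhc_def)
  then have "((\<lambda>x. 2 / (sinhc (carcosh x / 2))\<^sup>2) \<longlongrightarrow> 2 / 1\<^sup>2) (at 1)"
    by (intro tendsto_intros) auto
  moreover have "2 / (sinhc (carcosh x / 2))\<^sup>2 = ((carcosh x)\<^sup>2 - (carcosh 1)\<^sup>2) / (x - 1)"
    if "x \<noteq> 1" for x
  proof -
    have eq: "x - 1 = (sinhc (carcosh x / 2))\<^sup>2 / 2 * (carcosh x)\<^sup>2"
      using arg_cong[OF cosh_eq_sinhc[of "carcosh x"], of "\<lambda>y. y - 1"]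
      unfolding cosh_carcosh add_diff_cancel_left' .
    then have "carcosh x \<noteq> 0" "sinhc (carcosh x / 2) \<noteq> 0" using that by auto
    then show ?thesis unfolding eq c1 by simp
  qed
  ultimately have "((\<lambda>x. ((carcosh x)\<^sup>2 - (carcosh 1)\<^sup>2) / (x - 1)) \<longlongrightarrow> 2) (at 1)"
    by (auto elim!: Lim_transform_eventually simp: eventually_at_filter)
  then show ?thesis by (simp add: has_field_derivative_iff)
qed

text \<open>Away from x = 1 it suffices to have a root of x^2 - 1 that is holomorphic near x. The
  principal one serves unless x - 1 is a negative real; then 1 - x lies off the cut and i csqrt (x +
  1) csqrt (1 - x) serves.\<close>

lemma carcosh_square_deriv:
  assumes "x \<notin> complex_of_real ` {..-1}"
  shows "((\<lambda>x. (carcosh x)\<^sup>2) has_field_derivative 2 * z_quot x) (at x)"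
proof (cases "x = 1")
  case True
  then show ?thesis using carcosh_square_deriv_1 by (simp add: z_quot_def)
next
  case False
  have "x \<noteq> -1"
    using assms imageI[of "-1" "{..-1}" complex_of_real] by auto
  have x1: "x + 1 \<notin> \<real>\<^sub>\<le>\<^sub>0"
    using assms by (simp add: add_1_nonpos_iff)
  have "((\<lambda>x. (carcosh x)\<^sup>2) has_field_derivative
    2 * (carcosh x / (csqrt (x - 1) * csqrt (x + 1)))) (at x)"
  proof (cases "x - 1 \<in> \<real>\<^sub>\<le>\<^sub>0")
    case False
    then have "x - 1 \<noteq> 0" by auto
    obtain d where "((\<lambda>x. csqrt (x + 1) * csqrt (x - 1)) has_field_derivative d) (at x)"
      using False x1 by (fastforce intro: derivative_eq_intros)
    then show ?thesis
      by (rule carcosh_square_deriv_root[OF assms, rotated])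
        (use \<open>x \<noteq> -1\<close> \<open>x - 1 \<noteq> 0\<close> csqrt_product_square in \<open>auto simp: eq_neg_iff_add_eq_0\<close>)
  next
    case True
    have "1 - x \<notin> \<real>\<^sub>\<le>\<^sub>0"
      using True \<open>x \<noteq> 1\<close> by (auto simp: complex_nonpos_Reals_iff complex_eq_iff)
    obtain d where "((\<lambda>x. \<i> * csqrt (x + 1) * csqrt (1 - x)) has_field_derivative d) (at x)"
      using \<open>1 - x \<notin> \<real>\<^sub>\<le>\<^sub>0\<close> x1 by (fastforce intro: derivative_eq_intros)
    then show ?thesis
      by (rule carcosh_square_deriv_root[OF assms, rotated])
        (use \<open>x \<noteq> -1\<close> \<open>x \<noteq> 1\<close> in
          \<open>auto simp: eq_neg_iff_add_eq_0 power_mult_distrib, simp add: algebra_simps power2_eq_square\<close>)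
  qed
  then show ?thesis using False by (simp add: z_quot_def)
qed

text \<open>For real \<open>X \<ge> 1\<close> both principal roots are nonnegative reals, so the
  complex branch restricts to the real one.\<close>

lemma carcosh_of_real:
  assumes "X \<ge> 1"
  shows "carcosh (of_real X) = of_real (arcosh X)"
proof -
  have "csqrt (of_real (X + 1)) * csqrt (of_real (X - 1)) = of_real (sqrt (X\<^sup>2 - 1))"
    using assms by (simp add: of_real_sqrt[symmetric] real_sqrt_mult[symmetric] algebra_simps power2_eq_square
      flip: of_real_mult del: of_real_add of_real_diff)
  then have "carcosh (of_real X) = Ln (of_real (X + sqrt (X\<^sup>2 - 1)))"
    by (simp add: carcosh_def)
  also have "\<dots> = of_real (ln (X + sqrt (X\<^sup>2 - 1)))"
    using assms by (intro Ln_of_real) (simp add: add_pos_nonneg)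
  finally show ?thesis using assms by (simp add: arcosh_real_def)
qed

lemma sinh_of_real_complex: "sinh (complex_of_real r) = of_real (sinh r)"
  by (simp add: sinh_def exp_of_real scaleR_conv_of_real flip: of_real_minus)

lemma cosh_of_real_complex: "cosh (complex_of_real r) = of_real (cosh r)"
  by (simp add: cosh_def exp_of_real scaleR_conv_of_real flip: of_real_minus)

text \<open>The product of the roots at cosh r is sinh r, and the two continuous extensions, at x =
  1 and at r = 0, take the same value. This makes the coefficient in \<open>W_of\<close> the
  diagonal case of that in \<open>Z_of\<close>.\<close>

lemma z_quot_cosh:
  assumes "r \<ge> 0"
  shows "z_quot (of_real (cosh r)) = of_real (p_quot r)"
proof (cases "r = 0")
  case False
  have c: "carcosh (of_real (cosh r)) = of_real r"
    using assms by (simp add: carcosh_of_real cosh_real_ge_1 arcosh_cosh_real)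
  have "csqrt (of_real (cosh r) - 1) * csqrt (of_real (cosh r) + 1) = sinh (of_real r)"
    using sinh_carcosh[of "of_real (cosh r)"] unfolding c by simp
  moreover have "cosh r \<noteq> 1" using False assms cosh_real_strict_mono[of 0 r] by auto
  ultimately show ?thesis using False
    by (simp add: z_quot_def p_quot_def c sinh_of_real_complex)
qed (simp add: z_quot_def p_quot_def)

section \<open>Characters and coherent states on one edge\<close>

text \<open>A term can be split off the complete homogeneous sum h_n(p, q) at either end. The
  recursion of the characters combines both forms.\<close>

lemma sum_powers_Suc:
  fixes p q :: "'a::comm_ring_1"
  shows "(\<Sum>k\<le>Suc n. p ^ (Suc n - k) * q ^ k) = p * (\<Sum>k\<le>n. p ^ (n - k) * q ^ k) + q ^ Suc n"
    and "(\<Sum>k\<le>Suc n. p ^ (Suc n - k) * q ^ k) = q * (\<Sum>k\<le>n. p ^ (n - k) * q ^ k) + p ^ Suc n"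
proof -
  have "(\<Sum>k\<le>n. p ^ (Suc n - k) * q ^ k) = p * (\<Sum>k\<le>n. p ^ (n - k) * q ^ k)"
    unfolding sum_distrib_left by (rule sum.cong) (auto simp: Suc_diff_le)
  then show "(\<Sum>k\<le>Suc n. p ^ (Suc n - k) * q ^ k) = p * (\<Sum>k\<le>n. p ^ (n - k) * q ^ k) + q ^ Suc n"
    by simp
  show "(\<Sum>k\<le>Suc n. p ^ (Suc n - k) * q ^ k) = q * (\<Sum>k\<le>n. p ^ (n - k) * q ^ k) + p ^ Suc n"
    by (subst sum.atMost_Suc_shift) (simp add: sum_distrib_left mult_ac)
qed

lemma spin_char_coeff:
  "spin_char n g = coeff (\<Sum>k\<le>n. (monom 1 1 * [:g$1$1, g$2$1:]) ^ (n - k) * [:g$1$2, g$2$2:] ^ k) n"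
  unfolding spin_char_def coeff_sum
proof (rule sum.cong)
  fix k assume "k \<in> {..n}"
  then have "n - (n - k) = k" by auto
  then show "coeff ([:g$1$1, g$2$1:] ^ (n - k) * [:g$1$2, g$2$2:] ^ k) k =
      coeff ((monom 1 1 * [:g$1$1, g$2$1:]) ^ (n - k) * [:g$1$2, g$2$2:] ^ k) n"
    using \<open>k \<in> {..n}\<close> by (simp only: power_mult_distrib monom_power coeff_monom_mult mult.assoc) simp
qed simp

text \<open>With \<open>p = X P\<close> and \<open>q = Q\<close> every term of the trace becomes the same coefficient of the complete
  homogeneous sum \<open>h\<^sub>n(p, q)\<close>. In the recursion for \<open>h\<^sub>n\<close> the remainder
  \<open>c X\<^sup>2 p\<^bsup>n+1\<^esup> + b q\<^bsup>n+1\<^esup>\<close> has only terms of too high or too low degree.\<close>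

lemma spin_char_recursion:
  "spin_char (Suc (Suc n)) g = trace g * spin_char (Suc n) g - det g * spin_char n g"
proof -
  define a b c d where "a = g$1$1" and "b = g$1$2" and "c = g$2$1" and "d = g$2$2"
  define p q where "p = monom 1 1 * [:a, c:]" and "q = [:b, d:]"
  define h where "h n = (\<Sum>k\<le>n. p ^ (n - k) * q ^ k)" for n
  have p: "p = smult a (monom 1 1) + smult c (monom 1 2)"
    by (simp add: p_def monom_altdef numeral_2_eq_2)
  have q: "q = [:b:] + smult d (monom 1 1)"
    by (simp add: q_def monom_altdef)
  define X :: "complex poly" where "X = monom 1 1"
  have X2: "monom 1 2 = X * X" by (simp add: X_def mult_monom numeral_2_eq_2)
  have p': "p = [:a:] * X + [:c:] * (X * X)" and q': "q = [:b:] + [:d:] * X"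
    unfolding p q X2 X_def[symmetric] by simp_all
  have h2: "h (Suc (Suc n)) = p * h (Suc n) + q ^ Suc (Suc n)"
    and h1: "h (Suc n) = p * h n + q ^ Suc n" "h (Suc n) = q * h n + p ^ Suc n"
    unfolding h_def by (rule sum_powers_Suc)+
  have "h (Suc (Suc n)) = [:a + d:] * X * h (Suc n) - [:a * d - b * c:] * (X * X) * h n
      + [:c:] * (X * X) * p ^ Suc n + [:b:] * q ^ Suc n"
  proof -
    have "h (Suc (Suc n)) - [:a:] * X * h (Suc n) - [:d:] * X * h (Suc n)
        = [:c:] * (X * X) * h (Suc n) + q * q ^ Suc n - [:d:] * X * h (Suc n)"
      unfolding h2 by (subst p') (simp add: algebra_simps)
    \<comment> \<open>The sum of index n + 1 is expanded with q in one place and with p in the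
      other. The terms c d X^3 of the two products then cancel and the determinant remains.\<close>
    also have "\<dots> = [:c:] * (X * X) * (q * h n + p ^ Suc n) + q * q ^ Suc n
        - [:d:] * X * (p * h n + q ^ Suc n)"
      using h1 by metis
    also have "\<dots> = [:c:] * (X * X) * p ^ Suc n + (q - [:d:] * X) * q ^ Suc n
        + ([:c:] * (X * X) * q - [:d:] * X * p) * h n"
      by (simp only: algebra_simps)
    also have "q - [:d:] * X = [:b:]" by (simp add: q')
    also have "[:c:] * (X * X) * q - [:d:] * X * p
        = [:b:] * [:c:] * (X * X) - [:a:] * [:d:] * (X * X)"
      unfolding p' q' by (simp only: algebra_simps)
    finally have *: "h (Suc (Suc n)) - [:a:] * X * h (Suc n) - [:d:] * X * h (Suc n) =
        [:c:] * (X * X) * p ^ Suc n + [:b:] * q ^ Suc n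
          + ([:b:] * [:c:] * (X * X) - [:a:] * [:d:] * (X * X)) * h n" .
    have "[:a + d:] = [:a:] + [:d:]" "[:a * d - b * c:] = [:a:] * [:d:] - [:b:] * [:c:]"
      by simp_all
    with * show ?thesis by (simp only:) (simp only: algebra_simps)
  qed
  then have "coeff (h (Suc (Suc n))) (Suc (Suc n)) =
      (a + d) * coeff (X * h (Suc n)) (Suc (Suc n))
      - (a * d - b * c) * coeff (X * X * h n) (Suc (Suc n))
      + c * coeff (X * X * p ^ Suc n) (Suc (Suc n)) + b * coeff (q ^ Suc n) (Suc (Suc n))"
    by (simp only: coeff_add coeff_diff mult.assoc coeff_smult mult_smult_left
        smult_0_left mult_pCons_left mult_zero_left pCons_0_0 add_0_right)
  moreover have "coeff (X * h (Suc n)) (Suc (Suc n)) = coeff (h (Suc n)) (Suc n)"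
    by (simp add: X_def coeff_monom_mult)
  moreover have "coeff (X * X * h n) (Suc (Suc n)) = coeff (h n) n"
    by (simp add: X_def coeff_monom_mult mult_monom)
  moreover have "coeff (X * X * p ^ Suc n) (Suc (Suc n)) = 0"
  proof -
    have "X * X * p ^ Suc n = monom 1 (n + 3) * [:a, c:] ^ Suc n"
      by (simp only: X_def p_def power_mult_distrib monom_power mult_monom flip: mult.assoc)
        (simp del: power_Suc add: numeral_3_eq_3)
    then show ?thesis by (simp add: coeff_monom_mult)
  qed
  moreover have "coeff (q ^ Suc n) (Suc (Suc n)) = 0"
  proof (rule coeff_eq_0)
    have "degree (q ^ Suc n) \<le> degree q * Suc n" by (rule degree_power_le)
    also have "degree q * Suc n \<le> 1 * Suc n" by (rule mult_right_mono) (simp_all add: q_def)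
    finally show "degree (q ^ Suc n) < Suc (Suc n)" by (simp del: power_Suc)
  qed
  moreover have "spin_char m g = coeff (h m) m" for m
    by (simp add: spin_char_coeff h_def p_def q_def a_def b_def c_def d_def)
  ultimately show ?thesis
    by (simp add: trace_mat2 det_2 a_def b_def c_def d_def)
qed

text \<open>Chebyshev polynomials of the second kind at \<open>x / 2\<close>.\<close>

fun cheb :: "nat \<Rightarrow> complex \<Rightarrow> complex" where
  "cheb 0 x = 1"
| "cheb (Suc 0) x = x"
| "cheb (Suc (Suc n)) x = x * cheb (Suc n) x - cheb n x"

lemma spin_char_cheb:
  assumes "g \<in> SL2C"
  shows "spin_char n g = cheb n (trace g)"
proof (induction n rule: induct_nat_012)
  case 0
  then show ?case by (simp add: spin_char_def)
next
  case 1
  then show ?case by (simp add: spin_char_def trace_mat2)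
next
  case (ge2 n)
  then show ?case using assms by (simp add: spin_char_recursion SL2C_def)
qed

text \<open>A crude geometric bound suffices, since the weights of the spins decay like a
  Gaussian.\<close>

lemma norm_cheb_le: "norm (cheb n x) \<le> (norm x + 1) ^ n"
proof (induction n rule: induct_nat_012)
  case (ge2 n)
  have "norm (cheb (Suc (Suc n)) x) \<le> norm x * norm (cheb (Suc n) x) + norm (cheb n x)"
    using norm_triangle_ineq4[of "x * cheb (Suc n) x" "cheb n x"] by (simp add: norm_mult)
  also have "\<dots> \<le> norm x * (norm x + 1) ^ Suc n + (norm x + 1) ^ n"
    using ge2 by (intro add_mono mult_left_mono) auto
  also have "\<dots> \<le> norm x * (norm x + 1) ^ Suc n + (norm x + 1) ^ Suc n"
    by (intro add_left_mono power_increasing) auto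
  also have "\<dots> = (norm x + 1) ^ Suc (Suc n)"
    by (simp add: algebra_simps)
  finally show ?case .
qed auto

lemma holomorphic_cheb: "cheb n holomorphic_on A"
  by (induction n rule: induct_nat_012) (auto intro!: holomorphic_intros simp: fun_eq_iff cong: holomorphic_cong)

section \<open>Convergence of the sum over spins\<close>

definition spin_weight :: "real \<Rightarrow> nat \<Rightarrow> real" where
  "spin_weight t n = (2 * (real n / 2) + 1) * exp (- t * (real n / 2) * (real n / 2 + 1) / 2)"

lemma spin_weight_nonneg: "spin_weight t n \<ge> 0"
  by (simp add: spin_weight_def)

text \<open>The exponent is -t n^2/8 - t n/4. Without its second part the exponential is the n-th
  power of exp (-t n/8), which tends to 0 and so absorbs any \<open>B\<close>.\<close>

lemma summable_spin_weight:
  assumes "t > 0"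
  shows "summable (\<lambda>n. spin_weight t n * B ^ n)"
proof (rule summable_comparison_test_ev)
  \<comment> \<open>The threshold 1/4 below leaves room for the factor n + 1 \<le> 2^n and still
    gives the ratio 1/2.\<close>
  have "((\<lambda>n. exp (- t * real n / 8) * \<bar>B\<bar>) \<longlongrightarrow> 0) sequentially"
    using assms by real_asymp
  then have "\<forall>\<^sub>F n in sequentially. exp (- t * real n / 8) * \<bar>B\<bar> < 1 / 4"
    by (rule order_tendstoD) simp
  then show "\<forall>\<^sub>F n in sequentially. norm (spin_weight t n * B ^ n) \<le> (1 / 2) ^ n"
  proof eventually_elim
    case (elim n)
    have "- t * (real n / 2) * (real n / 2 + 1) / 2 \<le> real n * (- t * real n / 8)"
      using assms by (simp add: field_simps)
    then have "exp (- t * (real n / 2) * (real n / 2 + 1) / 2) \<le> exp (real n * (- t * real n / 8))"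
      by simp
    also have "\<dots> = exp (- t * real n / 8) ^ n" by (rule exp_of_nat_mult)
    finally have e: "exp (- t * (real n / 2) * (real n / 2 + 1) / 2) \<le> exp (- t * real n / 8) ^ n" .
    have "norm (spin_weight t n * B ^ n) =
        (real n + 1) * (exp (- t * (real n / 2) * (real n / 2 + 1) / 2) * \<bar>B\<bar> ^ n)"
      by (simp add: spin_weight_def abs_mult power_abs)
    also have "\<dots> \<le> (real n + 1) * (exp (- t * real n / 8) ^ n * \<bar>B\<bar> ^ n)"
      using e by (intro mult_left_mono mult_right_mono) auto
    also have "\<dots> \<le> 2 ^ n * (1 / 4) ^ n"
    proof (rule mult_mono)
      show "real n + 1 \<le> 2 ^ n"
        using of_nat_mono[OF Suc_leI[OF less_exp[of n]], where ?'a = real] by simp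
      show "exp (- t * real n / 8) ^ n * \<bar>B\<bar> ^ n \<le> (1 / 4) ^ n"
        unfolding power_mult_distrib[symmetric] using elim by (intro power_mono) auto
    qed auto
    also have "\<dots> = (1 / 2) ^ n" unfolding power_mult_distrib[symmetric] by simp
    finally show ?case .
  qed
qed (simp add: summable_geometric)

text \<open>The state as a function of the trace alone. Its argument ranges over the whole plane, so
  the matrix parameter can move in a vector space instead of the surface det = 1.\<close>

definition edge_fun :: "real \<Rightarrow> complex \<Rightarrow> complex" where
  "edge_fun t x = (\<Sum>n. of_real (spin_weight t n) * cheb n x)"

lemma holomorphic_edge_fun:
  assumes "t > 0"
  shows "edge_fun t holomorphic_on UNIV"
proof (rule holomorphic_uniform_sequence)
  show "(\<lambda>x. \<Sum>i<n. of_real (spin_weight t i) * cheb i x) holomorphic_on UNIV" for n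
    by (intro holomorphic_intros holomorphic_cheb)
  fix x :: complex
  have "uniform_limit (cball x 1) (\<lambda>n x. \<Sum>i<n. of_real (spin_weight t i) * cheb i x)
      (\<lambda>x. \<Sum>i. of_real (spin_weight t i) * cheb i x) sequentially"
  proof (rule Weierstrass_m_test)
    fix n y assume "y \<in> cball x 1"
    then have "norm y \<le> norm x + 1"
      using norm_triangle_ineq3[of x y] by (simp add: dist_norm)
    have "norm (cheb n y) \<le> (norm y + 1) ^ n" by (rule norm_cheb_le)
    also have "\<dots> \<le> (norm x + 2) ^ n"
      using \<open>norm y \<le> norm x + 1\<close> by (intro power_mono) auto
    finally show "norm (of_real (spin_weight t n) * cheb n y) \<le> spin_weight t n * (norm x + 2) ^ n"
      by (simp add: norm_mult spin_weight_nonneg mult_left_mono)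
  qed (rule summable_spin_weight[OF assms])
  then show "\<exists>d>0. cball x d \<subseteq> UNIV \<and>
      uniform_limit (cball x d) (\<lambda>n x. \<Sum>i<n. of_real (spin_weight t i) * cheb i x) (edge_fun t) sequentially"
    by (intro exI[of _ 1]) (simp add: edge_fun_def[abs_def])
qed simp

lemma edge_state_eq:
  assumes "g \<in> SL2C" "u \<in> SU2"
  shows "edge_state t g u = edge_fun t (trace (g ** dagger u))"
proof -
  have "g ** dagger u \<in> SL2C"
    using assms SL2C_mult SU2_SL2C SU2_dagger by blast
  then show ?thesis
    by (simp add: edge_state_def edge_fun_def matrix_inv_SU2[OF assms(2)] spin_char_cheb
        spin_weight_def Let_def)
qed

section \<open>Integrals depending holomorphically on a parameter\<close>

lemma integrable_bounded_mult:
  fixes F R :: "'b \<Rightarrow> complex"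
  assumes "F \<in> borel_measurable M" "integrable M R" "\<And>u. u \<in> space M \<Longrightarrow> norm (F u) \<le> K"
  shows "integrable M (\<lambda>u. F u * R u)"
proof (rule Bochner_Integration.integrable_bound)
  show "integrable M (\<lambda>u. K * norm (R u))" using assms(2) by simp
  show "(\<lambda>u. F u * R u) \<in> borel_measurable M" using assms by measurable
  show "AE u in M. norm (F u * R u) \<le> norm (K * norm (R u))"
  proof (rule AE_I2)
    fix u assume u: "u \<in> space M"
    have "0 \<le> K" using assms(3)[OF u] norm_ge_zero order_trans by blast
    then show "norm (F u * R u) \<le> norm (K * norm (R u))"
      using assms(3)[OF u] by (simp add: norm_mult mult_right_mono)
  qed
qed

lemma norm_integral_le:
  fixes f :: "'b \<Rightarrow> complex"
  assumes "integrable M f" "integrable M g" "\<And>u. u \<in> space M \<Longrightarrow> norm (f u) \<le> g u"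
  shows "norm (LINT u|M. f u) \<le> (LINT u|M. g u)"
  by (rule order_trans[OF integral_norm_bound integral_mono]) (use assms in auto)

text \<open>\<open>R\<close> is merely integrable, so the Taylor remainder must be bounded uniformly
  in \<open>u\<close>. For \<open>A\<close> near \<open>A0\<close> all values \<open>T A u\<close>
  lie in one disc, where E and its first two derivatives are bounded; the error is then a constant
  times the squared distance of \<open>A\<close> from \<open>A0\<close> times the integral of the
  modulus of \<open>R\<close>.\<close>

lemma has_derivative_integral_holomorphic:
  fixes T :: "'a::real_normed_vector \<Rightarrow> 'b \<Rightarrow> complex" and E :: "complex \<Rightarrow> complex"
  assumes E: "E holomorphic_on UNIV" and R: "integrable M R"
    and lin: "\<And>u. u \<in> space M \<Longrightarrow> linear (\<lambda>A. T A u)"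
    and bound: "\<And>A u. u \<in> space M \<Longrightarrow> norm (T A u) \<le> C * norm A"
    and meas: "\<And>A. T A \<in> borel_measurable M"
  shows "((\<lambda>A. LINT u|M. E (T A u) * R u) has_derivative
    (\<lambda>B. LINT u|M. deriv E (T A0 u) * T B u * R u)) (at A0)"
proof -
  \<comment> \<open>The radius covers the unit ball around \<open>A0\<close>, and the absolute value
    makes it monotone in the norm for any sign of \<open>C\<close>.\<close>
  define r where "r = \<bar>C\<bar> * (norm A0 + 1)"
  have T_ball: "T A u \<in> cball 0 r" if "norm A \<le> norm A0 + 1" "u \<in> space M" for A u
  proof -
    have "norm (T A u) \<le> C * norm A" by (rule bound[OF that(2)])
    also have "\<dots> \<le> \<bar>C\<bar> * norm A" by (intro mult_right_mono) auto
    also have "\<dots> \<le> r" unfolding r_def using that(1) by (intro mult_left_mono) auto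
    finally show ?thesis by simp
  qed
  have hol1: "deriv E holomorphic_on UNIV" and hol2: "deriv (deriv E) holomorphic_on UNIV"
    using E by (auto intro: holomorphic_deriv)
  have bdd: "\<exists>K. \<forall>x\<in>cball 0 r. norm (f x) \<le> K" if "f holomorphic_on UNIV" for f :: "complex \<Rightarrow> complex"
  proof -
    have "compact (f ` cball 0 r)"
      using that by (intro compact_continuous_image holomorphic_on_imp_continuous_on)
        (auto elim: holomorphic_on_subset)
    then show ?thesis by (auto dest!: compact_imp_bounded simp: bounded_iff)
  qed
  obtain K0 where K0: "\<And>x. x \<in> cball 0 r \<Longrightarrow> norm (E x) \<le> K0" using bdd[OF E] by blast
  obtain K1 where K1: "\<And>x. x \<in> cball 0 r \<Longrightarrow> norm (deriv E x) \<le> K1" using bdd[OF hol1] by blast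
  obtain K2 where K2: "\<And>x. x \<in> cball 0 r \<Longrightarrow> norm (deriv (deriv E) x) \<le> K2" using bdd[OF hol2] by blast
  have deriv: "(f has_field_derivative deriv f x) (at x within cball 0 r)"
    if "f holomorphic_on UNIV" for f x
    using that by (metis UNIV_I has_field_derivative_at_within holomorphic_derivI open_UNIV)
  \<comment> \<open>Taylor's theorem of first order on a disc, whose convexity keeps the segment
    from w to z inside the region where \<open>K2\<close> is valid.\<close>
  have taylor: "norm (E z - (E w + deriv E w * (z - w))) \<le> K2 * norm (z - w) ^ 2"
    if "w \<in> cball 0 r" "z \<in> cball 0 r" for w z
  proof -
    define f where "f i = (deriv ^^ i) E" for i :: nat
    have "norm (f 0 z - (\<Sum>i\<le>1. f i w * (z - w) ^ i / fact i)) \<le> K2 * norm (z - w) ^ Suc 1 / fact 1"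
    proof (rule complex_Taylor[OF convex_cball _ _ that])
      fix i :: nat and x assume "i \<le> 1"
      then have "i = 0 \<or> i = 1" by auto
      then show "(f i has_field_derivative f (Suc i) x) (at x within cball 0 r)"
        using deriv[OF E] deriv[OF hol1] by (auto simp: f_def)
    qed (use K2 in \<open>auto simp: f_def\<close>)
    then show ?thesis by (simp add: f_def numeral_2_eq_2)
  qed
  have E_meas: "(\<lambda>u. f (T A u)) \<in> borel_measurable M" if "f holomorphic_on UNIV" for f :: "complex \<Rightarrow> complex" and A
    by (rule borel_measurable_continuous_on[OF holomorphic_on_imp_continuous_on[OF that] meas])
  have int0: "integrable M (\<lambda>u. E (T A u) * R u)" if "norm A \<le> norm A0 + 1" for A
    using T_ball[OF that] K0 E_meas[OF E] R by (intro integrable_bounded_mult[where K = K0]) auto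
  have TA0: "T A0 u \<in> cball 0 r" if "u \<in> space M" for u using T_ball[OF _ that] by simp
  have bnd1: "norm (deriv E (T A0 u) * T B u) \<le> K1 * (C * norm B)" if "u \<in> space M" for B u
    unfolding norm_mult
  proof (rule mult_mono)
    show "norm (deriv E (T A0 u)) \<le> K1" by (rule K1[OF TA0[OF that]])
    then show "0 \<le> K1" using norm_ge_zero order_trans by blast
  qed (use bound[OF that] in auto)
  have int1: "integrable M (\<lambda>u. deriv E (T A0 u) * T B u * R u)" for B
    using bnd1 E_meas[OF hol1] meas R
    by (intro integrable_bounded_mult[where K = "K1 * (C * norm B)"]) auto
  define I where "I = (LINT u|M. norm (R u))"
  have "I \<ge> 0" by (simp add: I_def)
  show ?thesis
  proof (rule has_derivativeI_sandwich[where e = 1])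
    show "bounded_linear (\<lambda>B. LINT u|M. deriv E (T A0 u) * T B u * R u)"
    proof (rule bounded_linear_intro)
      fix B B' :: 'a
      have "(LINT u|M. deriv E (T A0 u) * T (B + B') u * R u)
          = (LINT u|M. deriv E (T A0 u) * T B u * R u + deriv E (T A0 u) * T B' u * R u)"
        by (rule Bochner_Integration.integral_cong) (auto simp: linear_add[OF lin] algebra_simps)
      also have "\<dots> = (LINT u|M. deriv E (T A0 u) * T B u * R u) + (LINT u|M. deriv E (T A0 u) * T B' u * R u)"
        by (intro Bochner_Integration.integral_add int1)
      finally show "(LINT u|M. deriv E (T A0 u) * T (B + B') u * R u)
          = (LINT u|M. deriv E (T A0 u) * T B u * R u) + (LINT u|M. deriv E (T A0 u) * T B' u * R u)" .
    next
      fix s :: real and B :: 'a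
      have "(LINT u|M. deriv E (T A0 u) * T (s *\<^sub>R B) u * R u)
          = (LINT u|M. s *\<^sub>R (deriv E (T A0 u) * T B u * R u))"
        by (rule Bochner_Integration.integral_cong) (auto simp: linear_cmul[OF lin])
      then show "(LINT u|M. deriv E (T A0 u) * T (s *\<^sub>R B) u * R u)
          = s *\<^sub>R (LINT u|M. deriv E (T A0 u) * T B u * R u)"
        by simp
    next
      fix B :: 'a
      have "norm (LINT u|M. deriv E (T A0 u) * T B u * R u) \<le> (LINT u|M. (K1 * (C * norm B)) * norm (R u))"
      proof (rule norm_integral_le[OF int1])
        show "integrable M (\<lambda>u. K1 * (C * norm B) * norm (R u))" using R by simp
        fix u assume u: "u \<in> space M"
        show "norm (deriv E (T A0 u) * T B u * R u) \<le> K1 * (C * norm B) * norm (R u)"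
          unfolding norm_mult[of _ "R u"] by (intro mult_right_mono bnd1 u) auto
      qed
      then show "norm (LINT u|M. deriv E (T A0 u) * T B u * R u) \<le> norm B * (K1 * C * I)"
        by (simp add: I_def algebra_simps)
    qed
  next
    fix A assume A: "A \<noteq> A0" "dist A A0 < 1"
    have nA: "norm A \<le> norm A0 + 1"
      using A(2) norm_triangle_ineq2[of A A0] by (simp add: dist_norm)
    have "(LINT u|M. E (T A u) * R u) - (LINT u|M. E (T A0 u) * R u)
        - (LINT u|M. deriv E (T A0 u) * T (A - A0) u * R u)
      = (LINT u|M. E (T A u) * R u - E (T A0 u) * R u - deriv E (T A0 u) * T (A - A0) u * R u)"
      using int0[OF nA] int0[of A0] int1 by simp
    also have "norm \<dots> \<le> (LINT u|M. K2 * (C * norm (A - A0)) ^ 2 * norm (R u))"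
    proof (rule norm_integral_le)
      show "integrable M (\<lambda>u. E (T A u) * R u - E (T A0 u) * R u - deriv E (T A0 u) * T (A - A0) u * R u)"
        using int0[OF nA] int0[of A0] int1 by simp
      show "integrable M (\<lambda>u. K2 * (C * norm (A - A0)) ^ 2 * norm (R u))" using R by simp
      fix u assume u: "u \<in> space M"
      have diff: "T A u - T A0 u = T (A - A0) u" by (simp add: linear_diff[OF lin[OF u]])
      have "K2 \<ge> 0" using K2[OF TA0[OF u]] norm_ge_zero order_trans by blast
      have "norm (E (T A u) - (E (T A0 u) + deriv E (T A0 u) * (T A u - T A0 u)))
          \<le> K2 * norm (T A u - T A0 u) ^ 2"
        by (rule taylor[OF TA0[OF u] T_ball[OF nA u]])
      also have "\<dots> \<le> K2 * (C * norm (A - A0)) ^ 2"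
        unfolding diff using bound[OF u] \<open>K2 \<ge> 0\<close> by (intro mult_left_mono power_mono) auto
      finally have "norm (E (T A u) - (E (T A0 u) + deriv E (T A0 u) * T (A - A0) u))
          \<le> K2 * (C * norm (A - A0)) ^ 2" unfolding diff .
      then have "norm (E (T A u) - (E (T A0 u) + deriv E (T A0 u) * T (A - A0) u)) * norm (R u)
          \<le> K2 * (C * norm (A - A0)) ^ 2 * norm (R u)"
        by (rule mult_right_mono) simp
      then show "norm (E (T A u) * R u - E (T A0 u) * R u - deriv E (T A0 u) * T (A - A0) u * R u)
          \<le> K2 * (C * norm (A - A0)) ^ 2 * norm (R u)"
        by (simp add: norm_mult[symmetric] algebra_simps)
    qed
    also have "\<dots> = (K2 * C\<^sup>2 * I * norm (A - A0)) * norm (A - A0)"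
      by (simp add: I_def power2_eq_square algebra_simps)
    finally show "norm ((LINT u|M. E (T A u) * R u) - (LINT u|M. E (T A0 u) * R u)
        - (LINT u|M. deriv E (T A0 u) * T (A - A0) u * R u)) / norm (A - A0)
        \<le> K2 * C\<^sup>2 * I * norm (A - A0)"
      using A(1) by (simp add: divide_le_eq)
  next
    have "((\<lambda>A. K2 * C\<^sup>2 * I * norm (A - A0)) \<longlongrightarrow> K2 * C\<^sup>2 * I * norm (A0 - A0)) (at A0)"
      by (intro tendsto_intros)
    then show "((\<lambda>A. K2 * C\<^sup>2 * I * norm (A - A0)) \<longlongrightarrow> 0) (at A0)" by simp
  qed simp
qed

lemma SU2_entry_norm_le:
  assumes "u \<in> SU2"
  shows "norm (u$i$j) \<le> 1"
proof -
  have "(dagger u ** u)$j$j = 1" using SU2D(2)[OF assms] by (simp add: mat_entry)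
  then have "of_real ((norm (u$1$j))\<^sup>2 + (norm (u$2$j))\<^sup>2) = (1 :: complex)"
    by (simp add: mmult_entry dagger_entry complex_norm_square mult.commute del: of_real_power)
  then have sum: "(norm (u$1$j))\<^sup>2 + (norm (u$2$j))\<^sup>2 = 1"
    using of_real_eq_1_iff by blast
  have "(norm (u$1$j))\<^sup>2 \<le> 1" "(norm (u$2$j))\<^sup>2 \<le> 1"
    using sum zero_le_power2[of "norm (u$1$j)"] zero_le_power2[of "norm (u$2$j)"] by linarith+
  then have "(norm (u$i$j))\<^sup>2 \<le> 1" using exhaust_2[of i] by auto
  then show ?thesis using power2_le_imp_le[of "norm (u$i$j)" 1] by simp
qed

text \<open>The trace is a sum of four products of an entry of \<open>A\<close> with a conjugated
  entry of \<open>u\<close>, hence the constant 4.\<close>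

lemma norm_trace_mult_dagger_le:
  assumes "u \<in> SU2"
  shows "norm (trace (A ** dagger u)) \<le> 4 * norm A"
proof -
  have entry: "norm (A$i$j * cnj (u$k$l)) \<le> norm A" for i j k l
  proof -
    have "norm (A$i$j) \<le> norm (A$i)" by (rule Finite_Cartesian_Product.norm_nth_le)
    also have "\<dots> \<le> norm A" by (rule Finite_Cartesian_Product.norm_nth_le)
    finally have "norm (A$i$j) \<le> norm A" .
    then have "norm (A$i$j) * norm (u$k$l) \<le> norm A * 1"
      by (intro mult_mono SU2_entry_norm_le assms) auto
    then show ?thesis by (simp add: norm_mult)
  qed
  have "norm (trace (A ** dagger u)) \<le>
      norm (A$1$1 * cnj (u$1$1)) + norm (A$1$2 * cnj (u$1$2))
      + (norm (A$2$1 * cnj (u$2$1)) + norm (A$2$2 * cnj (u$2$2)))"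
    unfolding trace_mat2 mmult_entry dagger_entry
    by (intro norm_triangle_le add_mono norm_triangle_ineq)
  also have "\<dots> \<le> norm A + norm A + (norm A + norm A)"
    by (intro add_mono entry)
  finally show ?thesis by simp
qed

lemma linear_trace_mult: "linear (\<lambda>A. trace (A ** (B :: mat2)))"
  by (rule linearI) (simp_all add: mat2_simps algebra_simps)

text \<open>The sigma-algebra of \<open>\<mu>\<close> is the restriction of the Borel one to SU(2),
  so the inclusion into the matrices is measurable and can follow the coordinate projection.\<close>

lemma haar_measurable_component:
  assumes "haar_SU2 \<mu>" "e \<in> arcs \<gamma>"
  shows "(\<lambda>u. u e) \<in> borel_measurable (SU2_edges \<gamma> \<mu>)"
proof -
  have "(\<lambda>u. u e) \<in> measurable (SU2_edges \<gamma> \<mu>) \<mu>"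
    unfolding SU2_edges_def using assms(2) by (rule measurable_component_singleton)
  moreover have "(\<lambda>x. x) \<in> borel_measurable \<mu>"
  proof -
    have "(\<lambda>x. x) \<in> borel_measurable (restrict_space borel SU2 :: mat2 measure)"
      by (rule measurable_restrict_space1) simp
    moreover have "measurable \<mu> borel = measurable (restrict_space borel SU2) (borel :: mat2 measure)"
      using assms(1) by (intro measurable_cong_sets) (auto simp: haar_SU2_def)
    ultimately show ?thesis by simp
  qed
  ultimately show ?thesis by (rule measurable_compose)
qed

lemma space_SU2_edges:
  assumes "haar_SU2 \<mu>" "u \<in> space (SU2_edges \<gamma> \<mu>)" "e \<in> arcs \<gamma>"
  shows "u e \<in> SU2"
  using assms by (auto simp: SU2_edges_def space_PiM haar_SU2_def)

lemma prob_space_SU2_edges: "haar_SU2 \<mu> \<Longrightarrow> prob_space (SU2_edges \<gamma> \<mu>)"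
  unfolding SU2_edges_def by (rule prob_space_PiM) (simp add: haar_SU2_def)

lemma measurable_trace_component:
  assumes "haar_SU2 \<mu>" "e \<in> arcs \<gamma>"
  shows "(\<lambda>u. trace (A ** dagger (u e))) \<in> borel_measurable (SU2_edges \<gamma> \<mu>)"
proof -
  have "continuous_on UNIV (\<lambda>v. trace (A ** dagger v))"
    by (intro linear_continuous_on bounded_linear_compose[OF bounded_linear_trace]
      bounded_linear_compose[OF bounded_bilinear.bounded_linear_right[OF bounded_bilinear_mmult]]
      bounded_linear_dagger)
  from borel_measurable_continuous_on[OF this haar_measurable_component[OF assms]]
  show ?thesis .
qed

lemma edge_state_measurable:
  assumes "haar_SU2 \<mu>" "e \<in> arcs \<gamma>" "t > 0" "g \<in> SL2C"
  shows "(\<lambda>u. edge_state t g (u e)) \<in> borel_measurable (SU2_edges \<gamma> \<mu>)"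
proof -
  have "(\<lambda>u. edge_fun t (trace (g ** dagger (u e)))) \<in> borel_measurable (SU2_edges \<gamma> \<mu>)"
    by (rule borel_measurable_continuous_on[OF holomorphic_on_imp_continuous_on[OF
          holomorphic_edge_fun[OF assms(3)]] measurable_trace_component[OF assms(1,2)]])
  moreover have "edge_state t g (u e) = edge_fun t (trace (g ** dagger (u e)))"
    if "u \<in> space (SU2_edges \<gamma> \<mu>)" for u
    using edge_state_eq assms(4) space_SU2_edges[OF assms(1) that assms(2)] by blast
  ultimately show ?thesis by (simp cong: measurable_cong)
qed

lemma edge_state_bounded:
  assumes "t > 0" "g \<in> SL2C"
  obtains K where "\<And>u. u \<in> SU2 \<Longrightarrow> norm (edge_state t g u) \<le> K"
proof -
  have "compact (edge_fun t ` cball 0 (4 * norm g))"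
    using holomorphic_edge_fun[OF assms(1)]
    by (intro compact_continuous_image holomorphic_on_imp_continuous_on)
      (auto elim: holomorphic_on_subset)
  then obtain K where "\<forall>y\<in>edge_fun t ` cball 0 (4 * norm g). norm y \<le> K"
    by (auto dest!: compact_imp_bounded simp: bounded_iff)
  then have K: "\<And>x. x \<in> cball 0 (4 * norm g) \<Longrightarrow> norm (edge_fun t x) \<le> K"
    by blast
  show ?thesis
  proof (rule that)
    fix u assume "u \<in> SU2"
    then show "norm (edge_state t g u) \<le> K"
      using K norm_trace_mult_dagger_le[of u g] by (simp add: edge_state_eq[OF assms(2)])
  qed
qed

text \<open>Each edge state is bounded and measurable on SU(2), so the factors can be multiplied
  onto an integrable function one at a time.\<close>

lemma integrable_prod_edge_states:
  assumes haar: "haar_SU2 \<mu>" and "finite J" "J \<subseteq> arcs \<gamma>" "t > 0"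
    and "\<And>e. e \<in> J \<Longrightarrow> k e \<in> SL2C" and R: "integrable (SU2_edges \<gamma> \<mu>) R"
  shows "integrable (SU2_edges \<gamma> \<mu>) (\<lambda>u. (\<Prod>e\<in>J. edge_state t (k e) (u e)) * R u)"
  using assms(2,3,5)
proof (induction J rule: finite_induct)
  case empty
  then show ?case using R by simp
next
  case (insert e J)
  obtain K where K: "\<And>u. u \<in> SU2 \<Longrightarrow> norm (edge_state t (k e) u) \<le> K"
    using edge_state_bounded[OF \<open>t > 0\<close>] insert.prems by blast
  have "integrable (SU2_edges \<gamma> \<mu>)
      (\<lambda>u. edge_state t (k e) (u e) * ((\<Prod>e\<in>J. edge_state t (k e) (u e)) * R u))"
  proof (rule integrable_bounded_mult[where K = K and F = "\<lambda>u. edge_state t (k e) (u e)"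
        and R = "\<lambda>u. (\<Prod>e\<in>J. edge_state t (k e) (u e)) * R u"])
    show "(\<lambda>u. edge_state t (k e) (u e)) \<in> borel_measurable (SU2_edges \<gamma> \<mu>)"
      using insert.prems by (intro edge_state_measurable[OF haar _ \<open>t > 0\<close>]) auto
    show "integrable (SU2_edges \<gamma> \<mu>) (\<lambda>u. (\<Prod>e\<in>J. edge_state t (k e) (u e)) * R u)"
      using insert.prems by (intro insert.IH) auto
    show "norm (edge_state t (k e) (u e)) \<le> K" if "u \<in> space (SU2_edges \<gamma> \<mu>)" for u
      using K space_SU2_edges[OF haar that] insert.prems by simp
  qed
  then show ?case using insert by (simp add: mult.assoc)
qed

text \<open>On a probability space the majorant 1 + r^2 of r is integrable.\<close>

lemma L2_integrable:
  assumes "haar_SU2 \<mu>" "\<phi> \<in> L2 (SU2_edges \<gamma> \<mu>)"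
  shows "integrable (SU2_edges \<gamma> \<mu>) \<phi>"
proof (rule Bochner_Integration.integrable_bound)
  interpret prob_space "SU2_edges \<gamma> \<mu>" by (rule prob_space_SU2_edges) fact
  show "integrable (SU2_edges \<gamma> \<mu>) (\<lambda>u. 1 + (norm (\<phi> u))\<^sup>2)"
    using assms(2) by (simp add: L2_def)
  show "\<phi> \<in> borel_measurable (SU2_edges \<gamma> \<mu>)" using assms(2) by (simp add: L2_def)
  have "r \<le> 1 + r\<^sup>2" for r :: real
  proof -
    have "0 \<le> (r - 1)\<^sup>2" "0 \<le> r\<^sup>2" by simp_all
    then show ?thesis unfolding power2_eq_square left_diff_distrib right_diff_distrib by linarith
  qed
  then show "AE u in SU2_edges \<gamma> \<mu>. norm (\<phi> u) \<le> norm (1 + (norm (\<phi> u))\<^sup>2)"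
    by (auto simp: abs_of_nonneg)
qed

text \<open>The factors of the other edges do not move and join \<open>\<phi>\<close> in the
  integrable weight \<open>R\<close>. What remains is one entire function of a trace linear in the
  matrix of edge \<open>e\<close>, composed with the exponential curve through
  \<open>k e\<close>.\<close>

lemma coherent_state_integral_deriv:
  assumes haar: "haar_SU2 \<mu>" and fin: "finite (arcs \<gamma>)" and t: "t > 0"
    and k: "\<forall>e\<in>arcs \<gamma>. k e \<in> SL2C" and e: "e \<in> arcs \<gamma>"
    and \<phi>: "\<phi> \<in> L2 (SU2_edges \<gamma> \<mu>)"
  shows "\<exists>d. ((\<lambda>\<xi>. LINT u|SU2_edges \<gamma> \<mu>. coherent_state \<gamma> t (vary k e \<xi>) u * \<phi> u)
    has_derivative (\<lambda>\<xi>. \<Sum>a\<in>UNIV. \<xi>$a * d a)) (at 0)"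
proof -
  let ?M = "SU2_edges \<gamma> \<mu>"
  define R where "R u = (\<Prod>e'\<in>arcs \<gamma> - {e}. edge_state t (k e') (u e')) * \<phi> u" for u
  have R: "integrable ?M R"
    unfolding R_def using fin k
    by (intro integrable_prod_edge_states[OF haar _ _ t] L2_integrable[OF haar \<phi>]) auto
  define T where "T A u = trace (A ** dagger (u e))" for A :: mat2 and u
  define D where "D B = (LINT u|?M. deriv (edge_fun t) (T (k e) u) * T B u * R u)" for B
  have I: "((\<lambda>A. LINT u|?M. edge_fun t (T A u) * R u) has_derivative D) (at (k e))"
    unfolding D_def
  proof (rule has_derivative_integral_holomorphic[OF holomorphic_edge_fun[OF t] R])
    show "linear (\<lambda>A. T A u)" for u unfolding T_def by (rule linear_trace_mult)
    show "norm (T A u) \<le> 4 * norm A" if "u \<in> space ?M" for A u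
      unfolding T_def by (rule norm_trace_mult_dagger_le[OF space_SU2_edges[OF haar that e]])
    show "T A \<in> borel_measurable ?M" for A
      unfolding T_def by (rule measurable_trace_component[OF haar e])
  qed
  have curve: "((\<lambda>\<xi>. k e ** mexp (tau_comb \<xi>)) has_derivative (\<lambda>\<xi>. k e ** tau_comb \<xi>)) (at 0)"
    by (rule bounded_linear.has_derivative[OF
          bounded_bilinear.bounded_linear_right[OF bounded_bilinear_mmult] mexp_has_derivative])
  have "((\<lambda>\<xi>. LINT u|?M. edge_fun t (T (k e ** mexp (tau_comb \<xi>)) u) * R u)
      has_derivative (\<lambda>\<xi>. D (k e ** tau_comb \<xi>))) (at 0)"
    using has_derivative_compose[OF curve, of "\<lambda>A. LINT u|?M. edge_fun t (T A u) * R u" D] I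
    by (simp add: mexp_0)
  \<comment> \<open>The return from \<open>edge_fun\<close> to the states is valid along the curve
    because it stays in SL(2,C).\<close>
  moreover have "(LINT u|?M. edge_fun t (T (k e ** mexp (tau_comb \<xi>)) u) * R u)
      = (LINT u|?M. coherent_state \<gamma> t (vary k e \<xi>) u * \<phi> u)" for \<xi>
  proof (rule Bochner_Integration.integral_cong)
    fix u assume u: "u \<in> space ?M"
    have "edge_state t (k e ** mexp (tau_comb \<xi>)) (u e) = edge_fun t (T (k e ** mexp (tau_comb \<xi>)) u)"
      unfolding T_def
      by (intro edge_state_eq SL2C_mult bspec[OF k] e mexp_SL2C space_SU2_edges[OF haar u])
    moreover have "coherent_state \<gamma> t (vary k e \<xi>) u =
        edge_state t (k e ** mexp (tau_comb \<xi>)) (u e) * (\<Prod>e'\<in>arcs \<gamma> - {e}. edge_state t (k e') (u e'))"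
      using e by (simp add: coherent_state_def prod.remove[OF fin e] vary_def)
    ultimately show "edge_fun t (T (k e ** mexp (tau_comb \<xi>)) u) * R u
        = coherent_state \<gamma> t (vary k e \<xi>) u * \<phi> u"
      by (simp add: R_def)
  qed simp
  moreover have "D (k e ** tau_comb \<xi>) = (\<Sum>a\<in>UNIV. \<xi>$a * D (k e ** tau a))" for \<xi>
  proof -
    \<comment> \<open>The general lemma gives a real-linear \<open>D\<close>. Homogeneity under
      complex scalars is the holomorphy of the integral, and it makes the differential a linear form
      in the components of \<open>\<xi>\<close>.\<close>
    have lin: "linear D" using has_derivative_linear[OF I] .
    have scale: "D (mat c ** B) = c * D B" for c B
    proof -
      have "T (mat c ** B) u = c * T B u" for u
        by (simp add: T_def mat2_simps algebra_simps)
      then have "D (mat c ** B) = (LINT u|?M. c * (deriv (edge_fun t) (T (k e) u) * T B u * R u))"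
        unfolding D_def by (intro Bochner_Integration.integral_cong) (simp_all add: mult_ac)
      then show ?thesis by (simp add: D_def)
    qed
    have "k e ** tau_comb \<xi> = (\<Sum>a\<in>UNIV. mat (\<xi>$a) ** (k e ** tau a))"
      by (simp add: mat2_simps sum_3 algebra_simps)
    then show ?thesis by (simp add: linear_sum[OF lin] scale)
  qed
  ultimately show ?thesis by auto
qed

section \<open>Matrix elements between coherent states\<close>

lemma L2_inner_cnj: "L2_inner M f g = cnj (L2_inner M g f)"
proof -
  have "cnj (cnj (g x) * f x) = cnj (f x) * g x" for x by simp
  then show ?thesis
    unfolding L2_inner_def Bochner_Integration.integral_cnj[symmetric] by (simp add: mult.commute)
qed

text \<open>The pair of \<open>f\<close> and \<open>H f\<close> lies in the graph of
  \<open>H\<close>, hence in that of the adjoint.\<close>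

lemma self_adjoint_symmetric:
  assumes "self_adjoint_operator M D H" "f \<in> D" "d \<in> D"
  shows "L2_inner M f (H d) = L2_inner M (H f) d"
proof -
  have "H f \<in> L2 M" using assms by (auto simp: self_adjoint_operator_def L2_operator_def)
  then have "(f, H f) \<in> adjoint_graph M D H"
    using assms(1,2) by (auto simp: self_adjoint_operator_def)
  then show ?thesis using assms(3) by (auto simp: adjoint_graph_def)
qed

section \<open>Complex-linear differentials and Wirtinger derivatives\<close>

lemma has_derivative_cong_rhs:
  assumes "(f has_derivative f') F" "\<And>x. f' x = g x"
  shows "(f has_derivative g) F"
  using assms by (metis ext)

text \<open>The quotient rule multiplies the two linear forms by numbers independent of
  \<open>\<xi>\<close>, so complex linearity survives. The coefficients stay existential because
  they are identified afterwards as Wirtinger derivatives.\<close>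

lemma has_derivative_quotient_linear:
  fixes f g :: "complex^'n \<Rightarrow> complex"
  assumes "(f has_derivative (\<lambda>\<xi>. \<Sum>a\<in>UNIV. \<xi>$a * d a)) (at x)"
    and "(g has_derivative (\<lambda>\<xi>. \<Sum>a\<in>UNIV. \<xi>$a * d' a)) (at x)" and "g x \<noteq> 0"
  shows "\<exists>q. ((\<lambda>\<xi>. f \<xi> / g \<xi>) has_derivative (\<lambda>\<xi>. \<Sum>a\<in>UNIV. \<xi>$a * q a)) (at x)"
proof (intro exI)
  show "((\<lambda>\<xi>. f \<xi> / g \<xi>) has_derivative
      (\<lambda>\<xi>. \<Sum>a\<in>UNIV. \<xi>$a * ((d a * g x - f x * d' a) / (g x * g x)))) (at x)"
    by (rule has_derivative_cong_rhs[OF has_derivative_divide'[OF assms]])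
      (use assms(3) in \<open>simp add: mult_ac sum_distrib_left sum_distrib_right sum_subtractf sum_divide_distrib algebra_simps diff_divide_distrib\<close>)
qed

lemma bounded_linear_axis: "bounded_linear (axis a :: complex \<Rightarrow> complex^'n)"
proof -
  have "linear (axis a :: complex \<Rightarrow> complex^'n)"
    by (rule linearI) (auto simp: axis_def vec_eq_iff)
  then show ?thesis by (simp add: linear_conv_bounded_linear)
qed

lemma has_derivative_axis:
  fixes F :: "complex^'n \<Rightarrow> complex"
  assumes "(F has_derivative F') (at 0)"
  shows "((\<lambda>\<epsilon>. F (axis a \<epsilon>)) has_derivative (\<lambda>\<epsilon>. F' (axis a \<epsilon>))) (at 0)"
proof -
  have z: "axis a 0 = (0 :: complex^'n)" by (simp add: axis_def vec_eq_iff)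
  show ?thesis
    by (rule has_derivative_compose[OF bounded_linear_imp_has_derivative[OF bounded_linear_axis], where g = F])
      (simp only: z assms)
qed

text \<open>Along one axis the differential is multiplication by \<open>d a\<close>. Its values at 1
  and at the imaginary unit then combine to \<open>d a\<close> itself.\<close>

lemma wirtinger_axis:
  assumes "(F has_derivative (\<lambda>\<xi>. \<Sum>a\<in>UNIV. \<xi>$a * d a)) (at 0)"
  shows "wirtinger (\<lambda>\<epsilon>. F (axis a \<epsilon>)) 0 = d (a :: 'n::finite)"
proof -
  have "((\<lambda>\<epsilon>. F (axis a \<epsilon>)) has_derivative (\<lambda>\<epsilon>. \<Sum>b\<in>UNIV. axis a \<epsilon> $ b * d b)) (at 0)"
    by (rule has_derivative_axis[OF assms])
  moreover have "(\<Sum>b\<in>UNIV. axis a \<epsilon> $ b * d b) = \<epsilon> * d a" for \<epsilon>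
    by (simp add: axis_def if_distrib[of "\<lambda>x. x * _"] cong: if_cong)
  ultimately have "((\<lambda>\<epsilon>. F (axis a \<epsilon>)) has_derivative (\<lambda>\<epsilon>. \<epsilon> * d a)) (at 0)"
    by simp
  then have "frechet_derivative (\<lambda>\<epsilon>. F (axis a \<epsilon>)) (at 0) = (\<lambda>\<epsilon>. \<epsilon> * d a)"
    by (rule frechet_derivative_at[symmetric])
  then show ?thesis by (simp add: wirtinger_def)
qed

text \<open>Differentiability ensures that \<open>frechet_derivative\<close> denotes the actual
  derivative, through which conjugation passes.\<close>

lemma wirtinger_bar_cnj:
  assumes "f differentiable at w"
  shows "wirtinger_bar (\<lambda>x. cnj (f x)) w = cnj (wirtinger f w)"
proof -
  have "(f has_derivative frechet_derivative f (at w)) (at w)"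
    using assms by (simp add: frechet_derivative_works)
  then have "((\<lambda>x. cnj (f x)) has_derivative (\<lambda>x. cnj (frechet_derivative f (at w) x))) (at w)"
    by (rule has_derivative_cnj)
  then have "frechet_derivative (\<lambda>x. cnj (f x)) (at w) = (\<lambda>x. cnj (frechet_derivative f (at w) x))"
    by (rule frechet_derivative_at[symmetric])
  then show ?thesis by (simp add: wirtinger_def wirtinger_bar_def)
qed

lemma vary_SL2C:
  assumes "\<forall>e\<in>A. k e \<in> SL2C" "e' \<in> A"
  shows "vary k e \<xi> e' \<in> SL2C"
  using assms by (auto simp: vary_def intro: SL2C_mult mexp_SL2C)

lemma vary_0 [simp]: "vary k e 0 = k"
  by (simp add: vary_def mexp_0)

lemma coherent_inner_deriv:
  assumes haar: "haar_SU2 \<mu>" and fin: "finite (arcs \<gamma>)" and t: "t > 0"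
    and k: "\<forall>e\<in>arcs \<gamma>. k e \<in> SL2C" and e: "e \<in> arcs \<gamma>"
    and \<phi>: "\<phi> \<in> L2 (SU2_edges \<gamma> \<mu>)"
  shows "\<exists>d. ((\<lambda>\<xi>. L2_inner (SU2_edges \<gamma> \<mu>) \<phi> (coherent_state \<gamma> t (vary k e \<xi>)))
    has_derivative (\<lambda>\<xi>. \<Sum>a\<in>UNIV. \<xi>$a * d a)) (at 0)"
proof -
  have "(\<lambda>u. cnj (\<phi> u)) \<in> L2 (SU2_edges \<gamma> \<mu>)"
    using \<phi> by (auto simp: L2_def intro: borel_measurable_continuous_on[OF continuous_on_cnj[OF continuous_on_id]])
  from coherent_state_integral_deriv[OF haar fin t k e this] show ?thesis
    by (simp add: L2_inner_def mult.commute)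
qed

lemma H_ratio_right_deriv:
  assumes haar: "haar_SU2 \<mu>" and fin: "finite (arcs \<gamma>)" and t: "t > 0"
    and H: "self_adjoint_operator (SU2_edges \<gamma> \<mu>) D H"
    and dom: "\<And>k. (\<forall>e\<in>arcs \<gamma>. k e \<in> SL2C) \<Longrightarrow> coherent_state \<gamma> t k \<in> D"
    and k1: "\<forall>e\<in>arcs \<gamma>. k1 e \<in> SL2C" and k2: "\<forall>e\<in>arcs \<gamma>. k2 e \<in> SL2C"
    and nz: "overlap \<gamma> \<mu> t k1 k2 \<noteq> 0" and e: "e \<in> arcs \<gamma>"
  shows "((\<lambda>\<xi>. H_ratio \<gamma> \<mu> H t k1 (vary k2 e \<xi>)) has_derivative
    (\<lambda>\<xi>. \<Sum>a\<in>UNIV. \<xi>$a * wirtinger (\<lambda>\<epsilon>. H_ratio \<gamma> \<mu> H t k1 (vary k2 e (axis a \<epsilon>))) 0)) (at 0)"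
proof -
  let ?M = "SU2_edges \<gamma> \<mu>"
  have L2: "D \<subseteq> L2 ?M" "H ` D \<subseteq> L2 ?M"
    using H by (auto simp: self_adjoint_operator_def L2_operator_def)
  have D1: "coherent_state \<gamma> t k1 \<in> D" using k1 by (intro dom) auto
  have D2: "coherent_state \<gamma> t (vary k2 e \<xi>) \<in> D" for \<xi>
    using k2 by (intro dom) (auto intro: vary_SL2C)
  have HL2: "H (coherent_state \<gamma> t k1) \<in> L2 ?M" and DL2: "coherent_state \<gamma> t k1 \<in> L2 ?M"
    using L2 D1 by auto
  obtain d where d: "((\<lambda>\<xi>. L2_inner ?M (H (coherent_state \<gamma> t k1)) (coherent_state \<gamma> t (vary k2 e \<xi>)))
      has_derivative (\<lambda>\<xi>. \<Sum>a\<in>UNIV. \<xi>$a * d a)) (at 0)"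
    using coherent_inner_deriv[OF haar fin t k2 e HL2] by blast
  obtain d' where d': "((\<lambda>\<xi>. overlap \<gamma> \<mu> t k1 (vary k2 e \<xi>))
      has_derivative (\<lambda>\<xi>. \<Sum>a\<in>UNIV. \<xi>$a * d' a)) (at 0)"
    unfolding overlap_def using coherent_inner_deriv[OF haar fin t k2 e DL2] by blast
  have "overlap \<gamma> \<mu> t k1 (vary k2 e 0) \<noteq> 0" using nz by simp
  from has_derivative_quotient_linear[OF d d' this]
  obtain q where q: "((\<lambda>\<xi>. H_ratio \<gamma> \<mu> H t k1 (vary k2 e \<xi>)) has_derivative
      (\<lambda>\<xi>. \<Sum>a\<in>UNIV. \<xi>$a * q a)) (at 0)"
    \<comment> \<open>This moves \<open>H\<close> to the state of \<open>k1\<close> for every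
      \<open>\<xi>\<close> at once, since all varied labels stay in SL(2,C) and their states in
      \<open>D\<close>.\<close>
    unfolding H_ratio_def self_adjoint_symmetric[OF H D1 D2] by blast
  show ?thesis using q unfolding wirtinger_axis[OF q] .
qed

lemma H_ratio_cnj:
  assumes H: "self_adjoint_operator (SU2_edges \<gamma> \<mu>) D H"
    and "coherent_state \<gamma> t k1 \<in> D" "coherent_state \<gamma> t k2 \<in> D"
  shows "H_ratio \<gamma> \<mu> H t k1 k2 = cnj (H_ratio \<gamma> \<mu> H t k2 k1)"
  unfolding H_ratio_def overlap_def self_adjoint_symmetric[OF H assms(2,3)]
  using L2_inner_cnj[of _ "coherent_state \<gamma> t k1"] L2_inner_cnj[of _ "H (coherent_state \<gamma> t k1)"]
  by simp

text \<open>Conjugation exchanges the two states, so this is the conjugate of the variation on the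
  right: the components of \<open>\<xi>\<close> become conjugated and the Wirtinger derivative
  becomes the barred one.\<close>

lemma H_ratio_left_deriv:
  assumes haar: "haar_SU2 \<mu>" and fin: "finite (arcs \<gamma>)" and t: "t > 0"
    and H: "self_adjoint_operator (SU2_edges \<gamma> \<mu>) D H"
    and dom: "\<And>k. (\<forall>e\<in>arcs \<gamma>. k e \<in> SL2C) \<Longrightarrow> coherent_state \<gamma> t k \<in> D"
    and k1: "\<forall>e\<in>arcs \<gamma>. k1 e \<in> SL2C" and k2: "\<forall>e\<in>arcs \<gamma>. k2 e \<in> SL2C"
    and nz: "overlap \<gamma> \<mu> t k1 k2 \<noteq> 0" and e: "e \<in> arcs \<gamma>"
  shows "((\<lambda>\<xi>. H_ratio \<gamma> \<mu> H t (vary k1 e \<xi>) k2) has_derivative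
    (\<lambda>\<xi>. \<Sum>a\<in>UNIV. cnj (\<xi>$a) * wirtinger_bar (\<lambda>\<epsilon>. H_ratio \<gamma> \<mu> H t (vary k1 e (axis a \<epsilon>)) k2) 0)) (at 0)"
proof -
  have eq: "H_ratio \<gamma> \<mu> H t (vary k1 e \<xi>) k2 = cnj (H_ratio \<gamma> \<mu> H t k2 (vary k1 e \<xi>))" for \<xi>
    using k1 k2 by (intro H_ratio_cnj[OF H] dom) (auto intro: vary_SL2C)
  have nz': "overlap \<gamma> \<mu> t k2 k1 \<noteq> 0"
    using nz L2_inner_cnj[of _ "coherent_state \<gamma> t k1"] by (simp add: overlap_def)
  note der = H_ratio_right_deriv[OF haar fin t H dom k2 k1 nz' e]
  have diff: "(\<lambda>\<epsilon>. H_ratio \<gamma> \<mu> H t k2 (vary k1 e (axis a \<epsilon>))) differentiable at 0" for a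
  proof -
    have "((\<lambda>\<epsilon>. H_ratio \<gamma> \<mu> H t k2 (vary k1 e (axis a \<epsilon>))) has_derivative
       (\<lambda>\<epsilon>. \<Sum>b\<in>UNIV. axis a \<epsilon> $ b * wirtinger (\<lambda>\<epsilon>. H_ratio \<gamma> \<mu> H t k2 (vary k1 e (axis b \<epsilon>))) 0)) (at 0)"
      by (rule has_derivative_axis[OF der])
    then show ?thesis by (rule differentiableI)
  qed
  have "wirtinger_bar (\<lambda>\<epsilon>. H_ratio \<gamma> \<mu> H t (vary k1 e (axis a \<epsilon>)) k2) 0
      = cnj (wirtinger (\<lambda>\<epsilon>. H_ratio \<gamma> \<mu> H t k2 (vary k1 e (axis a \<epsilon>))) 0)" for a
    unfolding eq by (rule wirtinger_bar_cnj[OF diff])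
  then have "(\<lambda>\<xi>. \<Sum>a\<in>UNIV. cnj (\<xi>$a) * wirtinger_bar (\<lambda>\<epsilon>. H_ratio \<gamma> \<mu> H t (vary k1 e (axis a \<epsilon>)) k2) 0)
     = (\<lambda>\<xi>. cnj (\<Sum>a\<in>UNIV. \<xi>$a * wirtinger (\<lambda>\<epsilon>. H_ratio \<gamma> \<mu> H t k2 (vary k1 e (axis a \<epsilon>))) 0))"
    by simp
  then show ?thesis
    unfolding eq using has_derivative_cnj[OF der] by simp
qed

section \<open>The differential of the action\<close>

text \<open>The differential of z^2 at (X, Y) in the direction (X', Y'). The factor 2 in the
  derivative of the squared arcosh cancels against the 1/2 in \<open>x_of\<close>.\<close>

definition z_square_diff :: "mat2 \<Rightarrow> mat2 \<Rightarrow> mat2 \<Rightarrow> mat2 \<Rightarrow> complex" where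
  "z_square_diff X Y X' Y' = z_quot (x_of X Y) * (trace (dagger X' ** Y) + trace (dagger X ** Y'))"

lemma z_square_has_derivative:
  assumes X: "(X has_derivative X') (at p)" and Y: "(Y has_derivative Y') (at p)"
    and cut: "x_of (X p) (Y p) \<notin> complex_of_real ` {..-1}"
  shows "((\<lambda>q. (z_of (X q) (Y q))\<^sup>2) has_derivative (\<lambda>\<xi>. z_square_diff (X p) (Y p) (X' \<xi>) (Y' \<xi>))) (at p)"
proof -
  have "((\<lambda>q. trace (dagger (X q) ** Y q)) has_derivative
      (\<lambda>\<xi>. trace (dagger (X p) ** Y' \<xi> + dagger (X' \<xi>) ** Y p))) (at p)"
    by (intro bounded_linear.has_derivative[OF bounded_linear_trace]
      bounded_bilinear.FDERIV[OF bounded_bilinear_mmult] bounded_linear.has_derivative[OF bounded_linear_dagger] X Y)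
  then have x: "((\<lambda>q. x_of (X q) (Y q)) has_derivative
      (\<lambda>\<xi>. trace (dagger (X p) ** Y' \<xi> + dagger (X' \<xi>) ** Y p) / 2)) (at p)"
    unfolding x_of_def by (rule bounded_linear.has_derivative[OF bounded_linear_divide])
  have "((\<lambda>q. (carcosh (x_of (X q) (Y q)))\<^sup>2) has_derivative
      (\<lambda>\<xi>. 2 * z_quot (x_of (X p) (Y p)) * (trace (dagger (X p) ** Y' \<xi> + dagger (X' \<xi>) ** Y p) / 2))) (at p)"
    using has_derivative_compose[OF x carcosh_square_deriv[OF cut, unfolded has_field_derivative_def]] .
  then show ?thesis
    unfolding z_of_def by (rule has_derivative_cong_rhs) (simp add: z_square_diff_def trace_add algebra_simps)
qed

text \<open>The witness is half the sum of the squared moduli of the entries, and det g = 1 bounds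
  it below by the inequality 2 x y \<le> x^2 + y^2.\<close>

lemma x_of_self:
  assumes "g \<in> SL2C"
  obtains X where "X \<ge> 1" "x_of g g = of_real X"
proof
  define X where "X = ((norm (g$1$1))\<^sup>2 + (norm (g$1$2))\<^sup>2 + (norm (g$2$1))\<^sup>2 + (norm (g$2$2))\<^sup>2) / 2"
  show "x_of g g = of_real X"
    by (simp add: x_of_def X_def mat2_simps complex_norm_square mult.commute del: of_real_power)
  have "1 = norm (g$1$1 * g$2$2 - g$1$2 * g$2$1)"
    using assms by (simp add: SL2C_def det_2)
  also have "\<dots> \<le> norm (g$1$1) * norm (g$2$2) + norm (g$1$2) * norm (g$2$1)"
    using norm_triangle_ineq4[of "g$1$1 * g$2$2" "g$1$2 * g$2$1"] by (simp only: norm_mult)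
  also have "\<dots> \<le> X"
    using zero_le_power2[of "norm (g$1$1) - norm (g$2$2)"] zero_le_power2[of "norm (g$1$2) - norm (g$2$1)"]
    unfolding X_def power2_diff by (simp add: field_simps)
  finally show "X \<ge> 1" .
qed

text \<open>Replaces the real arcosh, which is not differentiable at 1, by the holomorphic squared
  one. All terms of the kinetic part then have the same form.\<close>

lemma p_of_square:
  assumes "g \<in> SL2C"
  shows "of_real ((p_of g)\<^sup>2) = (z_of g g)\<^sup>2"
proof -
  obtain X where "X \<ge> 1" "x_of g g = of_real X" by (rule x_of_self[OF assms])
  then show ?thesis by (simp add: p_of_def z_of_def carcosh_of_real)
qed

lemma x_of_self_not_cut:
  assumes "g \<in> SL2C"
  shows "x_of g g \<notin> complex_of_real ` {..-1}"
proof -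
  obtain X where "X \<ge> 1" "x_of g g = of_real X" by (rule x_of_self[OF assms])
  then show ?thesis by (auto simp: image_iff)
qed

lemma z_quot_x_of_self:
  assumes "g \<in> SL2C"
  shows "z_quot (x_of g g) = of_real (p_quot (p_of g))"
proof -
  obtain X where X: "X \<ge> 1" "x_of g g = of_real X" by (rule x_of_self[OF assms])
  then have "cosh (arcosh X) = X" "arcosh X \<ge> 0" by (simp_all add: arcosh_nonneg_real)
  then show ?thesis using z_quot_cosh[of "arcosh X"] by (simp add: X p_of_def)
qed

lemma W_of_eq_Z_of:
  assumes "g \<in> SL2C"
  shows "W_of a g = Z_of a g g"
  by (simp add: W_of_def Z_of_def z_quot_x_of_self[OF assms])

text \<open>The parameter space is an arbitrary normed space because the lemma serves both the
  complex variations of the group variables and the real ones of the gauge variables.\<close>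

lemma action_has_derivative:
  fixes g :: "'p::real_normed_vector \<Rightarrow> nat \<Rightarrow> 'e \<Rightarrow> mat2" and h :: "'p \<Rightarrow> 'v \<Rightarrow> mat2"
    and \<gamma> :: "('v, 'e) pre_digraph" and N :: nat and gf gi :: "'e \<Rightarrow> mat2"
  defines "G \<equiv> \<lambda>p. slice \<gamma> N gf gi (g p) (h p)"
  assumes SL: "\<And>p j e. j \<le> N + 2 \<Longrightarrow> e \<in> arcs \<gamma> \<Longrightarrow> G p j e \<in> SL2C"
    and der: "\<And>j e. j \<le> N + 2 \<Longrightarrow> e \<in> arcs \<gamma> \<Longrightarrow> ((\<lambda>p. G p j e) has_derivative G' j e) (at 0)"
    and cut: "\<And>j e. j \<le> N + 1 \<Longrightarrow> e \<in> arcs \<gamma> \<Longrightarrow> x_of (G 0 (j + 1) e) (G 0 j e) \<notin> complex_of_real ` {..-1}"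
    and ratio: "\<And>j. j \<in> {1..N} \<Longrightarrow>
      ((\<lambda>p. H_ratio \<gamma> \<mu> H t (G p (j + 1)) (G p j)) has_derivative R' j) (at 0)"
  shows "((\<lambda>p. action \<gamma> \<mu> H \<kappa> \<Delta>\<tau> len t N gf gi (g p) (h p)) has_derivative
    (\<lambda>\<xi>. (\<Sum>j=0..N+1. \<Sum>e\<in>arcs \<gamma>.
        z_square_diff (G 0 (j + 1) e) (G 0 j e) (G' (j + 1) e \<xi>) (G' j e \<xi>)
        - z_square_diff (G 0 (j + 1) e) (G 0 (j + 1) e) (G' (j + 1) e \<xi>) (G' (j + 1) e \<xi>) / 2
        - z_square_diff (G 0 j e) (G 0 j e) (G' j e \<xi>) (G' j e \<xi>) / 2)
      - \<i> * of_real \<kappa> / of_real (len\<^sup>2) * (\<Sum>j=1..N. of_real \<Delta>\<tau> * R' j \<xi>))) (at 0)"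
proof -
  have "action \<gamma> \<mu> H \<kappa> \<Delta>\<tau> len t N gf gi (g p) (h p) =
      (\<Sum>j=0..N+1. \<Sum>e\<in>arcs \<gamma>. (z_of (G p (j + 1) e) (G p j e))\<^sup>2
        - (z_of (G p (j + 1) e) (G p (j + 1) e))\<^sup>2 / 2 - (z_of (G p j e) (G p j e))\<^sup>2 / 2)
      - \<i> * of_real \<kappa> / of_real (len\<^sup>2) *
        (\<Sum>j=1..N. of_real \<Delta>\<tau> * H_ratio \<gamma> \<mu> H t (G p (j + 1)) (G p j))" for p
  proof -
    \<comment> \<open>This rewrites the action as a function near the base point, so membership in
      SL(2,C) is demanded for every parameter value.\<close>
    have "(\<Sum>j=0..N+1. \<Sum>e\<in>arcs \<gamma>. (z_of (G p (j + 1) e) (G p j e))\<^sup>2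
        - of_real ((p_of (G p (j + 1) e))\<^sup>2) / 2 - of_real ((p_of (G p j e))\<^sup>2) / 2) =
      (\<Sum>j=0..N+1. \<Sum>e\<in>arcs \<gamma>. (z_of (G p (j + 1) e) (G p j e))\<^sup>2
        - (z_of (G p (j + 1) e) (G p (j + 1) e))\<^sup>2 / 2 - (z_of (G p j e) (G p j e))\<^sup>2 / 2)"
      by (intro sum.cong refl arg_cong2[where f = "(-)"] arg_cong2[where f = "(/)"] p_of_square SL) auto
    then show ?thesis unfolding action_def Let_def G_def by simp
  qed
  moreover have "((\<lambda>p. (\<Sum>j=0..N+1. \<Sum>e\<in>arcs \<gamma>. (z_of (G p (j + 1) e) (G p j e))\<^sup>2
        - (z_of (G p (j + 1) e) (G p (j + 1) e))\<^sup>2 / 2 - (z_of (G p j e) (G p j e))\<^sup>2 / 2)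
      - \<i> * of_real \<kappa> / of_real (len\<^sup>2) *
        (\<Sum>j=1..N. of_real \<Delta>\<tau> * H_ratio \<gamma> \<mu> H t (G p (j + 1)) (G p j))) has_derivative
    (\<lambda>\<xi>. (\<Sum>j=0..N+1. \<Sum>e\<in>arcs \<gamma>.
        z_square_diff (G 0 (j + 1) e) (G 0 j e) (G' (j + 1) e \<xi>) (G' j e \<xi>)
        - z_square_diff (G 0 (j + 1) e) (G 0 (j + 1) e) (G' (j + 1) e \<xi>) (G' (j + 1) e \<xi>) / 2
        - z_square_diff (G 0 j e) (G 0 j e) (G' j e \<xi>) (G' j e \<xi>) / 2)
      - \<i> * of_real \<kappa> / of_real (len\<^sup>2) * (\<Sum>j=1..N. of_real \<Delta>\<tau> * R' j \<xi>))) (at 0)"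
    by (intro has_derivative_diff has_derivative_sum has_derivative_mult_right
        bounded_linear.has_derivative[OF bounded_linear_divide] z_square_has_derivative der cut
        x_of_self_not_cut SL ratio) auto
  ultimately show ?thesis by simp
qed

text \<open>Multiples of one axis by 1 and by the imaginary unit give A + B = 0 and A - B = 0. This
  separates the two families of critical equations.\<close>

lemma linear_antilinear_zero_iff:
  fixes A B :: "'n::finite \<Rightarrow> complex"
  shows "(\<forall>\<xi>::complex^'n. (\<Sum>a\<in>UNIV. \<xi>$a * A a) + (\<Sum>a\<in>UNIV. cnj (\<xi>$a) * B a) = 0)
    \<longleftrightarrow> (\<forall>a. A a = 0 \<and> B a = 0)"
proof
  assume *: "\<forall>\<xi>::complex^'n. (\<Sum>a\<in>UNIV. \<xi>$a * A a) + (\<Sum>a\<in>UNIV. cnj (\<xi>$a) * B a) = 0"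
  show "\<forall>a. A a = 0 \<and> B a = 0"
  proof
    fix a
    have eq: "c * A a + cnj c * B a = 0" for c
      using spec[OF *, of "axis a c"]
      by (simp add: axis_def if_distrib[of "\<lambda>x. x * _"] if_distrib[of cnj] cong: if_cong)
    have "A a = - B a" "A a = B a"
      using eq[of 1] eq[of \<i>] by (simp_all add: eq_neg_iff_add_eq_0)
    then show "A a = 0 \<and> B a = 0" by simp
  qed
qed simp

lemma linear_zero_iff:
  fixes A :: "'n::finite \<Rightarrow> complex"
  shows "(\<forall>\<eta>::real^'n. (\<Sum>a\<in>UNIV. of_real (\<eta>$a) * A a) = 0) \<longleftrightarrow> (\<forall>a. A a = 0)"
proof
  assume *: "\<forall>\<eta>::real^'n. (\<Sum>a\<in>UNIV. of_real (\<eta>$a) * A a) = 0"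
  show "\<forall>a. A a = 0"
  proof
    fix a
    show "A a = 0"
      using spec[OF *, of "axis a 1"]
      by (simp add: axis_def if_distrib[of "\<lambda>x. x * _"] if_distrib[of of_real] cong: if_cong)
  qed
qed simp

lemma has_derivative_zero_iff:
  assumes "(f has_derivative D) (at x)"
  shows "(f has_derivative (\<lambda>_. 0)) (at x) \<longleftrightarrow> (\<forall>\<xi>. D \<xi> = 0)"
proof
  assume "(f has_derivative (\<lambda>_. 0)) (at x)"
  from has_derivative_unique[OF assms this] show "\<forall>\<xi>. D \<xi> = 0" by simp
next
  assume "\<forall>\<xi>. D \<xi> = 0"
  then have "D = (\<lambda>_. 0)" by auto
  with assms show "(f has_derivative (\<lambda>_. 0)) (at x)" by simp
qed

section \<open>The variation of one group variable\<close>

lemma z_square_diff_zero [simp]: "z_square_diff X Y 0 0 = 0"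
  by (simp add: z_square_diff_def mat2_simps)

text \<open>Cyclicity of the trace brings \<open>tau a\<close> to the front.\<close>

lemma z_square_diff_right:
  "z_square_diff X Y 0 (Y ** tau_comb \<xi>) = (\<Sum>a\<in>UNIV. \<xi>$a * Z_of a X Y)"
  unfolding z_square_diff_def Z_of_def by (simp add: mat2_simps sum_3 algebra_simps)

text \<open>The dagger conjugates the components, and the sign arises because \<open>tau a\<close>
  is anti-Hermitian.\<close>

lemma z_square_diff_left:
  "z_square_diff X Y (X ** tau_comb \<xi>) 0 = - (\<Sum>a\<in>UNIV. cnj (\<xi>$a) * Z_of a X Y)"
  unfolding z_square_diff_def Z_of_def by (simp add: mat2_simps sum_3 algebra_simps)

lemma z_square_diff_add: "z_square_diff X Y X' Y' = z_square_diff X Y X' 0 + z_square_diff X Y 0 Y'"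
  unfolding z_square_diff_def by (simp add: mat2_simps algebra_simps)

lemma sum_single:
  fixes f :: "'a \<Rightarrow> 'b::comm_monoid_add"
  assumes "finite A" "a \<in> A" "\<And>x. x \<in> A \<Longrightarrow> x \<noteq> a \<Longrightarrow> f x = 0"
  shows "sum f A = f a"
  using assms by (simp add: sum.remove)

lemma slice_vary:
  assumes "i \<in> {1..N+1}"
  shows "slice \<gamma> N gf gi (g(i := vary (g i) e \<xi>)) h j =
    (if j = i then vary (slice \<gamma> N gf gi g h i) e \<xi> else slice \<gamma> N gf gi g h j)"
  using assms by (auto simp: slice_def)

text \<open>The variable g_i(e) occurs in step i as the right argument and in step i - 1 as the left
  one. The conditionals record that the matrix elements of \<open>H\<close> are summed over steps 1
  to N only: none accompanies step N + 1 or step 0.\<close>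

lemma action_g_has_derivative:
  fixes \<gamma> :: "('v, 'e) pre_digraph" and N :: nat and gf gi :: "'e \<Rightarrow> mat2"
    and g :: "nat \<Rightarrow> 'e \<Rightarrow> mat2" and h :: "'v \<Rightarrow> mat2" and \<kappa> \<Delta>\<tau> len t :: real
  defines "G \<equiv> slice \<gamma> N gf gi g h"
    and "c \<equiv> \<i> * complex_of_real \<kappa> * complex_of_real \<Delta>\<tau> / complex_of_real (len\<^sup>2)"
  assumes haar: "haar_SU2 \<mu>" and fin: "finite (arcs \<gamma>)" and t: "t > 0"
    and H: "self_adjoint_operator (SU2_edges \<gamma> \<mu>) D H"
    and dom: "\<And>k. (\<forall>e\<in>arcs \<gamma>. k e \<in> SL2C) \<Longrightarrow> coherent_state \<gamma> t k \<in> D"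
    and SL: "\<And>j. j \<le> N + 2 \<Longrightarrow> \<forall>e\<in>arcs \<gamma>. G j e \<in> SL2C"
    and cut: "\<And>j e. j \<le> N + 1 \<Longrightarrow> e \<in> arcs \<gamma> \<Longrightarrow> x_of (G (j + 1) e) (G j e) \<notin> complex_of_real ` {..-1}"
    and nz: "\<And>j. j \<in> {1..N} \<Longrightarrow> overlap \<gamma> \<mu> t (G (j + 1)) (G j) \<noteq> 0"
    and i: "i \<in> {1..N+1}" and e: "e \<in> arcs \<gamma>"
  shows "((\<lambda>\<xi>. action \<gamma> \<mu> H \<kappa> \<Delta>\<tau> len t N gf gi (g(i := vary (g i) e \<xi>)) h) has_derivative
    (\<lambda>\<xi>. (\<Sum>a\<in>UNIV. \<xi>$a * (Z_of a (G (i+1) e) (G i e) - W_of a (G i e) -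
        (if i \<le> N then c * wirtinger (\<lambda>\<epsilon>. H_ratio \<gamma> \<mu> H t (G (i+1)) (vary (G i) e (axis a \<epsilon>))) 0 else 0)))
      + (\<Sum>a\<in>UNIV. cnj (\<xi>$a) * (W_of a (G i e) - Z_of a (G i e) (G (i-1) e) -
        (if 2 \<le> i then c * wirtinger_bar (\<lambda>\<epsilon>. H_ratio \<gamma> \<mu> H t (vary (G i) e (axis a \<epsilon>)) (G (i-1))) 0 else 0)))))
    (at 0)"
proof -
  define G' where "G' j e' \<xi> = (if j = i \<and> e' = e then G i e ** tau_comb \<xi> else 0)" for j e' \<xi>
  define w where "w a = wirtinger (\<lambda>\<epsilon>. H_ratio \<gamma> \<mu> H t (G (i+1)) (vary (G i) e (axis a \<epsilon>))) 0" for a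
  define wb where "wb a = wirtinger_bar (\<lambda>\<epsilon>. H_ratio \<gamma> \<mu> H t (vary (G i) e (axis a \<epsilon>)) (G (i-1))) 0" for a
  define R' where "R' j \<xi> = (if j = i then \<Sum>a\<in>UNIV. \<xi>$a * w a else 0)
      + (if j = i - 1 then \<Sum>a\<in>UNIV. cnj (\<xi>$a) * wb a else 0)" for j and \<xi> :: "complex^3"
  define GG where "GG \<xi> = slice \<gamma> N gf gi (g(i := vary (g i) e \<xi>)) h" for \<xi>
  have GG: "GG \<xi> j = (if j = i then vary (G i) e \<xi> else G j)" for \<xi> j
    unfolding GG_def G_def by (rule slice_vary[OF i])
  have GG0: "GG 0 = G" by (auto simp: GG)
  \<comment> \<open>Here \<open>i \<ge> 1\<close> prevents the truncated subtraction from merging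
    the two steps.\<close>
  have i1: "i - 1 + 1 = i" "i - 1 \<noteq> i" using i by auto
  have deriv: "((\<lambda>p. action \<gamma> \<mu> H \<kappa> \<Delta>\<tau> len t N gf gi (g(i := vary (g i) e p)) h) has_derivative
    (\<lambda>\<xi>. (\<Sum>j=0..N+1. \<Sum>e'\<in>arcs \<gamma>.
        z_square_diff (GG 0 (j + 1) e') (GG 0 j e') (G' (j + 1) e' \<xi>) (G' j e' \<xi>)
        - z_square_diff (GG 0 (j + 1) e') (GG 0 (j + 1) e') (G' (j + 1) e' \<xi>) (G' (j + 1) e' \<xi>) / 2
        - z_square_diff (GG 0 j e') (GG 0 j e') (G' j e' \<xi>) (G' j e' \<xi>) / 2)
      - \<i> * of_real \<kappa> / of_real (len\<^sup>2) * (\<Sum>j=1..N. of_real \<Delta>\<tau> * R' j \<xi>))) (at 0)"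
    unfolding GG_def
  proof (rule action_has_derivative, fold GG_def)
    show "GG p j e' \<in> SL2C" if "j \<le> N + 2" "e' \<in> arcs \<gamma>" for p j e'
      using SL[OF that(1)] SL[of i] i that(2) vary_SL2C[of "arcs \<gamma>" "G i" e'] by (simp add: GG)
    show "((\<lambda>p. GG p j e') has_derivative G' j e') (at 0)" for j e'
    proof (cases "j = i \<and> e' = e")
      case True
      have "((\<lambda>\<xi>. G i e ** mexp (tau_comb \<xi>)) has_derivative (\<lambda>\<xi>. G i e ** tau_comb \<xi>)) (at 0)"
        by (rule bounded_linear.has_derivative[OF
            bounded_bilinear.bounded_linear_right[OF bounded_bilinear_mmult] mexp_has_derivative])
      with True show ?thesis by (simp add: GG G'_def[abs_def] vary_def)
    next
      case False
      then have "(\<lambda>p. GG p j e') = (\<lambda>p. G j e')" "G' j e' = (\<lambda>_. 0)"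
        by (auto simp: GG G'_def vary_def)
      then show ?thesis by simp
    qed
    show "x_of (GG 0 (j + 1) e') (GG 0 j e') \<notin> complex_of_real ` {..-1}"
      if "j \<le> N + 1" "e' \<in> arcs \<gamma>" for j e'
      unfolding GG0 by (rule cut[OF that])
    show "((\<lambda>p. H_ratio \<gamma> \<mu> H t (GG p (j + 1)) (GG p j)) has_derivative R' j) (at 0)"
      if j: "j \<in> {1..N}" for j
    proof -
      consider "j = i" | "j = i - 1" | "j \<noteq> i" "j + 1 \<noteq> i" by linarith
      then show ?thesis
      proof cases
        case 1
        then have "R' j = (\<lambda>\<xi>. \<Sum>a\<in>UNIV. \<xi>$a * w a)" using i1 by (auto simp: R'_def)
        moreover have "((\<lambda>\<xi>. H_ratio \<gamma> \<mu> H t (G (i + 1)) (vary (G i) e \<xi>)) has_derivative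
            (\<lambda>\<xi>. \<Sum>a\<in>UNIV. \<xi>$a * w a)) (at 0)"
          unfolding w_def using j 1
          by (intro H_ratio_right_deriv[OF haar fin t H dom] SL nz e) auto
        ultimately show ?thesis using 1 by (simp add: GG)
      next
        case 2
        then have "R' j = (\<lambda>\<xi>. \<Sum>a\<in>UNIV. cnj (\<xi>$a) * wb a)" using i1 by (auto simp: R'_def)
        moreover have "overlap \<gamma> \<mu> t (G i) (G (i - 1)) \<noteq> 0" using nz[OF j] 2 i1 by simp
        then have "((\<lambda>\<xi>. H_ratio \<gamma> \<mu> H t (vary (G i) e \<xi>) (G (i - 1))) has_derivative
            (\<lambda>\<xi>. \<Sum>a\<in>UNIV. cnj (\<xi>$a) * wb a)) (at 0)"
          unfolding wb_def using j 2 i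
          by (intro H_ratio_left_deriv[OF haar fin t H dom] SL e) auto
        ultimately show ?thesis using 2 i1 by (simp add: GG)
      next
        case 3
        then have "R' j = (\<lambda>\<xi>. 0)" by (auto simp: R'_def)
        then show ?thesis using 3 by (simp add: GG)
      qed
    qed
  qed
  show ?thesis
  proof (rule has_derivative_cong_rhs[OF deriv], unfold GG0)
    fix \<xi> :: "complex^3"
    \<comment> \<open>\<open>L\<close> is the antilinear contribution of a varied left argument,
      \<open>R\<close> the linear one of a varied right argument; a diagonal term has both.\<close>
    define L where "L k l = - (\<Sum>a\<in>UNIV. cnj (\<xi>$a) * Z_of a (G k e) (G l e))" for k l
    define R where "R k l = (\<Sum>a\<in>UNIV. \<xi>$a * Z_of a (G k e) (G l e))" for k l
    have zd: "z_square_diff (G k e) (G l e) (G' k e \<xi>) (G' l e \<xi>) =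
        (if k = i then L i l else 0) + (if l = i then R k i else 0)" for k l
      by (subst z_square_diff_add) (simp add: G'_def L_def R_def z_square_diff_left z_square_diff_right)
    have inner: "(\<Sum>e'\<in>arcs \<gamma>.
        z_square_diff (G (j + 1) e') (G j e') (G' (j + 1) e' \<xi>) (G' j e' \<xi>)
        - z_square_diff (G (j + 1) e') (G (j + 1) e') (G' (j + 1) e' \<xi>) (G' (j + 1) e' \<xi>) / 2
        - z_square_diff (G j e') (G j e') (G' j e' \<xi>) (G' j e' \<xi>) / 2) =
        (if j = i then R (i + 1) i - (L i i + R i i) / 2 else 0)
        + (if j = i - 1 then L i (i - 1) - (L i i + R i i) / 2 else 0)" for j
    proof -
      have "(\<Sum>e'\<in>arcs \<gamma>.
        z_square_diff (G (j + 1) e') (G j e') (G' (j + 1) e' \<xi>) (G' j e' \<xi>)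
        - z_square_diff (G (j + 1) e') (G (j + 1) e') (G' (j + 1) e' \<xi>) (G' (j + 1) e' \<xi>) / 2
        - z_square_diff (G j e') (G j e') (G' j e' \<xi>) (G' j e' \<xi>) / 2) =
        z_square_diff (G (j + 1) e) (G j e) (G' (j + 1) e \<xi>) (G' j e \<xi>)
        - z_square_diff (G (j + 1) e) (G (j + 1) e) (G' (j + 1) e \<xi>) (G' (j + 1) e \<xi>) / 2
        - z_square_diff (G j e) (G j e) (G' j e \<xi>) (G' j e \<xi>) / 2"
        by (rule sum_single[OF fin e]) (simp add: G'_def)
      moreover have "j + 1 = i \<longleftrightarrow> j = i - 1" using i by auto
      ultimately show ?thesis unfolding zd using i1 by auto
    qed
    have "i \<in> {0..N+1}" "i - 1 \<in> {0..N+1}" using i by auto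
    \<comment> \<open>The steps i and i - 1 each contribute half of the diagonal
      differential.\<close>
    then have kin: "(\<Sum>j=0..N+1. (if j = i then R (i + 1) i - (L i i + R i i) / 2 else 0)
        + (if j = i - 1 then L i (i - 1) - (L i i + R i i) / 2 else 0)) =
        R (i + 1) i - R i i + (L i (i - 1) - L i i)"
      unfolding sum.distrib by (simp only: sum.delta finite_atLeastAtMost if_True) (simp add: field_simps)
    have "(i \<in> {1..N}) = (i \<le> N)" "(i - 1 \<in> {1..N}) = (2 \<le> i)" using i by auto
    then have rat: "(\<Sum>j=1..N. of_real \<Delta>\<tau> * R' j \<xi>) =
        of_real \<Delta>\<tau> * (if i \<le> N then \<Sum>a\<in>UNIV. \<xi>$a * w a else 0)
        + of_real \<Delta>\<tau> * (if 2 \<le> i then \<Sum>a\<in>UNIV. cnj (\<xi>$a) * wb a else 0)"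
      unfolding R'_def sum_distrib_left[symmetric] sum.distrib distrib_left[symmetric]
      by (simp only: sum.delta finite_atLeastAtMost)
    have c: "\<i> * of_real \<kappa> / of_real (len\<^sup>2) * (of_real \<Delta>\<tau> * x + of_real \<Delta>\<tau> * y)
        = c * (x + y)" for x y
      unfolding c_def distrib_left[symmetric] by simp
    have W: "W_of a (G i e) = Z_of a (G i e) (G i e)" for a
      using SL[of i] i e by (intro W_of_eq_Z_of) auto
    show "(\<Sum>j=0..N+1. \<Sum>e'\<in>arcs \<gamma>.
        z_square_diff (G (j + 1) e') (G j e') (G' (j + 1) e' \<xi>) (G' j e' \<xi>)
        - z_square_diff (G (j + 1) e') (G (j + 1) e') (G' (j + 1) e' \<xi>) (G' (j + 1) e' \<xi>) / 2
        - z_square_diff (G j e') (G j e') (G' j e' \<xi>) (G' j e' \<xi>) / 2)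
      - \<i> * of_real \<kappa> / of_real (len\<^sup>2) * (\<Sum>j=1..N. of_real \<Delta>\<tau> * R' j \<xi>) =
      (\<Sum>a\<in>UNIV. \<xi>$a * (Z_of a (G (i+1) e) (G i e) - W_of a (G i e) -
        (if i \<le> N then c * wirtinger (\<lambda>\<epsilon>. H_ratio \<gamma> \<mu> H t (G (i+1)) (vary (G i) e (axis a \<epsilon>))) 0 else 0)))
      + (\<Sum>a\<in>UNIV. cnj (\<xi>$a) * (W_of a (G i e) - Z_of a (G i e) (G (i-1) e) -
        (if 2 \<le> i then c * wirtinger_bar (\<lambda>\<epsilon>. H_ratio \<gamma> \<mu> H t (vary (G i) e (axis a \<epsilon>)) (G (i-1))) 0 else 0)))"
      unfolding inner kin rat w_def[symmetric] wb_def[symmetric] W c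
      by (auto simp: L_def R_def sum_3 algebra_simps)
  qed
qed

text \<open>The infinitesimal form of the invariance of tr (X^dagger X) under unitary multiplication
  from either side. It removes the momentum of the initial slice from the gauge variation.\<close>

lemma z_square_diff_gauge:
  assumes "dagger A = - A" "dagger B = - B"
  shows "z_square_diff X X (A ** X + X ** B) (A ** X + X ** B) = 0"
proof -
  have "trace ((Y ** (- A) + (- B) ** Y) ** X) + trace (Y ** (A ** X + X ** B)) = 0" for Y
    by (simp add: mat2_simps algebra_simps)
  from this[of "dagger X"] show ?thesis
    by (simp add: z_square_diff_def dagger_add dagger_mult assms)
qed

lemma action_h_has_derivative:
  fixes \<gamma> :: "('v, 'e) pre_digraph" and N :: nat and gf gi :: "'e \<Rightarrow> mat2"
    and g :: "nat \<Rightarrow> 'e \<Rightarrow> mat2" and h :: "'v \<Rightarrow> mat2" and \<kappa> \<Delta>\<tau> len t :: real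
  defines "G \<equiv> slice \<gamma> N gf gi g h"
  assumes fin: "fin_digraph \<gamma>"
    and SL: "\<And>j. j \<le> N + 2 \<Longrightarrow> \<forall>e\<in>arcs \<gamma>. G j e \<in> SL2C"
    and cut: "\<And>j e. j \<le> N + 1 \<Longrightarrow> e \<in> arcs \<gamma> \<Longrightarrow> x_of (G (j + 1) e) (G j e) \<notin> complex_of_real ` {..-1}"
    and h: "\<forall>v\<in>verts \<gamma>. h v \<in> SU2" and v: "v \<in> verts \<gamma>"
  shows "((\<lambda>\<eta>. action \<gamma> \<mu> H \<kappa> \<Delta>\<tau> len t N gf gi g (vary h v (cvec \<eta>))) has_derivative
    (\<lambda>\<eta>. \<Sum>a\<in>UNIV. of_real (\<eta>$a) *
      (- (\<Sum>e\<in>out_arcs \<gamma> v. z_quot (x_of (G 1 e) (G 0 e)) * trace (dagger (G 1 e) ** tau a ** G 0 e))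
       + (\<Sum>e\<in>in_arcs \<gamma> v. z_quot (x_of (G 1 e) (G 0 e)) * trace (tau a ** dagger (G 1 e) ** G 0 e)))))
    (at 0)"
proof -
  interpret fin_digraph \<gamma> by (rule fin)
  define m where "m \<eta> = mexp (tau_comb (cvec \<eta>))" for \<eta>
  \<comment> \<open>A factor is attached to every vertex, trivial away from \<open>v\<close>. The
    two ends of an edge are then treated alike, and an edge with both ends at \<open>v\<close> is no
    exception.\<close>
  define U where "U x \<eta> = (if x = v then m \<eta> else mat 1)" for x \<eta>
  define U' where "U' x \<eta> = (if x = v then tau_comb (cvec \<eta>) else 0)" for x \<eta>
  \<comment> \<open>The minus sign belongs to the source, where the inverse of \<open>h\<close>
    occurs: there the derivative of \<open>dagger U\<close> is \<open>- U'\<close>.\<close>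
  define G' where "G' j e \<eta> = (if j = 0 then - U' (tail \<gamma> e) \<eta> ** G 0 e + G 0 e ** U' (head \<gamma> e) \<eta> else 0)"
    for j :: nat and e \<eta>
  define GG where "GG \<eta> = slice \<gamma> N gf gi g (vary h v (cvec \<eta>))" for \<eta>
  have mSU2: "m \<eta> \<in> SU2" for \<eta> unfolding m_def by (rule mexp_real_SU2)
  have one_SU2: "mat 1 \<in> SU2" by (simp add: SU2_def dagger_mat)
  have U_SU2: "U x \<eta> \<in> SU2" for x \<eta> by (simp add: U_def mSU2 one_SU2)
  have vary_h: "vary h v (cvec \<eta>) x = h x ** U x \<eta>" for x \<eta>
    by (simp add: vary_def U_def m_def)
  have GG_0: "GG \<eta> 0 e = dagger (U (tail \<gamma> e) \<eta>) ** G 0 e ** U (head \<gamma> e) \<eta>" if "e \<in> arcs \<gamma>" for \<eta> e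
  proof -
    have t: "h (tail \<gamma> e) \<in> SU2" using h that by auto
    show ?thesis
      by (simp add: GG_def G_def slice_def gauge_transform_def vary_h
          matrix_inv_SU2[OF t] matrix_inv_SU2[OF SU2_mult[OF t U_SU2]] dagger_mult matrix_mul_assoc)
  qed
  have GG_pos: "GG \<eta> j = G j" if "j \<noteq> 0" for \<eta> j
    using that by (simp add: GG_def G_def slice_def)
  have cvec0: "cvec 0 = 0" by (simp add: cvec_def vec_eq_iff)
  have U0: "U x 0 = mat 1" for x by (simp add: U_def m_def cvec0 mexp_0)
  have GG0: "GG 0 j e = G j e" if "e \<in> arcs \<gamma>" for j e
    using that by (cases "j = 0") (simp_all add: GG_0 GG_pos U0 dagger_mat)
  have "bounded_linear cvec"
  proof -
    have "linear cvec" by (rule linearI) (simp_all add: cvec_def vec_eq_iff, simp add: scaleR_conv_of_real)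
    then show ?thesis by (simp add: linear_conv_bounded_linear)
  qed
  note dcvec = bounded_linear_imp_has_derivative[OF this]
  have "((\<lambda>\<xi>. mexp (tau_comb \<xi>)) has_derivative tau_comb) (at (cvec 0))"
    unfolding cvec0 by (rule mexp_has_derivative)
  from has_derivative_compose[OF dcvec this]
  have "(m has_derivative (\<lambda>\<eta>. tau_comb (cvec \<eta>))) (at 0)"
    unfolding m_def .
  then have dU: "(U x has_derivative U' x) (at 0)" for x
    by (cases "x = v") (simp_all add: U_def[abs_def] U'_def[abs_def])
  have dagger_U': "dagger (U' x \<eta>) = - U' x \<eta>" for x \<eta>
    by (simp add: U'_def mat2_simps cvec_def)
  have deriv: "((\<lambda>p. action \<gamma> \<mu> H \<kappa> \<Delta>\<tau> len t N gf gi g (vary h v (cvec p))) has_derivative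
    (\<lambda>\<eta>. (\<Sum>j=0..N+1. \<Sum>e\<in>arcs \<gamma>.
        z_square_diff (GG 0 (j + 1) e) (GG 0 j e) (G' (j + 1) e \<eta>) (G' j e \<eta>)
        - z_square_diff (GG 0 (j + 1) e) (GG 0 (j + 1) e) (G' (j + 1) e \<eta>) (G' (j + 1) e \<eta>) / 2
        - z_square_diff (GG 0 j e) (GG 0 j e) (G' j e \<eta>) (G' j e \<eta>) / 2)
      - \<i> * of_real \<kappa> / of_real (len\<^sup>2) * (\<Sum>j=1..N. of_real \<Delta>\<tau> * 0))) (at 0)"
    unfolding GG_def
  proof (rule action_has_derivative, fold GG_def)
    show "GG p j e \<in> SL2C" if "j \<le> N + 2" "e \<in> arcs \<gamma>" for p j e
    proof (cases "j = 0")
      case True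
      have "G 0 e \<in> SL2C" using SL[of 0] that(2) by simp
      then show ?thesis
        unfolding True GG_0[OF that(2)]
        by (rule SL2C_mult[OF SL2C_mult[OF SU2_SL2C[OF SU2_dagger[OF U_SU2]]] SU2_SL2C[OF U_SU2]])
    qed (use SL[OF that(1)] that in \<open>simp add: GG_pos\<close>)
    show "((\<lambda>p. GG p j e) has_derivative G' j e) (at 0)" if e: "e \<in> arcs \<gamma>" for j e
    proof (cases "j = 0")
      case True
      have "((\<lambda>\<eta>. dagger (U (tail \<gamma> e) \<eta>) ** G 0 e ** U (head \<gamma> e) \<eta>) has_derivative
          (\<lambda>\<eta>. dagger (U (tail \<gamma> e) 0) ** G 0 e ** U' (head \<gamma> e) \<eta>
            + (dagger (U (tail \<gamma> e) 0) ** 0 + dagger (U' (tail \<gamma> e) \<eta>) ** G 0 e) ** U (head \<gamma> e) 0)) (at 0)"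
        by (intro bounded_bilinear.FDERIV[OF bounded_bilinear_mmult]
            bounded_linear.has_derivative[OF bounded_linear_dagger] dU has_derivative_const)
      then show ?thesis
        unfolding True GG_0[OF e]
        by (rule has_derivative_cong_rhs)
          (simp add: U0 dagger_mat dagger_U' G'_def mat2_simps)
    next
      case False
      then show ?thesis by (simp add: GG_pos G'_def[abs_def])
    qed
    show "x_of (GG 0 (j + 1) e) (GG 0 j e) \<notin> complex_of_real ` {..-1}"
      if "j \<le> N + 1" "e \<in> arcs \<gamma>" for j e
      using cut[OF that] by (simp add: GG0[OF that(2)])
    show "((\<lambda>p. H_ratio \<gamma> \<mu> H t (GG p (j + 1)) (GG p j)) has_derivative (\<lambda>_. 0)) (at 0)"
      if "j \<in> {1..N}" for j
      using that by (simp add: GG_pos)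
  qed
  show ?thesis
  proof (rule has_derivative_cong_rhs[OF deriv])
    fix \<eta> :: "real^3"
    define q where "q e = z_quot (x_of (G 1 e) (G 0 e))" for e
    define A where "A e a = trace (dagger (G 1 e) ** tau a ** G 0 e)" for e a
    define B where "B e a = trace (tau a ** dagger (G 1 e) ** G 0 e)" for e a
    have "(\<Sum>j=0..N+1. \<Sum>e\<in>arcs \<gamma>.
        z_square_diff (GG 0 (j + 1) e) (GG 0 j e) (G' (j + 1) e \<eta>) (G' j e \<eta>)
        - z_square_diff (GG 0 (j + 1) e) (GG 0 (j + 1) e) (G' (j + 1) e \<eta>) (G' (j + 1) e \<eta>) / 2
        - z_square_diff (GG 0 j e) (GG 0 j e) (G' j e \<eta>) (G' j e \<eta>) / 2)
      = (\<Sum>e\<in>arcs \<gamma>. z_square_diff (GG 0 (0 + 1) e) (GG 0 0 e) (G' (0 + 1) e \<eta>) (G' 0 e \<eta>)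
        - z_square_diff (GG 0 (0 + 1) e) (GG 0 (0 + 1) e) (G' (0 + 1) e \<eta>) (G' (0 + 1) e \<eta>) / 2
        - z_square_diff (GG 0 0 e) (GG 0 0 e) (G' 0 e \<eta>) (G' 0 e \<eta>) / 2)"
      by (rule sum_single) (auto simp: G'_def)
    also have "\<dots> = (\<Sum>e\<in>arcs \<gamma>. \<Sum>a\<in>UNIV. of_real (\<eta>$a) *
        (- (if tail \<gamma> e = v then q e * A e a else 0) + (if head \<gamma> e = v then q e * B e a else 0)))"
    proof (rule sum.cong)
      fix e assume e: "e \<in> arcs \<gamma>"
      have "z_square_diff (G 0 e) (G 0 e) (G' 0 e \<eta>) (G' 0 e \<eta>) = 0"
        unfolding G'_def using dagger_U'[of "tail \<gamma> e" \<eta>] dagger_U'[of "head \<gamma> e" \<eta>]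
        by (simp add: z_square_diff_gauge bounded_linear.linear[OF bounded_linear_dagger] linear_neg)
      moreover have "z_square_diff (G 1 e) (G 0 e) 0 (G' 0 e \<eta>) =
        (\<Sum>a\<in>UNIV. of_real (\<eta>$a) *
        (- (if tail \<gamma> e = v then q e * A e a else 0) + (if head \<gamma> e = v then q e * B e a else 0)))"
        unfolding z_square_diff_def q_def[symmetric] G'_def U'_def A_def B_def
        by (simp add: mat2_simps sum_3 cvec_def algebra_simps)
      ultimately show "z_square_diff (GG 0 (0 + 1) e) (GG 0 0 e) (G' (0 + 1) e \<eta>) (G' 0 e \<eta>)
        - z_square_diff (GG 0 (0 + 1) e) (GG 0 (0 + 1) e) (G' (0 + 1) e \<eta>) (G' (0 + 1) e \<eta>) / 2
        - z_square_diff (GG 0 0 e) (GG 0 0 e) (G' 0 e \<eta>) (G' 0 e \<eta>) / 2 =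
        (\<Sum>a\<in>UNIV. of_real (\<eta>$a) *
        (- (if tail \<gamma> e = v then q e * A e a else 0) + (if head \<gamma> e = v then q e * B e a else 0)))"
        using e by (simp add: GG0 G'_def[of "Suc 0"])
    qed simp
    also have "\<dots> = (\<Sum>a\<in>UNIV. of_real (\<eta>$a) *
        (- (\<Sum>e\<in>out_arcs \<gamma> v. q e * A e a) + (\<Sum>e\<in>in_arcs \<gamma> v. q e * B e a)))"
      unfolding out_arcs_def in_arcs_def sum.inter_filter[OF finite_arcs]
      by (subst sum.swap) (simp only: sum_distrib_left[symmetric] sum.distrib sum_negf)
    finally show "(\<Sum>j=0..N+1. \<Sum>e\<in>arcs \<gamma>.
        z_square_diff (GG 0 (j + 1) e) (GG 0 j e) (G' (j + 1) e \<eta>) (G' j e \<eta>)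
        - z_square_diff (GG 0 (j + 1) e) (GG 0 (j + 1) e) (G' (j + 1) e \<eta>) (G' (j + 1) e \<eta>) / 2
        - z_square_diff (GG 0 j e) (GG 0 j e) (G' j e \<eta>) (G' j e \<eta>) / 2)
      - \<i> * of_real \<kappa> / of_real (len\<^sup>2) * (\<Sum>j=1..N. of_real \<Delta>\<tau> * 0) =
      (\<Sum>a\<in>UNIV. of_real (\<eta>$a) *
      (- (\<Sum>e\<in>out_arcs \<gamma> v. z_quot (x_of (G 1 e) (G 0 e)) * trace (dagger (G 1 e) ** tau a ** G 0 e))
       + (\<Sum>e\<in>in_arcs \<gamma> v. z_quot (x_of (G 1 e) (G 0 e)) * trace (tau a ** dagger (G 1 e) ** G 0 e))))"
      unfolding q_def A_def B_def by simp
  qed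
qed

section \<open>Polar coordinates and closure\<close>

text \<open>The double-angle formulas sum the exponential of 2 A. It is needed for the square of the
  Hermitian polar factor.\<close>

lemma mexp_double:
  assumes "A ** A = mat (w\<^sup>2)"
  shows "mexp A ** mexp A = mat (cosh (2 * w)) + mat (2 * sinhc (2 * w)) ** A"
proof -
  have A: "mexp A = mat (cosh w) + mat (sinhc w) ** A" by (rule mexp_eq[OF assms])
  have "mexp A ** mexp A = mat ((cosh w)\<^sup>2) + mat (2 * (cosh w * sinhc w)) ** A
      + mat ((sinhc w)\<^sup>2) ** (A ** A)"
    unfolding A by (simp add: mat2_simps algebra_simps power2_eq_square)
  also have "mat ((sinhc w)\<^sup>2) ** (A ** A) = mat ((sinh w)\<^sup>2)"
    unfolding assms sinhc_mult[of w, symmetric] by (simp add: mat2_simps power_mult_distrib)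
  also have "cosh w * sinhc w = sinhc (2 * w)"
    by (simp add: sinhc_def sinh_double)
  finally have eq: "mexp A ** mexp A =
      mat ((cosh w)\<^sup>2) + mat (2 * sinhc (2 * w)) ** A + mat ((sinh w)\<^sup>2)" .
  show ?thesis
    unfolding eq cosh_double by (simp add: mat2_simps)
qed

lemma antihermitian_traceless_expansion:
  assumes "dagger M = - M" "trace M = 0"
  shows "\<exists>l. M = (\<Sum>b\<in>UNIV. mat (of_real (l b)) ** tau b)"
proof
  \<comment> \<open>In the combination, entry (1,2) is -i l_1 - l_2 and entry (1,1) is -i
    l_3.\<close>
  define l :: "3 \<Rightarrow> real" where
    "l b = (if b = 1 then - Im (M$1$2) else if b = 2 then - Re (M$1$2) else - Im (M$1$1))" for b
  have l: "l 1 = - Im (M$1$2)" "l 2 = - Re (M$1$2)" "l 3 = - Im (M$1$1)"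
    by (simp_all add: l_def)
  have "cnj (M$1$1) = - M$1$1" "cnj (M$1$2) = - M$2$1" "cnj (M$2$1) = - M$1$2"
    using arg_cong[OF assms(1), of "\<lambda>A. A$1$1"] arg_cong[OF assms(1), of "\<lambda>A. A$2$1"]
      arg_cong[OF assms(1), of "\<lambda>A. A$1$2"] by (simp_all add: dagger_entry)
  moreover have "M$2$2 = - M$1$1"
    using assms(2) by (simp add: trace_mat2 add_eq_0_iff)
  ultimately show "M = (\<Sum>b\<in>UNIV. mat (of_real (l b)) ** tau b)"
    by (simp add: mat2_eq_iff sum_3 smult_entry tau_entry l complex_eq_iff)
qed

lemma tau_independent:
  assumes "(\<Sum>b\<in>UNIV. mat (of_real (l b)) ** tau b) = (\<Sum>b\<in>UNIV. mat (of_real (l' b)) ** tau b)"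
  shows "l b = l' b"
proof -
  have "l 1 = l' 1" "l 2 = l' 2" "l 3 = l' 3"
    using assms by (simp_all add: mat2_eq_iff sum_3 smult_entry tau_entry complex_eq_iff)
  then show ?thesis using exhaust_3[of b] by auto
qed

text \<open>\<open>Lambda\<close> is a definite description, so existence and uniqueness are owed.
  Conjugation by a unitary keeps a matrix anti-Hermitian and traceless, and the \<open>tau a\<close>
  form a real basis of such matrices.\<close>

lemma Lambda_eq:
  "mexp (tau_comb (cvec (\<theta> /\<^sub>R 2))) ** tau a ** mexp (tau_comb (cvec (- \<theta> /\<^sub>R 2)))
    = (\<Sum>b\<in>UNIV. mat (of_real (Lambda \<theta> $ a $ b)) ** tau b)"
proof -
  define U where "U = mexp (tau_comb (cvec (\<theta> /\<^sub>R 2)))"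
  have U: "U \<in> SU2" unfolding U_def by (rule mexp_real_SU2)
  have dU: "mexp (tau_comb (cvec (- \<theta> /\<^sub>R 2))) = dagger U"
    by (simp add: U_def dagger_mexp_cvec)
  have ex: "\<exists>l. U ** tau a ** dagger U = (\<Sum>b\<in>UNIV. mat (of_real (l b)) ** tau b)" for a
  proof (rule antihermitian_traceless_expansion)
    have tau: "dagger (tau a) = - tau a" "trace (tau a) = 0"
      using exhaust_3[of a] by (auto simp: mat2_simps)
    show "dagger (U ** tau a ** dagger U) = - (U ** tau a ** dagger U)"
    proof -
      have "A ** ((- B) ** C) = - (A ** B ** C)" for A B C :: mat2
        by (simp add: mat2_simps algebra_simps)
      then show ?thesis by (simp add: dagger_mult tau)
    qed
    have "trace (U ** tau a ** dagger U) = trace (tau a ** (dagger U ** U))"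
      unfolding matrix_mul_assoc[symmetric] by (subst trace_mul_sym) (simp only: matrix_mul_assoc)
    then show "trace (U ** tau a ** dagger U) = 0"
      using SU2D(2)[OF U] tau by simp
  qed
  define P where "P L \<longleftrightarrow> (\<forall>a. U ** tau a ** dagger U = (\<Sum>b\<in>UNIV. mat (of_real (L $ a $ b)) ** tau b))"
    for L :: "real^3^3"
  have "\<exists>!L. P L"
    unfolding P_def
  proof (rule ex_ex1I)
    obtain l where l: "\<forall>a. U ** tau a ** dagger U = (\<Sum>b\<in>UNIV. mat (of_real (l a b)) ** tau b)"
      using choice[of "\<lambda>a l. U ** tau a ** dagger U = (\<Sum>b\<in>UNIV. mat (of_real (l b)) ** tau b)"] ex by blast
    show "\<exists>L::real^3^3. \<forall>a. U ** tau a ** dagger U = (\<Sum>b\<in>UNIV. mat (of_real (L $ a $ b)) ** tau b)"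
      by (rule exI[of _ "\<chi> a b. l a b"]) (unfold vec_lambda_beta, rule l)
  next
    fix L L' :: "real^3^3"
    assume L: "\<forall>a. U ** tau a ** dagger U = (\<Sum>b\<in>UNIV. mat (of_real (L $ a $ b)) ** tau b)"
      and L': "\<forall>a. U ** tau a ** dagger U = (\<Sum>b\<in>UNIV. mat (of_real (L' $ a $ b)) ** tau b)"
    have "(\<Sum>b\<in>UNIV. mat (of_real (L $ a $ b)) ** tau b) = (\<Sum>b\<in>UNIV. mat (of_real (L' $ a $ b)) ** tau b)" for a
      by (rule trans[OF sym[OF spec[OF L]] spec[OF L']])
    then have "L $ a $ b = L' $ a $ b" for a b
      by (rule tau_independent)
    then show "L = L'" by (simp add: vec_eq_iff)
  qed
  then have "P (THE L. P L)" by (rule theI')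
  moreover have "Lambda \<theta> = (THE L. P L)"
    unfolding Lambda_def P_def dU U_def[symmetric] ..
  ultimately have "P (Lambda \<theta>)" by (simp only:)
  then show ?thesis
    unfolding P_def dU U_def[symmetric] by blast
qed

text \<open>The traces carry a factor sinh r / r with r the length of p, and \<open>z_quot\<close>
  is exactly its inverse, so the result is linear in p. The constant 2 i comes from tr (tau_a tau_b)
  = -2 delta_ab and the coefficients -i p/2 in the exponent.\<close>

lemma polar_coords_traces:
  assumes "polar_coords g p \<theta>"
  shows "z_quot (x_of g g) * trace (dagger g ** tau a ** g) = 2 * \<i> * of_real (p $ a)"
    and "z_quot (x_of g g) * trace (tau a ** dagger g ** g)
      = 2 * \<i> * of_real (\<Sum>b\<in>UNIV. Lambda \<theta> $ a $ b * p $ b)"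
proof -
  define r where "r = norm p"
  define A where "A = tau_comb (\<chi> a. - \<i> * of_real (p $ a) / 2)"
  define U where "U = mexp (tau_comb (cvec (\<theta> /\<^sub>R 2)))"
  define V where "V = mexp (tau_comb (cvec (- \<theta> /\<^sub>R 2)))"
  have g: "g = mexp A ** U" using assms by (simp add: polar_coords_def A_def U_def)
  have U: "U \<in> SU2" unfolding U_def by (rule mexp_real_SU2)
  have V: "V = dagger U"
    by (simp add: U_def V_def dagger_mexp_cvec)
  have r2: "r\<^sup>2 = (\<Sum>a\<in>UNIV. (p $ a)\<^sup>2)"
    by (simp add: r_def norm_vec_def L2_set_def sum_nonneg)
  \<comment> \<open>\<open>A\<close> is Hermitian with eigenvalues r/2 and -r/2.\<close>
  have sq: "A ** A = mat ((of_real (r / 2))\<^sup>2)"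
  proof -
    have "- (\<Sum>a\<in>UNIV. ((\<chi> a. - \<i> * of_real (p $ a) / 2) $ a)\<^sup>2 :: complex)
        = of_real ((\<Sum>a\<in>UNIV. (p $ a)\<^sup>2) / 4)"
      by (simp add: sum_3 power_mult_distrib power_divide add_divide_distrib)
    also have "\<dots> = (of_real (r / 2))\<^sup>2"
      unfolding r2[symmetric] by (simp add: power_divide)
    finally have eq: "- (\<Sum>a\<in>UNIV. ((\<chi> a. - \<i> * of_real (p $ a) / 2) $ a)\<^sup>2 :: complex)
      = (of_real (r / 2))\<^sup>2" .
    show ?thesis unfolding A_def tau_comb_square eq ..
  qed
  define Q where "Q = mexp A ** mexp A"
  have Q: "Q = mat (cosh (of_real r)) + mat (2 * sinhc (of_real r)) ** A"
    unfolding Q_def mexp_double[OF sq] by simp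
  have dA: "dagger (mexp A) = mexp A"
  proof -
    have "dagger A = A" by (simp add: A_def mat2_simps)
    then show ?thesis unfolding A_def dagger_mexp_tau_comb by simp
  qed
  have gg: "g ** dagger g = Q"
  proof -
    have "g ** dagger g = mexp A ** (U ** dagger U) ** mexp A"
      unfolding g dagger_mult dA by (simp only: matrix_mul_assoc)
    then show ?thesis using SU2D(3)[OF U] by (simp add: Q_def)
  qed
  have gg': "dagger g ** g = dagger U ** Q ** U"
    unfolding g dagger_mult dA Q_def by (simp only: matrix_mul_assoc)
  have tr: "trace (tau a ** Q) = 2 * \<i> * sinhc (of_real r) * of_real (p $ a)" for a
    unfolding Q A_def using exhaust_3[of a] by (auto simp: mat2_simps algebra_simps)
  have "trace (dagger g ** g) = trace Q" unfolding trace_mul_sym[of "dagger g"] gg ..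
  also have "\<dots> = 2 * of_real (cosh r)"
  proof -
    have "trace A = 0" by (simp add: A_def mat2_simps)
    moreover have "trace (mat c + mat d ** A) = 2 * c + d * trace A" for c d
      by (simp add: mat2_simps algebra_simps)
    ultimately show ?thesis by (simp add: Q cosh_of_real_complex)
  qed
  finally have "x_of g g = of_real (cosh r)" by (simp add: x_of_def)
  then have "z_quot (x_of g g) = of_real (p_quot r)"
    using z_quot_cosh[of r] by (simp add: r_def)
  moreover have "of_real (p_quot r) * sinhc (of_real r) = 1"
    by (auto simp: p_quot_def sinhc_def sinh_of_real_complex)
  ultimately have z: "z_quot (x_of g g) * sinhc (of_real r) = 1" by simp
  have "trace (dagger g ** tau a ** g) = trace (tau a ** Q)"
    unfolding gg[symmetric] matrix_mul_assoc[symmetric] by (subst trace_mul_sym) (simp only: matrix_mul_assoc)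
  then have "z_quot (x_of g g) * trace (dagger g ** tau a ** g)
      = z_quot (x_of g g) * sinhc (of_real r) * (2 * \<i> * of_real (p $ a))"
    by (simp add: tr)
  then show "z_quot (x_of g g) * trace (dagger g ** tau a ** g) = 2 * \<i> * of_real (p $ a)"
    by (simp only: z)  simp
  \<comment> \<open>Cyclicity shifts the SU(2) factors from \<open>Q\<close> to
    \<open>tau a\<close>, where they act as the rotation \<open>Lambda\<close>.\<close>
  have "trace (tau a ** dagger g ** g) = trace (U ** tau a ** V ** Q)"
  proof -
    have "trace (tau a ** dagger g ** g) = trace ((tau a ** dagger U ** Q) ** U)"
      unfolding matrix_mul_assoc[symmetric] gg' by (simp only: matrix_mul_assoc)
    then show ?thesis unfolding V by (subst (asm) trace_mul_sym) (simp only: matrix_mul_assoc)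
  qed
  also have "\<dots> = trace ((\<Sum>b\<in>UNIV. mat (of_real (Lambda \<theta> $ a $ b)) ** tau b) ** Q)"
    unfolding U_def V_def Lambda_eq ..
  also have "\<dots> = (\<Sum>b\<in>UNIV. of_real (Lambda \<theta> $ a $ b) * trace (tau b ** Q))"
    by (simp add: sum_3 mat2_simps algebra_simps)
  finally have "z_quot (x_of g g) * trace (tau a ** dagger g ** g)
      = z_quot (x_of g g) * sinhc (of_real r) * (2 * \<i> * of_real (\<Sum>b\<in>UNIV. Lambda \<theta> $ a $ b * p $ b))"
    by (simp add: tr sum_3 algebra_simps)
  then show "z_quot (x_of g g) * trace (tau a ** dagger g ** g)
      = 2 * \<i> * of_real (\<Sum>b\<in>UNIV. Lambda \<theta> $ a $ b * p $ b)"
    by (simp only: z) simp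
qed

text \<open>The vertex expression is 2 i times the real closure expression, so the two vanish
  together.\<close>

lemma vertex_condition_iff_closure:
  assumes "\<forall>e\<in>arcs \<gamma>. g1 e = g0 e" and "\<forall>e\<in>arcs \<gamma>. polar_coords (g1 e) (p e) (\<theta> e)"
  shows "vertex_condition \<gamma> g1 g0 \<longleftrightarrow> closure_condition \<gamma> p \<theta>"
proof -
  have "- (\<Sum>e\<in>out_arcs \<gamma> v. z_quot (x_of (g1 e) (g0 e)) * trace (dagger (g1 e) ** tau a ** g0 e))
      + (\<Sum>e\<in>in_arcs \<gamma> v. z_quot (x_of (g1 e) (g0 e)) * trace (tau a ** dagger (g1 e) ** g0 e))
    = 2 * \<i> * of_real (- (\<Sum>e\<in>out_arcs \<gamma> v. p e $ a)
      + (\<Sum>e\<in>in_arcs \<gamma> v. \<Sum>b\<in>UNIV. Lambda (\<theta> e) $ a $ b * p e $ b))" for v a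
  proof -
    have "(\<Sum>e\<in>out_arcs \<gamma> v. z_quot (x_of (g1 e) (g0 e)) * trace (dagger (g1 e) ** tau a ** g0 e))
        = (\<Sum>e\<in>out_arcs \<gamma> v. 2 * \<i> * of_real (p e $ a))"
      using assms by (intro sum.cong refl) (auto simp: polar_coords_traces(1)[where \<theta> = "\<theta> _"])
    moreover have "(\<Sum>e\<in>in_arcs \<gamma> v. z_quot (x_of (g1 e) (g0 e)) * trace (tau a ** dagger (g1 e) ** g0 e))
        = (\<Sum>e\<in>in_arcs \<gamma> v. 2 * \<i> * of_real (\<Sum>b\<in>UNIV. Lambda (\<theta> e) $ a $ b * p e $ b))"
    proof (rule sum.cong)
      fix e assume "e \<in> in_arcs \<gamma> v"
      then show "z_quot (x_of (g1 e) (g0 e)) * trace (tau a ** dagger (g1 e) ** g0 e)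
          = 2 * \<i> * of_real (\<Sum>b\<in>UNIV. Lambda (\<theta> e) $ a $ b * p e $ b)"
        using polar_coords_traces(2)[of "g1 e" "p e" "\<theta> e" a] assms by simp
    qed simp
    ultimately show ?thesis by (simp add: sum_distrib_left[symmetric] right_diff_distrib)
  qed
  then show ?thesis
    unfolding vertex_condition_def closure_condition_def by (simp only:) (simp del: of_real_add of_real_minus of_real_sum)
qed

theorem mainTheorem4:
  fixes \<gamma> :: "('v, 'e) pre_digraph"
    and \<mu> :: "mat2 measure"
    and H :: "(('e \<Rightarrow> mat2) \<Rightarrow> complex) \<Rightarrow> (('e \<Rightarrow> mat2) \<Rightarrow> complex)"
    and D :: "(('e \<Rightarrow> mat2) \<Rightarrow> complex) set"
    and \<kappa> \<Delta>\<tau> len t :: real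
    and N :: nat
    and g' gfin :: "'e \<Rightarrow> mat2"
    and g :: "nat \<Rightarrow> 'e \<Rightarrow> mat2"
    and h :: "'v \<Rightarrow> mat2"
  defines "G \<equiv> slice \<gamma> N gfin g' g h"
    and "c \<equiv> \<i> * complex_of_real \<kappa> * complex_of_real \<Delta>\<tau> / complex_of_real (len\<^sup>2)"
  assumes lattice: "cubic_lattice \<gamma>"
    and haar: "haar_SU2 \<mu>"
    and params: "\<kappa> > 0" "\<Delta>\<tau> > 0" "len > 0" "t > 0" "N \<ge> 1"
    and H_sa: "self_adjoint_operator (SU2_edges \<gamma> \<mu>) D H"
    and H_dom: "\<And>k. (\<forall>e\<in>arcs \<gamma>. k e \<in> SL2C) \<Longrightarrow> coherent_state \<gamma> t k \<in> D"
    and bdry: "\<forall>e\<in>arcs \<gamma>. g' e \<in> SL2C" "\<forall>e\<in>arcs \<gamma>. gfin e \<in> SL2C"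
    and dom: "(g, h) \<in> action_domain \<gamma> \<mu> t N gfin g'"
  shows "(critical_point \<gamma> N (action \<gamma> \<mu> H \<kappa> \<Delta>\<tau> len t N gfin g') g h \<longleftrightarrow>
       (\<forall>i\<in>{1..N}. \<forall>e\<in>arcs \<gamma>. \<forall>a.
          Z_of a (G (i+1) e) (G i e) - W_of a (G i e) =
          c * wirtinger (\<lambda>\<epsilon>. H_ratio \<gamma> \<mu> H t (G (i+1)) (vary (G i) e (axis a \<epsilon>))) 0) \<and>
       (\<forall>i\<in>{2..N+1}. \<forall>e\<in>arcs \<gamma>. \<forall>a.
          Z_of a (G i e) (G (i-1) e) - W_of a (G i e) =
          - c * wirtinger_bar (\<lambda>\<epsilon>. H_ratio \<gamma> \<mu> H t (vary (G i) e (axis a \<epsilon>)) (G (i-1))) 0) \<and>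
       (\<forall>e\<in>arcs \<gamma>. \<forall>a.
          Z_of a (G (N+2) e) (G (N+1) e) - W_of a (G (N+1) e) = 0 \<and>
          Z_of a (G 1 e) (G 0 e) - W_of a (G 1 e) = 0) \<and>
       vertex_condition \<gamma> (G 1) (gauge_transform \<gamma> h g')) \<and>
     ((\<forall>e\<in>arcs \<gamma>. g 1 e = gauge_transform \<gamma> h g' e) \<longrightarrow>
       (\<forall>p \<theta> :: 'e \<Rightarrow> real^3. (\<forall>e\<in>arcs \<gamma>. polar_coords (g 1 e) (p e) (\<theta> e)) \<longrightarrow>
         (vertex_condition \<gamma> (G 1) (gauge_transform \<gamma> h g') \<longleftrightarrow>
          closure_condition \<gamma> p \<theta>)))"
proof (intro conjI impI allI)
  have fin: "fin_digraph \<gamma>" using lattice by (simp add: cubic_lattice_def)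
  then interpret fin_digraph \<gamma> .
  have gSL: "\<And>i e. i \<in> {1..N+1} \<Longrightarrow> e \<in> arcs \<gamma> \<Longrightarrow> g i e \<in> SL2C"
    and hSU: "\<forall>v\<in>verts \<gamma>. h v \<in> SU2"
    and cut: "\<And>j e. j \<le> N + 1 \<Longrightarrow> e \<in> arcs \<gamma> \<Longrightarrow> x_of (G (j + 1) e) (G j e) \<notin> complex_of_real ` {..-1}"
    and nz: "\<And>j. j \<in> {1..N} \<Longrightarrow> overlap \<gamma> \<mu> t (G (j + 1)) (G j) \<noteq> 0"
    using dom by (auto simp: action_domain_def configurations_def G_def Let_def)
  have G0: "G 0 = gauge_transform \<gamma> h g'" by (simp add: G_def slice_def)
  have SL: "\<forall>e\<in>arcs \<gamma>. G j e \<in> SL2C" if "j \<le> N + 2" for j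
  proof
    fix e assume e: "e \<in> arcs \<gamma>"
    have "j = 0 \<or> j = N + 2 \<or> (j \<noteq> N + 2 \<and> j \<in> {1..N+1})" using that by auto
    then consider "j = 0" | "j = N + 2" | "j \<noteq> N + 2" "j \<in> {1..N+1}" by blast
    then show "G j e \<in> SL2C"
    proof cases
      case 1
      have "h (tail \<gamma> e) \<in> SU2" "h (head \<gamma> e) \<in> SU2" "g' e \<in> SL2C" using hSU bdry e by auto
      then show ?thesis
        unfolding 1 G0 gauge_transform_def
        by (auto simp: matrix_inv_SU2 intro!: SL2C_mult intro: SU2_SL2C SU2_dagger)
    next
      case 2
      then show ?thesis using bdry e by (simp add: G_def slice_def)
    next
      case 3
      then show ?thesis using gSL e by (simp add: G_def slice_def)
    qed
  qed
  \<comment> \<open>With the value 0 where no matrix element of \<open>H\<close> occurs, both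
    conditions range over all of \<open>{1..N+1}\<close>, as \<open>critical_point\<close> does.
    Their exceptional indices, N + 1 for \<open>P\<close> and 1 for \<open>Q\<close>, are condition
    (3).\<close>
  define P where "P i e a \<longleftrightarrow> Z_of a (G (i+1) e) (G i e) - W_of a (G i e) =
      (if i \<le> N then c * wirtinger (\<lambda>\<epsilon>. H_ratio \<gamma> \<mu> H t (G (i+1)) (vary (G i) e (axis a \<epsilon>))) 0 else 0)" for i e a
  define Q where "Q i e a \<longleftrightarrow> Z_of a (G i e) (G (i-1) e) - W_of a (G i e) =
      (if 2 \<le> i then - c * wirtinger_bar (\<lambda>\<epsilon>. H_ratio \<gamma> \<mu> H t (vary (G i) e (axis a \<epsilon>)) (G (i-1))) 0 else 0)" for i e a
  have crit_g: "((\<lambda>\<epsilon>. action \<gamma> \<mu> H \<kappa> \<Delta>\<tau> len t N gfin g' (g(i := vary (g i) e \<epsilon>)) h) has_derivative (\<lambda>_. 0)) (at 0)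
      \<longleftrightarrow> (\<forall>a. P i e a \<and> Q i e a)" if "i \<in> {1..N+1}" "e \<in> arcs \<gamma>" for i e
  proof -
    have "((\<lambda>\<epsilon>. action \<gamma> \<mu> H \<kappa> \<Delta>\<tau> len t N gfin g' (g(i := vary (g i) e \<epsilon>)) h) has_derivative
      (\<lambda>\<xi>. (\<Sum>a\<in>UNIV. \<xi>$a * (Z_of a (G (i+1) e) (G i e) - W_of a (G i e) -
        (if i \<le> N then c * wirtinger (\<lambda>\<epsilon>. H_ratio \<gamma> \<mu> H t (G (i+1)) (vary (G i) e (axis a \<epsilon>))) 0 else 0)))
      + (\<Sum>a\<in>UNIV. cnj (\<xi>$a) * (W_of a (G i e) - Z_of a (G i e) (G (i-1) e) -
        (if 2 \<le> i then c * wirtinger_bar (\<lambda>\<epsilon>. H_ratio \<gamma> \<mu> H t (vary (G i) e (axis a \<epsilon>)) (G (i-1))) 0 else 0)))))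
      (at 0)"
      unfolding G_def c_def
      by (rule action_g_has_derivative[OF haar finite_arcs params(4) H_sa _ _ _ _ that])
        (fact H_dom, fact SL[unfolded G_def], fact cut[unfolded G_def], fact nz[unfolded G_def])
    then have "((\<lambda>\<epsilon>. action \<gamma> \<mu> H \<kappa> \<Delta>\<tau> len t N gfin g' (g(i := vary (g i) e \<epsilon>)) h) has_derivative (\<lambda>_. 0)) (at 0)
      \<longleftrightarrow> (\<forall>a. (Z_of a (G (i+1) e) (G i e) - W_of a (G i e) -
        (if i \<le> N then c * wirtinger (\<lambda>\<epsilon>. H_ratio \<gamma> \<mu> H t (G (i+1)) (vary (G i) e (axis a \<epsilon>))) 0 else 0)) = 0 \<and>
        W_of a (G i e) - Z_of a (G i e) (G (i-1) e) -
        (if 2 \<le> i then c * wirtinger_bar (\<lambda>\<epsilon>. H_ratio \<gamma> \<mu> H t (vary (G i) e (axis a \<epsilon>)) (G (i-1))) 0 else 0) = 0)"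
      unfolding linear_antilinear_zero_iff[symmetric] by (rule has_derivative_zero_iff)
    also have "\<dots> \<longleftrightarrow> (\<forall>a. P i e a \<and> Q i e a)"
      unfolding P_def Q_def by (auto simp: algebra_simps)
    finally show ?thesis .
  qed
  have crit_h: "(\<forall>v\<in>verts \<gamma>. ((\<lambda>\<eta>. action \<gamma> \<mu> H \<kappa> \<Delta>\<tau> len t N gfin g' g (vary h v (cvec \<eta>))) has_derivative (\<lambda>_. 0)) (at 0))
      \<longleftrightarrow> vertex_condition \<gamma> (G 1) (gauge_transform \<gamma> h g')"
  proof -
    have "((\<lambda>\<eta>. action \<gamma> \<mu> H \<kappa> \<Delta>\<tau> len t N gfin g' g (vary h v (cvec \<eta>))) has_derivative (\<lambda>_. 0)) (at 0)
      \<longleftrightarrow> (\<forall>a. - (\<Sum>e\<in>out_arcs \<gamma> v. z_quot (x_of (G 1 e) (G 0 e)) * trace (dagger (G 1 e) ** tau a ** G 0 e))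
       + (\<Sum>e\<in>in_arcs \<gamma> v. z_quot (x_of (G 1 e) (G 0 e)) * trace (tau a ** dagger (G 1 e) ** G 0 e)) = 0)"
      if "v \<in> verts \<gamma>" for v
      unfolding linear_zero_iff[symmetric] G_def
      by (rule has_derivative_zero_iff, rule action_h_has_derivative[OF fin _ _ hSU that])
        (fact SL[unfolded G_def], fact cut[unfolded G_def])
    then show ?thesis unfolding vertex_condition_def G0[symmetric] by simp
  qed
  have splitP: "(\<forall>i\<in>{1..N+1}. X i) \<longleftrightarrow> (\<forall>i\<in>{1..N}. X i) \<and> X (N+1)"
    and splitQ: "(\<forall>i\<in>{1..N+1}. X i) \<longleftrightarrow> (\<forall>i\<in>{2..N+1}. X i) \<and> X 1" for X
  proof -
    have P: "{1..N+1} = insert (N+1) {1..N}" and Q: "{1..N+1} = insert 1 {2..N+1}" by auto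
    show "(\<forall>i\<in>{1..N+1}. X i) \<longleftrightarrow> (\<forall>i\<in>{1..N}. X i) \<and> X (N+1)"
      unfolding P by blast
    show "(\<forall>i\<in>{1..N+1}. X i) \<longleftrightarrow> (\<forall>i\<in>{2..N+1}. X i) \<and> X 1"
      unfolding Q by blast
  qed
  have "critical_point \<gamma> N (action \<gamma> \<mu> H \<kappa> \<Delta>\<tau> len t N gfin g') g h \<longleftrightarrow>
      (\<forall>i\<in>{1..N+1}. \<forall>e\<in>arcs \<gamma>. \<forall>a. P i e a) \<and> (\<forall>i\<in>{1..N+1}. \<forall>e\<in>arcs \<gamma>. \<forall>a. Q i e a) \<and>
      vertex_condition \<gamma> (G 1) (gauge_transform \<gamma> h g')"
    unfolding critical_point_def crit_h using crit_g by blast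
  also have "(\<forall>i\<in>{1..N+1}. \<forall>e\<in>arcs \<gamma>. \<forall>a. P i e a) \<longleftrightarrow>
      (\<forall>i\<in>{1..N}. \<forall>e\<in>arcs \<gamma>. \<forall>a. Z_of a (G (i+1) e) (G i e) - W_of a (G i e) =
          c * wirtinger (\<lambda>\<epsilon>. H_ratio \<gamma> \<mu> H t (G (i+1)) (vary (G i) e (axis a \<epsilon>))) 0) \<and>
      (\<forall>e\<in>arcs \<gamma>. \<forall>a. Z_of a (G (N+2) e) (G (N+1) e) - W_of a (G (N+1) e) = 0)"
    unfolding splitP P_def by simp
  also have "(\<forall>i\<in>{1..N+1}. \<forall>e\<in>arcs \<gamma>. \<forall>a. Q i e a) \<longleftrightarrow>
      (\<forall>i\<in>{2..N+1}. \<forall>e\<in>arcs \<gamma>. \<forall>a. Z_of a (G i e) (G (i-1) e) - W_of a (G i e) =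
          - c * wirtinger_bar (\<lambda>\<epsilon>. H_ratio \<gamma> \<mu> H t (vary (G i) e (axis a \<epsilon>)) (G (i-1))) 0) \<and>
      (\<forall>e\<in>arcs \<gamma>. \<forall>a. Z_of a (G 1 e) (G 0 e) - W_of a (G 1 e) = 0)"
    unfolding splitQ Q_def by simp
  finally show "critical_point \<gamma> N (action \<gamma> \<mu> H \<kappa> \<Delta>\<tau> len t N gfin g') g h \<longleftrightarrow>
       (\<forall>i\<in>{1..N}. \<forall>e\<in>arcs \<gamma>. \<forall>a.
          Z_of a (G (i+1) e) (G i e) - W_of a (G i e) =
          c * wirtinger (\<lambda>\<epsilon>. H_ratio \<gamma> \<mu> H t (G (i+1)) (vary (G i) e (axis a \<epsilon>))) 0) \<and>
       (\<forall>i\<in>{2..N+1}. \<forall>e\<in>arcs \<gamma>. \<forall>a.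
          Z_of a (G i e) (G (i-1) e) - W_of a (G i e) =
          - c * wirtinger_bar (\<lambda>\<epsilon>. H_ratio \<gamma> \<mu> H t (vary (G i) e (axis a \<epsilon>)) (G (i-1))) 0) \<and>
       (\<forall>e\<in>arcs \<gamma>. \<forall>a.
          Z_of a (G (N+2) e) (G (N+1) e) - W_of a (G (N+1) e) = 0 \<and>
          Z_of a (G 1 e) (G 0 e) - W_of a (G 1 e) = 0) \<and>
       vertex_condition \<gamma> (G 1) (gauge_transform \<gamma> h g')"
    by blast
next
  fix p \<theta> :: "'e \<Rightarrow> real^3"
  assume "\<forall>e\<in>arcs \<gamma>. g 1 e = gauge_transform \<gamma> h g' e"
    and "\<forall>e\<in>arcs \<gamma>. polar_coords (g 1 e) (p e) (\<theta> e)"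
  moreover have "G 1 = g 1" by (simp add: G_def slice_def)
  ultimately show "vertex_condition \<gamma> (G 1) (gauge_transform \<gamma> h g') \<longleftrightarrow> closure_condition \<gamma> p \<theta>"
    by (simp only: vertex_condition_iff_closure)
qed

end
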